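(* Let $n\ge1$ and let $\lambda,\mu$ be partitions with $\lambda_1\le n$, $\mu_1\le n$. Let $v_{\widetilde\mu}$ be a highest weight vector of the irreducible $gl(n)$-module $Schur_\mu(n)$ of highest weight $\widetilde\mu$. Then: (i) if $|\mu|<|\lambda|$, then $\mathbf{K}_\lambda(n)(v_{\widetilde\mu})=0$; (ii) if $|\mu|=|\lambda|$ and $\mu\ntrianglerighteq\lambda$, then $\mathbf{K}_\lambda(n)(v_{\widetilde\mu})=0$; (iii) if $\mu=\lambda\vdash k$, then $\mathbf{K}_\lambda(n)(v_{\widetilde\lambda})=(-1)^{\binom k2}H(\lambda)\cdot v_{\widetilde\lambda}$. Here $\trianglelefteq$ is the dominance order on partitions and $H(\lambda)=H(\widetilde\lambda)$ is the product of the hook lengths of the cells of the Ferrers diagram of $\lambda$.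
   Context: Virtual method. $gl(m_0|m_1+n)$ ($m_0,m_1$ sufficiently large) is the complex general linear Lie superalgebra with basis $e_{a,b}$, $a,b\in A_0\cup A_1\cup L$, $A_0=\{\alpha_1,\dots,\alpha_{m_0}\}$ (parity $0$), $A_1=\{\beta_1,\dots,\beta_{m_1}\}$ (parity $1$), $L=\{1,\dots,n\}$ (parity $1$), $|e_{a,b}|=|a|+|b|$, and $[e_{a,b},e_{c,d}]=\delta_{bc}e_{a,d}-(-1)^{(|a|+|b|)(|c|+|d|)}\delta_{ad}e_{c,b}$. Symbols in $A_0\cup A_1$ are virtual. $gl(n)$ is the subalgebra spanned by $e_{i,j}$, $i,j\in L$, so $\mathbf{U}(gl(n))\subset\mathbf{U}(gl(m_0|m_1+n))$. A product $e_{a_M,b_M}\cdots e_{a_1,b_1}$ is irregular if there are $i\le M$ and a virtual symbol $\gamma$ with $\#\{j\le i: b_j=\gamma\}>\#\{j<i: a_j=\gamma\}$. Let $\mathbf{Irr}$ be the left ideal of $\mathbf{U}(gl(m_0|m_1+n))$ generated by irregular products. The sum $Virt(m_0+m_1,n)=\mathbf{U}(gl(n))\oplus\mathbf{Irr}$ is direct and is a subalgebra in which $\mathbf{Irr}$ is a two-sided ideal; $\mathfrak p:Virt(m_0+m_1,n)\to\mathbf{U}(gl(n))$ is the projection with kernel $\mathbf{Irr}$ (an algebra epimorphism). All monomials to which $\mathfrak p$ is applied here lie in $Virt(m_0+m_1,n)$. Tableaux. For two Young tableaux $S,T$ of the same shape $\lambda$ (row $i$ has $\lambda_i$ cells), $e_{S,T}$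 is the product of the $e_{s,t}$, $s,t$ being the entries of $S,T$ in the same cell, the cells being read row by row from top to bottom and from left to right in each row. $C^*_\lambda$ is the tableau of shape $\lambda$ all of whose entries in row $i$ equal $\alpha_i$ ($m_0\ge\widetilde\lambda_1$). For $\lambda_1\le n$, $$\mathbf{K}_\lambda(n)=\sum_S\mathfrak p\big(e_{S,C^*_\lambda}\cdot e_{C^*_\lambda,S}\big)\in\mathbf{U}(gl(n)),$$ the sum being over all tableaux $S$ of shape $\lambda$ with entries in $\{1,\dots,n\}$ whose rows are strictly increasing; $\mathbf{K}_\emptyset(n)=1$. These elements are central in $\mathbf{U}(gl(n))$. For a partition $\mu$ with $\mu_1\le n$, $Schur_\mu(n)$ is the irreducible $gl(n)$-module of highest weight $\widetilde\mu$ (the conjugate partition, padded by zeros to length $n$). *)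

theory Defs
  imports "HOL-Library.Poly_Mapping" "HOL-Algebra.QuotRing" Complex_Main
begin

definition is_partition :: "nat list \<Rightarrow> bool" where
  "is_partition lam \<longleftrightarrow> sorted_wrt (\<ge>) lam \<and> 0 \<notin> set lam"

text \<open>Parts are numbered from 1; \<open>part lam i = 0\<close> beyond the length.\<close>

definition part :: "nat list \<Rightarrow> nat \<Rightarrow> nat" where
  "part lam i = (if 1 \<le> i \<and> i \<le> length lam then lam ! (i - 1) else 0)"

definition conjugate :: "nat list \<Rightarrow> nat list" where
  "conjugate lam = map (\<lambda>j. card {i \<in> {1..length lam}. j \<le> part lam i}) [1..<Suc (part lam 1)]"

definition dominated_by :: "nat list \<Rightarrow> nat list \<Rightarrow> bool"  (infix \<open>\<unlhd>\<^sub>d\<close> 50) where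
  "lam \<unlhd>\<^sub>d mu \<longleftrightarrow> sum_list lam = sum_list mu \<and>
     (\<forall>k. (\<Sum>i=1..k. part lam i) \<le> (\<Sum>i=1..k. part mu i))"

definition cells :: "nat list \<Rightarrow> (nat \<times> nat) set" where
  "cells lam = {(i, j). 1 \<le> i \<and> i \<le> length lam \<and> 1 \<le> j \<and> j \<le> part lam i}"

definition hook_length :: "nat list \<Rightarrow> nat \<times> nat \<Rightarrow> nat" where
  "hook_length lam = (\<lambda>(i, j). (part lam i - j) + (part (conjugate lam) j - i) + 1)"

definition hook_product :: "nat list \<Rightarrow> nat" where
  "hook_product lam = (\<Prod>c\<in>cells lam. hook_length lam c)"

datatype glsym = Alpha (idx: nat) | Beta (idx: nat) | Letter (idx: nat)

fun parity :: "glsym \<Rightarrow> nat" where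
  "parity (Alpha _) = 0"
| "parity (Beta _) = 1"
| "parity (Letter _) = 1"

definition virtual_syms :: "nat \<Rightarrow> nat \<Rightarrow> glsym set" where
  "virtual_syms m0 m1 = Alpha ` {1..m0} \<union> Beta ` {1..m1}"

definition syms :: "nat \<Rightarrow> nat \<Rightarrow> nat \<Rightarrow> glsym set" where
  "syms m0 m1 n = virtual_syms m0 m1 \<union> Letter ` {1..n}"

text \<open>Lists form a monoid under concatenation; the convolution product of finitely supported
  functions on words is then the product of the free associative algebra.\<close>

instantiation list :: (type) monoid_add
begin
definition zero_list :: "'a list" where "zero_list = []"
definition plus_list :: "'a list \<Rightarrow> 'a list \<Rightarrow> 'a list" where "plus_list = append"
instance by standard (simp_all add: zero_list_def plus_list_def)
end

type_synonym gl_word = "(glsym \<times> glsym) list"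
type_synonym gl_poly = "gl_word \<Rightarrow>\<^sub>0 complex"

text \<open>The tensor algebra of \<open>gl(m0|m1+n)\<close>: the free algebra on the basis \<open>e\<^sub>a\<^sub>b\<close>. The pair
  \<open>(a, b)\<close> as a letter of a word stands for \<open>e\<^sub>a\<^sub>b\<close>.\<close>

definition tensor_alg :: "nat \<Rightarrow> nat \<Rightarrow> nat \<Rightarrow> gl_poly ring" where
  "tensor_alg m0 m1 n =
     \<lparr>carrier = {f. \<forall>w\<in>Poly_Mapping.keys f. set w \<subseteq> syms m0 m1 n \<times> syms m0 m1 n},
      monoid.mult = (*), one = 1, zero = 0, add = (+)\<rparr>"

definition word :: "gl_word \<Rightarrow> gl_poly" where
  "word w = Poly_Mapping.single w 1"

definition gen :: "glsym \<Rightarrow> glsym \<Rightarrow> gl_poly" where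
  "gen a b = word [(a, b)]"

definition super_sign :: "glsym \<Rightarrow> glsym \<Rightarrow> glsym \<Rightarrow> glsym \<Rightarrow> gl_poly" where
  "super_sign a b c d = (- 1) ^ ((parity a + parity b) * (parity c + parity d))"

definition gl_bracket :: "glsym \<Rightarrow> glsym \<Rightarrow> glsym \<Rightarrow> glsym \<Rightarrow> gl_poly" where
  "gl_bracket a b c d =
     (if b = c then gen a d else 0) - super_sign a b c d * (if a = d then gen c b else 0)"

definition gl_relations :: "nat \<Rightarrow> nat \<Rightarrow> nat \<Rightarrow> gl_poly set" where
  "gl_relations m0 m1 n =
     {gen a b * gen c d - super_sign a b c d * (gen c d * gen a b) - gl_bracket a b c d | a b c d.
        a \<in> syms m0 m1 n \<and> b \<in> syms m0 m1 n \<and> c \<in> syms m0 m1 n \<and> d \<in> syms m0 m1 n}"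

definition gl_ideal :: "nat \<Rightarrow> nat \<Rightarrow> nat \<Rightarrow> gl_poly set" where
  "gl_ideal m0 m1 n = genideal (tensor_alg m0 m1 n) (gl_relations m0 m1 n)"

definition U :: "nat \<Rightarrow> nat \<Rightarrow> nat \<Rightarrow> gl_poly set ring" where
  "U m0 m1 n = tensor_alg m0 m1 n Quot gl_ideal m0 m1 n"

definition U_class :: "nat \<Rightarrow> nat \<Rightarrow> nat \<Rightarrow> gl_poly \<Rightarrow> gl_poly set" where
  "U_class m0 m1 n f = gl_ideal m0 m1 n +>\<^bsub>tensor_alg m0 m1 n\<^esub> f"

text \<open>\<open>U 0 0 n\<close> is the enveloping algebra of \<open>gl(n)\<close> (all symbols have parity 1, so all generators
  are even); \<open>U_incl\<close> is its canonical map into \<open>U m0 m1 n\<close>.\<close>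

abbreviation Ugl :: "nat \<Rightarrow> gl_poly set ring" where
  "Ugl n \<equiv> U 0 0 n"

definition U_incl :: "nat \<Rightarrow> nat \<Rightarrow> nat \<Rightarrow> gl_poly set \<Rightarrow> gl_poly set" where
  "U_incl m0 m1 n u = the_elem (U_class m0 m1 n ` u)"

text \<open>The word \<open>w\<close> lists the factors of \<open>e\<^bsub>a_M,b_M\<^esub> \<cdots> e\<^bsub>a_1,b_1\<^esub>\<close> from left to right, so
  \<open>(a_(j+1), b_(j+1)) = rev w ! j\<close>.\<close>

definition irregular :: "nat \<Rightarrow> nat \<Rightarrow> gl_word \<Rightarrow> bool" where
  "irregular m0 m1 w \<longleftrightarrow> (\<exists>i<length w. \<exists>g\<in>virtual_syms m0 m1.
     card {j. j \<le> i \<and> snd (rev w ! j) = g} > card {j. j < i \<and> fst (rev w ! j) = g})"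

definition left_ideal_gen :: "('a, 'b) ring_scheme \<Rightarrow> 'a set \<Rightarrow> 'a set" where
  "left_ideal_gen R S = \<Inter>{J. additive_subgroup J R \<and>
     (\<forall>x\<in>carrier R. \<forall>y\<in>J. x \<otimes>\<^bsub>R\<^esub> y \<in> J) \<and> S \<subseteq> J}"

definition Irr :: "nat \<Rightarrow> nat \<Rightarrow> nat \<Rightarrow> gl_poly set set" where
  "Irr m0 m1 n = left_ideal_gen (U m0 m1 n)
     {U_class m0 m1 n (word w) | w.
        set w \<subseteq> syms m0 m1 n \<times> syms m0 m1 n \<and> irregular m0 m1 w}"

text \<open>The projection of \<open>U(gl(n)) \<oplus> Irr\<close> onto \<open>U(gl(n))\<close> along \<open>Irr\<close>; only meaningful for
  arguments in this direct sum.\<close>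

definition virt_proj :: "nat \<Rightarrow> nat \<Rightarrow> nat \<Rightarrow> gl_poly set \<Rightarrow> gl_poly set" where
  "virt_proj m0 m1 n x =
     (THE u. u \<in> carrier (Ugl n) \<and> x \<ominus>\<^bsub>U m0 m1 n\<^esub> U_incl m0 m1 n u \<in> Irr m0 m1 n)"

text \<open>A tableau is the list of its rows.\<close>

definition row_strict_tableaux :: "nat \<Rightarrow> nat list \<Rightarrow> nat list list set" where
  "row_strict_tableaux n lam =
     {S. map length S = lam \<and> (\<forall>r\<in>set S. sorted_wrt (<) r \<and> set r \<subseteq> {1..n})}"

definition bitableau_monomial ::
  "nat \<Rightarrow> nat \<Rightarrow> nat \<Rightarrow> glsym list list \<Rightarrow> glsym list list \<Rightarrow> gl_poly set" where
  "bitableau_monomial m0 m1 n S T = U_class m0 m1 n (word (zip (concat S) (concat T)))"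

definition C_star :: "nat list \<Rightarrow> glsym list list" where
  "C_star lam = map (\<lambda>i. replicate (part lam i) (Alpha i)) [1..<Suc (length lam)]"

definition K_elem :: "nat \<Rightarrow> nat \<Rightarrow> nat \<Rightarrow> nat list \<Rightarrow> gl_poly set" where
  "K_elem m0 m1 n lam =
     (\<Oplus>\<^bsub>Ugl n\<^esub>S\<in>row_strict_tableaux n lam. virt_proj m0 m1 n
        (bitableau_monomial m0 m1 n (map (map Letter) S) (C_star lam) \<otimes>\<^bsub>U m0 m1 n\<^esub>
         bitableau_monomial m0 m1 n (C_star lam) (map (map Letter) S)))"

text \<open>\<open>E i j\<close> is the action of the matrix unit \<open>e\<^sub>i\<^sub>j\<close>.\<close>

locale gl_module = vector_space scale
  for scale :: "complex \<Rightarrow> 'v::ab_group_add \<Rightarrow> 'v" +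
  fixes n :: nat and E :: "nat \<Rightarrow> nat \<Rightarrow> 'v \<Rightarrow> 'v"
  assumes E_linear: "\<lbrakk>i \<in> {1..n}; j \<in> {1..n}\<rbrakk> \<Longrightarrow> Vector_Spaces.linear scale scale (E i j)"
    and E_bracket: "\<lbrakk>i \<in> {1..n}; j \<in> {1..n}; k \<in> {1..n}; l \<in> {1..n}\<rbrakk> \<Longrightarrow>
      E i j (E k l v) - E k l (E i j v) =
        (if j = k then E i l v else 0) - (if i = l then E k j v else 0)"

definition gl_irreducible ::
  "(complex \<Rightarrow> 'v::ab_group_add \<Rightarrow> 'v) \<Rightarrow> nat \<Rightarrow> (nat \<Rightarrow> nat \<Rightarrow> 'v \<Rightarrow> 'v) \<Rightarrow> bool" where
  "gl_irreducible scale n E \<longleftrightarrow> gl_module scale n E \<and> (\<exists>v::'v. v \<noteq> 0) \<and>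
     (\<forall>W. module.subspace scale W \<and> (\<forall>i\<in>{1..n}. \<forall>j\<in>{1..n}. \<forall>v\<in>W. E i j v \<in> W)
        \<longrightarrow> W = {0} \<or> W = UNIV)"

definition highest_weight_vector ::
  "(complex \<Rightarrow> 'v::ab_group_add \<Rightarrow> 'v) \<Rightarrow> nat \<Rightarrow> (nat \<Rightarrow> nat \<Rightarrow> 'v \<Rightarrow> 'v) \<Rightarrow> (nat \<Rightarrow> complex) \<Rightarrow> 'v \<Rightarrow> bool"
  where
  "highest_weight_vector scale n E wt v \<longleftrightarrow> v \<noteq> 0 \<and>
     (\<forall>i\<in>{1..n}. E i i v = scale (wt i) v) \<and>
     (\<forall>i\<in>{1..n}. \<forall>j\<in>{1..n}. i < j \<longrightarrow> E i j v = 0)"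

definition poly_act ::
  "(complex \<Rightarrow> 'v::ab_group_add \<Rightarrow> 'v) \<Rightarrow> (nat \<Rightarrow> nat \<Rightarrow> 'v \<Rightarrow> 'v) \<Rightarrow> gl_poly \<Rightarrow> 'v \<Rightarrow> 'v" where
  "poly_act scale E f v = (\<Sum>w\<in>Poly_Mapping.keys f.
     scale (Poly_Mapping.lookup f w) (foldr (\<lambda>(a, b). E (idx a) (idx b)) w v))"

text \<open>The action of an element of \<open>Ugl n\<close>, i.e. of a class in the tensor algebra, through any of its
  representatives.\<close>

definition U_act ::
  "(complex \<Rightarrow> 'v::ab_group_add \<Rightarrow> 'v) \<Rightarrow> (nat \<Rightarrow> nat \<Rightarrow> 'v \<Rightarrow> 'v) \<Rightarrow> gl_poly set \<Rightarrow> 'v \<Rightarrow> 'v" where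
  "U_act scale E u v = the_elem ((\<lambda>f. poly_act scale E f v) ` u)"

end

theory Submission
  imports Defs "HOL-Library.Function_Algebras" "HOL-Library.Product_Plus" "HOL-Library.Multiset"
begin

text \<open>The whole of \<open>gl(m0|m1+n)\<close> acts on super tensor space, where a word that is irregular in a virtual
  symbol kills every tensor without virtual symbols, because the number of occurrences of that symbol
  would become negative. Elements of \<open>U(gl(n))\<close> are separated by their action on such tensors once an
  inert letter is added, so the virtual projection is well defined and its values act on tensors
  without virtual symbols in the same way as the unprojected monomials.

  An element of weight zero acts on a highest weight vector by a scalar that depends on the weight
  only (compare two modules by looking at the pair of their highest weight vectors in the direct
  sum), so it suffices to compute in tensor space. The summand of a tableau \<open>S\<close> removes the letters
  of \<open>S\<close>; it vanishes unless the content of \<open>S\<close> is bounded by the weight, and counting the letters in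
  the first \<open>r\<close> rows of \<open>S\<close> then gives the dominance inequalities. For \<open>mu = lam\<close> a single tableau
  survives. Reordering its anticommuting factors so that a cell \<open>(p, j)\<close> is annihilated right after
  it has been created, each such pair contributes the weight of \<open>e\<^sub>j\<^sub>j + e\<^sub>\<alpha>\<^sub>\<alpha>\<close>, \<open>\<alpha> = \<alpha>\<^sub>p\<close>, which is
  the hook length of the cell; the reordering produces the sign.\<close>

subsection \<open>Super tensor space\<close>

text \<open>The projection is a definite description, so every summand needs existence and
  uniqueness of its value. Existence comes from rewriting: modulo \<open>Irr\<close>, every word
  becomes a combination of words whose virtual symbols occur only as first entries. In the monomials
  at hand each symbol is as often a first as a second entry; this balance survives the rewriting, so
  no virtual symbol can remain. Balance is also what gives weight zero. Uniqueness says that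
  U(gl(n)) meets \<open>Irr\<close> only in 0, hence the need for a faithful module. The inert
  letter adds a trivial summand to the natural module, and its coordinate serves to subtract the
  action of the identity on a tensor factor.

  As letters are odd and the \<alpha> even, all factors e_{\<alpha>,j} and e_{j,\<alpha>} are odd;
  those of one kind anticommute and square to zero, which drives every vanishing argument. Both
  words read the cells in the same order, whereas cancelling pairs from the inside outwards needs
  opposite orders. Reversing k anticommuting factors takes binomial(k, 2) transpositions: this is
  the sign.\<close>

type_synonym tens = "glsym list \<Rightarrow> complex"

text \<open>A tensor is given by its coefficients, so \<open>ten_act a b\<close> is the action of \<open>e\<^sub>a\<^sub>b\<close> in transposed form:
  the coefficient at a word collects the words in which one \<open>a\<close> is replaced by \<open>b\<close>. All indices are
  allowed here, in particular \<open>Letter 0\<close>.\<close>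

fun ten_act :: "glsym \<Rightarrow> glsym \<Rightarrow> tens \<Rightarrow> tens" where
  "ten_act a b x [] = 0"
| "ten_act a b x (c # l) = (if c = a then x (b # l) else 0)
     + (- 1) ^ ((parity a + parity b) * parity c) * ten_act a b (\<lambda>u. x (c # u)) l"

definition ten_scale :: "complex \<Rightarrow> tens \<Rightarrow> tens" where
  "ten_scale k x = (\<lambda>l. k * x l)"

interpretation ten: vector_space ten_scale
  by unfold_locales (auto simp: ten_scale_def fun_eq_iff algebra_simps)

lemma ten_act_add: "ten_act a b (\<lambda>u. x u + y u) l = ten_act a b x l + ten_act a b y l"
  by (induction l arbitrary: x y) (auto simp: algebra_simps)

lemma ten_act_mult: "ten_act a b (\<lambda>u. k * x u) l = k * ten_act a b x l"
proof (induction l arbitrary: x)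
  case (Cons c l)
  show ?case by (simp add: Cons algebra_simps)
qed simp

lemma ten_act_0: "ten_act a b (\<lambda>u. 0) l = 0"
  using ten_act_mult[of a b 0 "\<lambda>_. 0" l] by simp

lemma ten_act_linear: "Vector_Spaces.linear ten_scale ten_scale (ten_act a b)"
  by unfold_locales
    (auto simp: ten_scale_def fun_eq_iff algebra_simps ten_act_mult plus_fun_def ten_act_add)

lemma ten_act_if: "ten_act a b (\<lambda>u. if P then x u else 0) l = (if P then ten_act a b x l else 0)"
  by (simp add: ten_act_0)

definition bsign :: "glsym \<Rightarrow> glsym \<Rightarrow> glsym \<Rightarrow> glsym \<Rightarrow> complex" where
  "bsign a b c d = (- 1) ^ ((parity a + parity b) * (parity c + parity d))"

definition psign :: "glsym \<Rightarrow> glsym \<Rightarrow> complex" where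
  "psign a b = (- 1) ^ (parity a * parity b)"

lemma psign_commute: "psign a b = psign b a"
  by (simp add: psign_def mult.commute)

lemma psign_square [simp]: "psign a b * psign a b = 1"
  by (simp add: psign_def flip: power_add mult_2)

lemma psign_square_left [simp]: "psign a b * (psign a b * z) = z"
  by (simp flip: mult.assoc)

lemma psign_add: "(- 1) ^ ((parity a + parity b) * parity c) = psign a c * psign b c"
  by (simp add: psign_def power_add add_mult_distrib)

lemma bsign_psign: "bsign a b c d = psign a c * psign a d * psign b c * psign b d"
  by (simp add: bsign_def psign_def power_add algebra_simps)

text \<open>Hits at two different positions supercommute, because moving one operator past the
  letter changed by the other costs exactly \<open>bsign\<close>; hits at the same position give the
  bracket. The induction splits off the first letter, with \<open>x\<close> generalized to cover its
  slices.\<close>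

lemma ten_act_bracket_at:
  "ten_act a b (ten_act c d x) l - bsign a b c d * ten_act c d (ten_act a b x) l =
     (if b = c then ten_act a d x l else 0) - bsign a b c d * (if a = d then ten_act c b x l else 0)"
proof (induction l arbitrary: x)
  case Nil
  show ?case by simp
next
  case (Cons k l)
  have expand: "ten_act a b (ten_act c d x) (k # l) =
      (if k = a then (if b = c then x (d # l) else 0)
          + psign c b * psign d b * ten_act c d (\<lambda>u. x (b # u)) l else 0)
      + psign a k * psign b k *
        ((if k = c then ten_act a b (\<lambda>u. x (d # u)) l else 0)
          + psign c k * psign d k * ten_act a b (ten_act c d (\<lambda>u. x (k # u))) l)"
    for a b c d x
    by (simp add: ten_act_add ten_act_mult ten_act_if psign_add)
  have IH: "ten_act a b (ten_act c d (\<lambda>u. x (k # u))) l =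
      bsign a b c d * ten_act c d (ten_act a b (\<lambda>u. x (k # u))) l
      + (if b = c then ten_act a d (\<lambda>u. x (k # u)) l else 0)
      - bsign a b c d * (if a = d then ten_act c b (\<lambda>u. x (k # u)) l else 0)"
    using Cons[of "\<lambda>u. x (k # u)"] by (simp add: algebra_simps)
  show ?case
    unfolding expand IH unfolding ten_act.simps psign_add bsign_psign
    by (cases "b = c"; cases "a = d"; cases "k = a"; cases "k = c")
      (simp_all add: algebra_simps psign_commute)
qed

lemma ten_act_bracket:
  "ten_act a b (ten_act c d x) - ten_scale (bsign a b c d) (ten_act c d (ten_act a b x)) =
     (if b = c then ten_act a d x else 0) - ten_scale (bsign a b c d) (if a = d then ten_act c b x else 0)"
  using ten_act_bracket_at[of a b c d x] by (auto simp: fun_eq_iff ten_scale_def)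

text \<open>A weight condition with an integer bound: the bookkeeping may run below 0, and there it
  forces the tensor to vanish. The zero tensor has every count.\<close>

definition has_count :: "glsym \<Rightarrow> int \<Rightarrow> tens \<Rightarrow> bool" where
  "has_count s c x \<longleftrightarrow> (\<forall>l. x l \<noteq> 0 \<longrightarrow> int (count_list l s) = c)"

lemma has_count_neg: "has_count s c x \<Longrightarrow> c < 0 \<Longrightarrow> x = 0"
  by (auto simp: has_count_def fun_eq_iff)

lemma has_count_Cons:
  "has_count s c x \<Longrightarrow> has_count s (c - (if k = s then 1 else 0)) (\<lambda>u. x (k # u))"
  by (auto simp: has_count_def)

lemma ten_act_has_count:
  assumes "has_count s c x"
  shows "has_count s (c + (if a = s then 1 else 0) - (if b = s then 1 else 0)) (ten_act a b x)"
proof -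
  have "ten_act a b x l \<noteq> 0 \<Longrightarrow>
     int (count_list l s) = c + (if a = s then 1 else 0) - (if b = s then 1 else 0)" for l
    using assms
  proof (induction l arbitrary: x c)
    case (Cons k l)
    show ?case
    proof (cases "ten_act a b (\<lambda>u. x (k # u)) l = 0")
      case True
      then have "k = a" "x (b # l) \<noteq> 0" using Cons.prems by (auto split: if_splits)
      then show ?thesis using Cons.prems(2) by (force simp: has_count_def)
    next
      case False
      from Cons.IH[OF False has_count_Cons[OF Cons.prems(2)]] show ?thesis by (auto split: if_splits)
    qed
  qed simp
  then show ?thesis by (simp add: has_count_def)
qed

lemma ten_act_diag:
  assumes "has_count s c x"
  shows "ten_act s s x = ten_scale (of_int c) x"
proof -
  have "ten_act s s x l = of_int c * x l" for l
    using assms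
  proof (induction l arbitrary: x c)
    case Nil
    then show ?case by (cases "x [] = 0") (auto simp: has_count_def)
  next
    case (Cons k l)
    have "even (parity s + parity s)" by simp
    then have "ten_act s s x (k # l) = (if k = s then x (s # l) else 0) + ten_act s s (\<lambda>u. x (k # u)) l"
      by simp
    also have "ten_act s s (\<lambda>u. x (k # u)) l = of_int (c - (if k = s then 1 else 0)) * x (k # l)"
      by (rule Cons.IH[OF has_count_Cons[OF Cons.prems]])
    finally show ?case by (cases "k = s") (simp_all add: algebra_simps)
  qed
  then show ?thesis by (simp add: fun_eq_iff ten_scale_def)
qed

text \<open>Each term of the action consumes one \<open>s\<close>, and there is none. In the
  induction the slice at the letter \<open>s\<close> has count -1 and is therefore 0.\<close>

lemma ten_act_count_0:
  assumes "has_count s 0 x"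
  shows "ten_act a s x = 0"
proof -
  have "ten_act a s x l = 0" for l
    using assms
  proof (induction l arbitrary: x)
    case (Cons k l)
    have "x (s # l) = 0" using Cons.prems by (force simp: has_count_def)
    moreover have "ten_act a s (\<lambda>u. x (k # u)) l = 0"
    proof (cases "k = s")
      case True
      have "(\<lambda>u. x (k # u)) = 0"
        by (rule has_count_neg[OF has_count_Cons[OF Cons.prems, of k]]) (simp add: True)
      then show ?thesis by (simp add: zero_fun_def ten_act_0)
    qed (use Cons.IH[of "\<lambda>u. x (k # u)"] has_count_Cons[OF Cons.prems, of k] in simp)
    ultimately show ?case by simp
  qed simp
  then show ?thesis by (simp add: fun_eq_iff)
qed

subsection \<open>Modules over the free algebra\<close>

lemma in_tensor_carrier:
  "f \<in> carrier (tensor_alg m0 m1 n) \<longleftrightarrow>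
     (\<forall>w\<in>Poly_Mapping.keys f. set w \<subseteq> syms m0 m1 n \<times> syms m0 m1 n)"
  by (simp add: tensor_alg_def)

lemma tensor_simps [simp]:
  "monoid.mult (tensor_alg m0 m1 n) = (*)" "one (tensor_alg m0 m1 n) = 1"
  "zero (tensor_alg m0 m1 n) = 0" "add (tensor_alg m0 m1 n) = (+)"
  by (simp_all add: tensor_alg_def)

lemma tensor_add_closed:
  "f \<in> carrier (tensor_alg m0 m1 n) \<Longrightarrow> g \<in> carrier (tensor_alg m0 m1 n) \<Longrightarrow>
     f + g \<in> carrier (tensor_alg m0 m1 n)"
  using Poly_Mapping.keys_add[of f g] by (fastforce simp: in_tensor_carrier)

lemma tensor_uminus_closed:
  "f \<in> carrier (tensor_alg m0 m1 n) \<Longrightarrow> - f \<in> carrier (tensor_alg m0 m1 n)"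
  by (auto simp: in_tensor_carrier in_keys_iff)

lemma tensor_diff_closed:
  "f \<in> carrier (tensor_alg m0 m1 n) \<Longrightarrow> g \<in> carrier (tensor_alg m0 m1 n) \<Longrightarrow>
     f - g \<in> carrier (tensor_alg m0 m1 n)"
  using tensor_add_closed[of f m0 m1 n "- g"] tensor_uminus_closed[of g m0 m1 n] by simp

lemma tensor_mult_closed:
  assumes "f \<in> carrier (tensor_alg m0 m1 n)" "g \<in> carrier (tensor_alg m0 m1 n)"
  shows "f * g \<in> carrier (tensor_alg m0 m1 n)"
  unfolding in_tensor_carrier
proof
  fix w assume "w \<in> Poly_Mapping.keys (f * g)"
  then obtain u v where "w = u @ v" "u \<in> Poly_Mapping.keys f" "v \<in> Poly_Mapping.keys g"
    using Poly_Mapping.keys_mult[of f g] by (auto simp: plus_list_def)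
  then show "set w \<subseteq> syms m0 m1 n \<times> syms m0 m1 n"
    using assms by (auto simp: in_tensor_carrier)
qed

lemma tensor_single_closed:
  "set w \<subseteq> syms m0 m1 n \<times> syms m0 m1 n \<Longrightarrow> Poly_Mapping.single w c \<in> carrier (tensor_alg m0 m1 n)"
  by (simp add: in_tensor_carrier)

lemma tensor_word_closed:
  "set w \<subseteq> syms m0 m1 n \<times> syms m0 m1 n \<Longrightarrow> word w \<in> carrier (tensor_alg m0 m1 n)"
  by (simp add: word_def tensor_single_closed)

lemma tensor_0_closed: "0 \<in> carrier (tensor_alg m0 m1 n)"
  by (simp add: in_tensor_carrier)

lemma tensor_sum_closed:
  "(\<And>i. i \<in> A \<Longrightarrow> f i \<in> carrier (tensor_alg m0 m1 n)) \<Longrightarrow> sum f A \<in> carrier (tensor_alg m0 m1 n)"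
  by (induction A rule: infinite_finite_induct) (auto simp: tensor_0_closed intro: tensor_add_closed)

lemma tensor_ring: "ring (tensor_alg m0 m1 n)"
proof (rule ringI)
  show "abelian_group (tensor_alg m0 m1 n)"
  proof (rule abelian_groupI)
    fix x assume "x \<in> carrier (tensor_alg m0 m1 n)"
    then show "\<exists>y\<in>carrier (tensor_alg m0 m1 n). y \<oplus>\<^bsub>tensor_alg m0 m1 n\<^esub> x = \<zero>\<^bsub>tensor_alg m0 m1 n\<^esub>"
      by (intro bexI[of _ "- x"]) (auto simp: tensor_uminus_closed)
  qed (auto simp: tensor_add_closed tensor_0_closed add_ac)
  show "monoid (tensor_alg m0 m1 n)"
    by (rule monoidI) (auto simp: tensor_mult_closed mult.assoc in_tensor_carrier[of 1] zero_list_def)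
qed (auto simp: algebra_simps)

lemma tensor_a_inv:
  assumes "f \<in> carrier (tensor_alg m0 m1 n)"
  shows "\<ominus>\<^bsub>tensor_alg m0 m1 n\<^esub> f = - f"
proof -
  interpret ring "tensor_alg m0 m1 n" by (rule tensor_ring)
  show ?thesis
    by (rule minus_equality) (use assms tensor_uminus_closed in auto)
qed

lemma tensor_minus:
  "f \<in> carrier (tensor_alg m0 m1 n) \<Longrightarrow> g \<in> carrier (tensor_alg m0 m1 n) \<Longrightarrow>
    f \<ominus>\<^bsub>tensor_alg m0 m1 n\<^esub> g = f - g"
  by (simp add: a_minus_def tensor_a_inv)

lemma word_append: "word (u @ v) = word u * word v"
  by (simp add: word_def mult_single plus_list_def)

lemma word_Cons: "word ((a, b) # w) = gen a b * word w"
  using word_append[of "[(a, b)]" w] by (simp add: gen_def)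

lemma single_conv_word: "Poly_Mapping.single w c = Poly_Mapping.single [] c * word w"
  by (simp add: word_def mult_single plus_list_def)

lemma poly_mapping_decompose: "f = (\<Sum>w\<in>Poly_Mapping.keys f. Poly_Mapping.single w (Poly_Mapping.lookup f w))"
proof (rule poly_mapping_eqI)
  fix k
  show "Poly_Mapping.lookup f k =
    Poly_Mapping.lookup (\<Sum>w\<in>Poly_Mapping.keys f. Poly_Mapping.single w (Poly_Mapping.lookup f w)) k"
  proof (cases "k \<in> Poly_Mapping.keys f")
    case True
    then show ?thesis
      by (simp add: lookup_sum lookup_single when_def)
  next
    case False
    then have "Poly_Mapping.lookup f k = 0" by (simp add: in_keys_iff)
    moreover have "(\<Sum>w\<in>Poly_Mapping.keys f. Poly_Mapping.lookup (Poly_Mapping.single w (Poly_Mapping.lookup f w)) k) = 0"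
      by (rule sum.neutral) (use False in \<open>auto simp: lookup_single when_def\<close>)
    ultimately show ?thesis by (simp add: lookup_sum)
  qed
qed

lemma super_sign_single: "super_sign a b c d = Poly_Mapping.single [] (bsign a b c d)"
proof -
  have "Poly_Mapping.single [] (1::complex) = 1" by (metis single_one zero_list_def)
  then show ?thesis
    using minus_one_power_iff[of "(parity a + parity b) * (parity c + parity d)", where ?'a = complex]
      minus_one_power_iff[of "(parity a + parity b) * (parity c + parity d)", where ?'a = gl_poly]
    by (auto simp: super_sign_def bsign_def single_uminus)
qed

lemma gen_closed: "a \<in> syms m0 m1 n \<Longrightarrow> b \<in> syms m0 m1 n \<Longrightarrow> gen a b \<in> carrier (tensor_alg m0 m1 n)"
  by (simp add: gen_def tensor_word_closed)

lemma super_sign_closed: "super_sign a b c d \<in> carrier (tensor_alg m0 m1 n)"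
  by (simp add: super_sign_single tensor_single_closed)

lemma gl_bracket_closed:
  assumes "a \<in> syms m0 m1 n" "b \<in> syms m0 m1 n" "c \<in> syms m0 m1 n" "d \<in> syms m0 m1 n"
  shows "gl_bracket a b c d \<in> carrier (tensor_alg m0 m1 n)"
proof -
  have "(if b = c then gen a d else 0) \<in> carrier (tensor_alg m0 m1 n)"
    "(if a = d then gen c b else 0) \<in> carrier (tensor_alg m0 m1 n)"
    using assms by (simp_all add: gen_closed tensor_0_closed)
  then show ?thesis
    unfolding gl_bracket_def by (intro tensor_diff_closed tensor_mult_closed super_sign_closed)
qed

lemma gl_relations_closed: "gl_relations m0 m1 n \<subseteq> carrier (tensor_alg m0 m1 n)"
  unfolding gl_relations_def
  by (auto intro!: tensor_diff_closed tensor_mult_closed gen_closed super_sign_closed gl_bracket_closed)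

lemma gl_ideal_ideal: "ideal (gl_ideal m0 m1 n) (tensor_alg m0 m1 n)"
  and gl_relations_subset: "gl_relations m0 m1 n \<subseteq> gl_ideal m0 m1 n"
  and gl_ideal_minimal: "ideal J (tensor_alg m0 m1 n) \<Longrightarrow> gl_relations m0 m1 n \<subseteq> J \<Longrightarrow> gl_ideal m0 m1 n \<subseteq> J"
proof -
  interpret ring "tensor_alg m0 m1 n" by (rule tensor_ring)
  note gl_relations_closed[of m0 m1 n]
  then show "ideal (gl_ideal m0 m1 n) (tensor_alg m0 m1 n)"
    and "gl_relations m0 m1 n \<subseteq> gl_ideal m0 m1 n"
    by (auto simp: gl_ideal_def genideal_ideal genideal_self)
  show "ideal J (tensor_alg m0 m1 n) \<Longrightarrow> gl_relations m0 m1 n \<subseteq> J \<Longrightarrow> gl_ideal m0 m1 n \<subseteq> J"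
    by (simp add: gl_ideal_def genideal_minimal)
qed

text \<open>A common frame for super tensor space and, with \<open>m0 = m1 = 0\<close>, for
  arbitrary gl(n)-modules, so that the passage from generators to the enveloping algebra is made
  once.\<close>

locale gl_super_module = vector_space scale
  for scale :: "complex \<Rightarrow> 'v::ab_group_add \<Rightarrow> 'v" +
  fixes m0 m1 n :: nat and rho :: "glsym \<times> glsym \<Rightarrow> 'v \<Rightarrow> 'v"
  assumes rho_linear: "p \<in> syms m0 m1 n \<times> syms m0 m1 n \<Longrightarrow> Vector_Spaces.linear scale scale (rho p)"
    and rho_bracket: "\<lbrakk>a \<in> syms m0 m1 n; b \<in> syms m0 m1 n; c \<in> syms m0 m1 n; d \<in> syms m0 m1 n\<rbrakk> \<Longrightarrow>
      rho (a, b) (rho (c, d) v) - scale (bsign a b c d) (rho (c, d) (rho (a, b) v)) =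
        (if b = c then rho (a, d) v else 0) - scale (bsign a b c d) (if a = d then rho (c, b) v else 0)"
begin

definition act :: "gl_poly \<Rightarrow> 'v \<Rightarrow> 'v" where
  "act f v = (\<Sum>w\<in>Poly_Mapping.keys f. scale (Poly_Mapping.lookup f w) (foldr rho w v))"

lemma act_superset:
  assumes "finite A" "Poly_Mapping.keys f \<subseteq> A"
  shows "act f v = (\<Sum>w\<in>A. scale (Poly_Mapping.lookup f w) (foldr rho w v))"
  unfolding act_def
  by (rule sum.mono_neutral_left) (use assms in \<open>auto simp: in_keys_iff\<close>)

lemma act_0 [simp]: "act 0 v = 0"
  by (simp add: act_def)

lemma act_add: "act (f + g) v = act f v + act g v"
proof -
  let ?A = "Poly_Mapping.keys f \<union> Poly_Mapping.keys g"
  have "finite ?A" by simp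
  then show ?thesis
    using Poly_Mapping.keys_add[of f g]
    by (simp add: act_superset[of ?A] lookup_add scale_left_distrib sum.distrib)
qed

lemma act_uminus: "act (- f) v = - act f v"
  using act_add[of f "- f" v] by (simp add: eq_neg_iff_add_eq_0 add.commute)

lemma act_diff: "act (f - g) v = act f v - act g v"
  using act_add[of f "- g" v] by (simp add: act_uminus)

lemma act_sum: "act (sum f A) v = (\<Sum>i\<in>A. act (f i) v)"
  by (induction A rule: infinite_finite_induct) (auto simp: act_add)

lemma act_single: "act (Poly_Mapping.single w c) v = scale c (foldr rho w v)"
  by (simp add: act_superset[of "{w}"])

lemma act_word [simp]: "act (word w) v = foldr rho w v"
  by (simp add: word_def act_single)

lemma foldr_linear:
  "set w \<subseteq> syms m0 m1 n \<times> syms m0 m1 n \<Longrightarrow> Vector_Spaces.linear scale scale (foldr rho w)"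
proof (induction w)
  case Nil
  then show ?case by (simp add: linear_id flip: id_def)
next
  case (Cons p w)
  have "foldr rho (p # w) = rho p \<circ> foldr rho w" by (simp add: fun_eq_iff)
  then show ?case
    unfolding \<open>foldr rho (p # w) = rho p \<circ> foldr rho w\<close>
    by (intro Vector_Spaces.linear_compose[OF Cons.IH rho_linear]) (use Cons.prems in auto)
qed

lemma act_linear:
  assumes "f \<in> carrier (tensor_alg m0 m1 n)"
  shows "Vector_Spaces.linear scale scale (act f)"
proof -
  interpret vector_space_pair scale scale ..
  have "Vector_Spaces.linear scale scale (\<lambda>v. \<Sum>w\<in>Poly_Mapping.keys f. scale (Poly_Mapping.lookup f w) (foldr rho w v))"
    by (intro linear_compose_sum ballI linear_compose_scale_right foldr_linear)
      (use assms in \<open>auto simp: in_tensor_carrier\<close>)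
  then show ?thesis by (simp add: act_def[abs_def])
qed

lemma act_mult:
  assumes f: "f \<in> carrier (tensor_alg m0 m1 n)"
  shows "act (f * g) v = act f (act g v)"
proof -
  have *: "act (Poly_Mapping.single u c * Poly_Mapping.single w d) v =
      scale c (foldr rho u (scale d (foldr rho w v)))"
    if "set u \<subseteq> syms m0 m1 n \<times> syms m0 m1 n" for u c w d
  proof -
    interpret Vector_Spaces.linear scale scale "foldr rho u"
      by (rule foldr_linear[OF that])
    show ?thesis by (simp add: mult_single act_single plus_list_def scale)
  qed
  have "f * g = (\<Sum>u\<in>Poly_Mapping.keys f. \<Sum>w\<in>Poly_Mapping.keys g.
       Poly_Mapping.single u (Poly_Mapping.lookup f u) * Poly_Mapping.single w (Poly_Mapping.lookup g w))"
    by (subst (1) poly_mapping_decompose[of f], subst (1) poly_mapping_decompose[of g])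
      (simp add: sum_product)
  then have "act (f * g) v = (\<Sum>u\<in>Poly_Mapping.keys f. \<Sum>w\<in>Poly_Mapping.keys g.
       scale (Poly_Mapping.lookup f u) (foldr rho u (scale (Poly_Mapping.lookup g w) (foldr rho w v))))"
    using f by (simp add: act_sum * in_tensor_carrier)
  also have "\<dots> = (\<Sum>u\<in>Poly_Mapping.keys f. scale (Poly_Mapping.lookup f u) (foldr rho u (act g v)))"
  proof (rule sum.cong[OF refl])
    fix u assume "u \<in> Poly_Mapping.keys f"
    then interpret Vector_Spaces.linear scale scale "foldr rho u"
      by (intro foldr_linear) (use f in \<open>auto simp: in_tensor_carrier\<close>)
    show "(\<Sum>w\<in>Poly_Mapping.keys g. scale (Poly_Mapping.lookup f u)
          (foldr rho u (scale (Poly_Mapping.lookup g w) (foldr rho w v)))) =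
        scale (Poly_Mapping.lookup f u) (foldr rho u (act g v))"
      by (simp add: act_def sum scale_sum_right)
  qed
  finally show ?thesis by (simp add: act_def)
qed

text \<open>The polynomials that act as 0 form a two-sided ideal containing the relations, so the
  action descends to the quotient.\<close>

lemma act_ideal:
  assumes "f \<in> gl_ideal m0 m1 n"
  shows "act f v = 0"
proof -
  let ?T = "tensor_alg m0 m1 n"
  interpret T: ring ?T by (rule tensor_ring)
  define J where "J = {f \<in> carrier ?T. \<forall>v. act f v = 0}"
  have lin0: "act x 0 = 0" if "x \<in> carrier ?T" for x
  proof -
    interpret Vector_Spaces.linear scale scale "act x" by (rule act_linear[OF that])
    show ?thesis by (rule zero)
  qed
  have "ideal J ?T"
  proof (rule idealI[OF T.ring_axioms])
    show "subgroup J (add_monoid ?T)"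
    proof (rule subgroup.intro)
      fix x assume x: "x \<in> J"
      then have "x \<in> carrier ?T" by (simp add: J_def)
      then show "inv\<^bsub>add_monoid ?T\<^esub> x \<in> J"
        using x tensor_a_inv[of x m0 m1 n] by (auto simp: J_def a_inv_def tensor_uminus_closed act_uminus)
    qed (auto simp: J_def act_add tensor_add_closed tensor_0_closed)
  qed (auto simp: J_def act_mult tensor_mult_closed lin0)
  moreover have "gl_relations m0 m1 n \<subseteq> J"
  proof
    fix r assume "r \<in> gl_relations m0 m1 n"
    then obtain a b c d where r: "r = gen a b * gen c d - super_sign a b c d * (gen c d * gen a b) - gl_bracket a b c d"
      and s: "a \<in> syms m0 m1 n" "b \<in> syms m0 m1 n" "c \<in> syms m0 m1 n" "d \<in> syms m0 m1 n"
      by (auto simp: gl_relations_def)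
    have "act r v = 0" for v
      using rho_bracket[OF s, of v]
      by (simp add: r gl_bracket_def super_sign_single gen_def word_def mult_single plus_list_def
          act_diff act_single if_distrib[of "\<lambda>f. act f v"] if_distrib[of "\<lambda>f. Poly_Mapping.single [] c * f" for c])
    moreover have "r \<in> carrier ?T"
      using \<open>r \<in> gl_relations m0 m1 n\<close> gl_relations_closed by blast
    ultimately show "r \<in> J" by (simp add: J_def)
  qed
  ultimately have "gl_ideal m0 m1 n \<subseteq> J" by (rule gl_ideal_minimal)
  then show ?thesis using assms by (auto simp: J_def)
qed

end

text \<open>\<open>ten_act\<close> is defined on all symbols, so \<open>ten.act\<close> is one and
  the same function for all sizes. Elements of U(gl(n)) and of the large superalgebra can thus be
  compared on the same tensors.\<close>

interpretation ten: gl_super_module ten_scale m0 m1 n "\<lambda>(a, b). ten_act a b" for m0 m1 n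
  by (intro gl_super_module.intro ten.vector_space_axioms gl_super_module_axioms.intro)
    (auto simp: ten_act_linear ten_act_bracket)

lemma gl_module_super:
  assumes "gl_module scale n E"
  shows "gl_super_module scale 0 0 n (\<lambda>(a, b). E (idx a) (idx b))"
proof -
  interpret gl_module scale n E by (rule assms)
  have syms: "a \<in> syms 0 0 n \<longleftrightarrow> (\<exists>i\<in>{1..n}. a = Letter i)" for a
    by (auto simp: syms_def virtual_syms_def)
  have bracket: "E (idx a) (idx b) (E (idx c) (idx d) v) -
        scale (bsign a b c d) (E (idx c) (idx d) (E (idx a) (idx b) v)) =
        (if b = c then E (idx a) (idx d) v else 0) -
        scale (bsign a b c d) (if a = d then E (idx c) (idx b) v else 0)"
    if mem: "a \<in> syms 0 0 n" "b \<in> syms 0 0 n" "c \<in> syms 0 0 n" "d \<in> syms 0 0 n" for a b c d v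
  proof -
    obtain i j k l where "a = Letter i" "b = Letter j" "c = Letter k" "d = Letter l"
      and "i \<in> {1..n}" "j \<in> {1..n}" "k \<in> {1..n}" "l \<in> {1..n}"
      using mem unfolding syms by blast
    then show ?thesis using E_bracket[of i j k l v] by (simp add: bsign_def)
  qed
  show ?thesis
  proof (intro gl_super_module.intro vector_space_axioms gl_super_module_axioms.intro)
    fix p assume "p \<in> syms 0 0 n \<times> syms 0 0 n"
    then show "Vector_Spaces.linear scale scale (case p of (a, b) \<Rightarrow> E (idx a) (idx b))"
      using E_linear by (auto simp: syms)
  qed (use bracket in simp)
qed

subsection \<open>The enveloping superalgebra as a quotient\<close>

lemma U_ring: "ring (U m0 m1 n)"
  unfolding U_def by (rule ideal.quotient_is_ring[OF gl_ideal_ideal])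

lemma U_class_hom: "U_class m0 m1 n \<in> ring_hom (tensor_alg m0 m1 n) (U m0 m1 n)"
  using ideal.rcos_ring_hom[OF gl_ideal_ideal[of m0 m1 n]]
  by (simp add: U_def U_class_def[abs_def])

lemma U_class_ring_hom: "ring_hom_ring (tensor_alg m0 m1 n) (U m0 m1 n) (U_class m0 m1 n)"
  by (intro ring_hom_ringI2 tensor_ring U_ring U_class_hom)

lemma U_carrier: "carrier (U m0 m1 n) = U_class m0 m1 n ` carrier (tensor_alg m0 m1 n)"
  by (auto simp: U_def FactRing_def A_RCOSETS_def' U_class_def)

lemma U_class_closed: "f \<in> carrier (tensor_alg m0 m1 n) \<Longrightarrow> U_class m0 m1 n f \<in> carrier (U m0 m1 n)"
  by (simp add: U_carrier)

lemma U_class_add: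
  "f \<in> carrier (tensor_alg m0 m1 n) \<Longrightarrow> g \<in> carrier (tensor_alg m0 m1 n) \<Longrightarrow>
    U_class m0 m1 n f \<oplus>\<^bsub>U m0 m1 n\<^esub> U_class m0 m1 n g = U_class m0 m1 n (f + g)"
  using ring_hom_add[OF U_class_hom] by simp

lemma U_class_mult:
  "f \<in> carrier (tensor_alg m0 m1 n) \<Longrightarrow> g \<in> carrier (tensor_alg m0 m1 n) \<Longrightarrow>
    U_class m0 m1 n f \<otimes>\<^bsub>U m0 m1 n\<^esub> U_class m0 m1 n g = U_class m0 m1 n (f * g)"
  using ring_hom_mult[OF U_class_hom] by simp

lemma U_class_a_inv:
  assumes "f \<in> carrier (tensor_alg m0 m1 n)"
  shows "\<ominus>\<^bsub>U m0 m1 n\<^esub> U_class m0 m1 n f = U_class m0 m1 n (- f)"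
proof -
  interpret ring_hom_ring "tensor_alg m0 m1 n" "U m0 m1 n" "U_class m0 m1 n"
    by (rule U_class_ring_hom)
  show ?thesis using hom_a_inv[of f] assms by (simp add: tensor_a_inv)
qed

lemma U_class_minus:
  "f \<in> carrier (tensor_alg m0 m1 n) \<Longrightarrow> g \<in> carrier (tensor_alg m0 m1 n) \<Longrightarrow>
    U_class m0 m1 n f \<ominus>\<^bsub>U m0 m1 n\<^esub> U_class m0 m1 n g = U_class m0 m1 n (f - g)"
  by (simp add: a_minus_def U_class_a_inv U_class_add tensor_uminus_closed)

lemma U_class_0: "U_class m0 m1 n 0 = \<zero>\<^bsub>U m0 m1 n\<^esub>"
  using ring_hom_zero[OF U_class_hom tensor_ring U_ring] by simp

lemma U_class_eq_iff:
  assumes "f \<in> carrier (tensor_alg m0 m1 n)" "g \<in> carrier (tensor_alg m0 m1 n)"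
  shows "U_class m0 m1 n f = U_class m0 m1 n g \<longleftrightarrow> f - g \<in> gl_ideal m0 m1 n"
  using ring.quotient_eq_iff_same_a_r_cos[OF tensor_ring gl_ideal_ideal, of f m0 m1 n g] assms
  by (simp add: U_class_def tensor_minus)

lemma gl_ideal_closed: "f \<in> gl_ideal m0 m1 n \<Longrightarrow> f \<in> carrier (tensor_alg m0 m1 n)"
  using additive_subgroup.a_Hcarr[OF ideal.axioms(1)[OF gl_ideal_ideal]] by blast

lemma gl_ideal_0: "0 \<in> gl_ideal m0 m1 n"
  using additive_subgroup.zero_closed[OF ideal.axioms(1)[OF gl_ideal_ideal]] by simp

lemma gl_ideal_add: "f \<in> gl_ideal m0 m1 n \<Longrightarrow> g \<in> gl_ideal m0 m1 n \<Longrightarrow> f + g \<in> gl_ideal m0 m1 n"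
  using additive_subgroup.a_closed[OF ideal.axioms(1)[OF gl_ideal_ideal]] by fastforce

lemma gl_ideal_uminus: "f \<in> gl_ideal m0 m1 n \<Longrightarrow> - f \<in> gl_ideal m0 m1 n"
proof -
  assume f: "f \<in> gl_ideal m0 m1 n"
  show ?thesis using additive_subgroup.a_inv_closed[OF ideal.axioms(1)[OF gl_ideal_ideal] f]
      tensor_a_inv[OF gl_ideal_closed[OF f]] by simp
qed

lemma gl_ideal_mult_left:
  "f \<in> gl_ideal m0 m1 n \<Longrightarrow> g \<in> carrier (tensor_alg m0 m1 n) \<Longrightarrow> g * f \<in> gl_ideal m0 m1 n"
  using ideal.I_l_closed[OF gl_ideal_ideal] by fastforce

lemma gl_ideal_mult_right:
  "f \<in> gl_ideal m0 m1 n \<Longrightarrow> g \<in> carrier (tensor_alg m0 m1 n) \<Longrightarrow> f * g \<in> gl_ideal m0 m1 n"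
  using ideal.I_r_closed[OF gl_ideal_ideal] by fastforce

lemma U_class_self: "f \<in> carrier (tensor_alg m0 m1 n) \<Longrightarrow> f \<in> U_class m0 m1 n f"
  unfolding U_class_def a_r_coset_def' using gl_ideal_0[of m0 m1 n] by force

lemma U_class_mem:
  assumes "g \<in> U_class m0 m1 n f"
  shows "g - f \<in> gl_ideal m0 m1 n"
  using assms by (auto simp: U_class_def a_r_coset_def')

lemma syms_mono: "syms 0 0 n \<subseteq> syms m0 m1 n"
  by (auto simp: syms_def virtual_syms_def)

lemma tensor_carrier_mono: "f \<in> carrier (tensor_alg 0 0 n) \<Longrightarrow> f \<in> carrier (tensor_alg m0 m1 n)"
  using syms_mono[of n m0 m1] by (fastforce simp: in_tensor_carrier)

text \<open>The large ideal cuts out of the small free algebra an ideal containing the relations of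
  gl(n). This makes \<open>U_incl\<close> independent of representatives.\<close>

lemma gl_ideal_mono: "gl_ideal 0 0 n \<subseteq> gl_ideal m0 m1 n"
proof -
  let ?T = "tensor_alg 0 0 n" and ?J = "gl_ideal m0 m1 n \<inter> carrier (tensor_alg 0 0 n)"
  interpret T: ring ?T by (rule tensor_ring)
  have "ideal ?J ?T"
  proof (rule idealI[OF T.ring_axioms])
    show "subgroup ?J (add_monoid ?T)"
    proof (rule subgroup.intro)
      fix x assume x: "x \<in> ?J"
      then show "inv\<^bsub>add_monoid ?T\<^esub> x \<in> ?J"
        using tensor_a_inv[of x 0 0 n] by (auto simp: a_inv_def tensor_uminus_closed gl_ideal_uminus)
    qed (auto simp: gl_ideal_add tensor_add_closed tensor_0_closed gl_ideal_0)
  qed (auto simp: tensor_mult_closed gl_ideal_mult_left gl_ideal_mult_right tensor_carrier_mono)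
  moreover have "gl_relations 0 0 n \<subseteq> ?J"
  proof -
    have "gl_relations 0 0 n \<subseteq> gl_relations m0 m1 n"
      using syms_mono[of n m0 m1] by (auto simp: gl_relations_def) blast
    then show ?thesis
      using gl_relations_subset[of m0 m1 n] gl_relations_closed[of 0 0 n] by blast
  qed
  ultimately show ?thesis using gl_ideal_minimal by blast
qed

lemma U_incl_class:
  assumes f: "f \<in> carrier (tensor_alg 0 0 n)"
  shows "U_incl m0 m1 n (U_class 0 0 n f) = U_class m0 m1 n f"
proof -
  have "U_class m0 m1 n g = U_class m0 m1 n f" if "g \<in> U_class 0 0 n f" for g
  proof -
    have "g - f \<in> gl_ideal 0 0 n" using that by (rule U_class_mem)
    then have g: "g - f \<in> gl_ideal m0 m1 n" using gl_ideal_mono by blast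
    have "g - f + f \<in> carrier (tensor_alg m0 m1 n)"
      by (rule tensor_add_closed[OF gl_ideal_closed[OF g] tensor_carrier_mono[OF f]])
    then show ?thesis using g f by (simp add: U_class_eq_iff tensor_carrier_mono)
  qed
  then have "U_class m0 m1 n ` U_class 0 0 n f = (\<lambda>_. U_class m0 m1 n f) ` U_class 0 0 n f"
    by (rule image_cong[OF refl])
  then have "U_class m0 m1 n ` U_class 0 0 n f = {U_class m0 m1 n f}"
    using U_class_self[OF f] by (simp only: image_constant_conv) auto
  then show ?thesis by (simp add: U_incl_def)
qed

lemma U_act_class:
  assumes "gl_module scale n E" and f: "f \<in> carrier (tensor_alg 0 0 n)"
  shows "U_act scale E (U_class 0 0 n f) v = poly_act scale E f v"
proof -
  interpret gl_super_module scale 0 0 n "\<lambda>(a, b). E (idx a) (idx b)"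
    by (rule gl_module_super[OF assms(1)])
  have act: "poly_act scale E g v = act g v" for g
    by (simp add: poly_act_def act_def)
  have "act g v = act f v" if "g \<in> U_class 0 0 n f" for g
    using act_ideal[OF U_class_mem[OF that], of v] by (simp add: act_diff)
  then have "(\<lambda>g. poly_act scale E g v) ` U_class 0 0 n f = (\<lambda>_. poly_act scale E f v) ` U_class 0 0 n f"
    unfolding act by (rule image_cong[OF refl])
  then have "(\<lambda>g. poly_act scale E g v) ` U_class 0 0 n f = {poly_act scale E f v}"
    using U_class_self[OF f] by (simp only: image_constant_conv) auto
  then show ?thesis by (simp add: U_act_def)
qed

lemma finsum_U_class:
  assumes "\<And>i. i \<in> A \<Longrightarrow> f i \<in> carrier (tensor_alg m0 m1 n)"
  shows "(\<Oplus>\<^bsub>U m0 m1 n\<^esub>i\<in>A. U_class m0 m1 n (f i)) = U_class m0 m1 n (sum f A)"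
proof -
  interpret U: ring "U m0 m1 n" by (rule U_ring)
  show ?thesis
    using assms
  proof (induction A rule: infinite_finite_induct)
    case (insert i A)
    have "(\<lambda>i. U_class m0 m1 n (f i)) \<in> A \<rightarrow> carrier (U m0 m1 n)"
      using insert.prems by (auto intro: U_class_closed)
    then show ?case
      using insert by (simp add: U_class_closed U_class_add tensor_sum_closed)
  qed (simp_all add: U_class_0)
qed

subsection \<open>The ideal generated by irregular words\<close>

text \<open>The preimage of \<open>Irr\<close> in the free algebra, which allows computing with
  polynomials instead of cosets.\<close>

definition irr_poly :: "nat \<Rightarrow> nat \<Rightarrow> nat \<Rightarrow> gl_poly set" where
  "irr_poly m0 m1 n = {f \<in> carrier (tensor_alg m0 m1 n). U_class m0 m1 n f \<in> Irr m0 m1 n}"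

lemma irr_poly_closed: "f \<in> irr_poly m0 m1 n \<Longrightarrow> f \<in> carrier (tensor_alg m0 m1 n)"
  by (simp add: irr_poly_def)

lemma irr_poly_zero: "0 \<in> irr_poly m0 m1 n"
proof -
  have "\<zero>\<^bsub>U m0 m1 n\<^esub> \<in> J" if "additive_subgroup J (U m0 m1 n)" for J
    using additive_subgroup.zero_closed[OF that] .
  then show ?thesis
    by (simp add: irr_poly_def Irr_def left_ideal_gen_def tensor_0_closed U_class_0)
qed

lemma irr_poly_ideal: "f \<in> gl_ideal m0 m1 n \<Longrightarrow> f \<in> irr_poly m0 m1 n"
  using U_class_eq_iff[of f m0 m1 n 0] gl_ideal_closed[of f m0 m1 n] irr_poly_zero[of m0 m1 n]
  by (simp add: irr_poly_def tensor_0_closed)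

lemma irr_poly_add:
  assumes "f \<in> irr_poly m0 m1 n" "g \<in> irr_poly m0 m1 n"
  shows "f + g \<in> irr_poly m0 m1 n"
proof -
  have "U_class m0 m1 n (f + g) \<in> J"
    if "additive_subgroup J (U m0 m1 n)" "U_class m0 m1 n f \<in> J" "U_class m0 m1 n g \<in> J" for J
    using additive_subgroup.a_closed[OF that] U_class_add[of f m0 m1 n g] assms
    by (simp add: irr_poly_def)
  then show ?thesis
    using assms by (simp add: irr_poly_def Irr_def left_ideal_gen_def tensor_add_closed)
qed

lemma irr_poly_mult:
  "f \<in> irr_poly m0 m1 n \<Longrightarrow> g \<in> carrier (tensor_alg m0 m1 n) \<Longrightarrow> g * f \<in> irr_poly m0 m1 n"
  by (auto simp: irr_poly_def Irr_def left_ideal_gen_def tensor_mult_closed U_class_closed simp flip: U_class_mult)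

lemma irr_poly_uminus: "f \<in> irr_poly m0 m1 n \<Longrightarrow> - f \<in> irr_poly m0 m1 n"
proof -
  assume "f \<in> irr_poly m0 m1 n"
  moreover have "Poly_Mapping.single [] (- 1) * f = - f"
    by (simp add: single_uminus flip: zero_list_def)
  ultimately show ?thesis using irr_poly_mult[of f m0 m1 n "Poly_Mapping.single [] (- 1)"]
    by (simp add: tensor_single_closed)
qed

lemma irr_poly_diff: "f \<in> irr_poly m0 m1 n \<Longrightarrow> g \<in> irr_poly m0 m1 n \<Longrightarrow> f - g \<in> irr_poly m0 m1 n"
  using irr_poly_add[of f m0 m1 n "- g"] irr_poly_uminus[of g m0 m1 n] by simp

lemma irr_poly_virtual:
  assumes "a \<in> syms m0 m1 n" "g \<in> virtual_syms m0 m1"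
  shows "gen a g \<in> irr_poly m0 m1 n"
proof -
  have "irregular m0 m1 [(a, g)]"
  proof -
    have "{j. j = 0 \<and> snd ([(a, g)] ! j) = g} = {0}" by auto
    then show ?thesis
      unfolding irregular_def by (intro exI[of _ 0] conjI bexI[OF _ assms(2)]) simp_all
  qed
  moreover have "set [(a, g)] \<subseteq> syms m0 m1 n \<times> syms m0 m1 n"
    using assms by (auto simp: syms_def)
  ultimately show ?thesis
    unfolding irr_poly_def Irr_def left_ideal_gen_def gen_def
    by (auto intro!: tensor_word_closed exI[of _ "[(a, g)]"])
qed

section \<open>Irregular words on tensors without virtual symbols\<close>

abbreviation ten_gen :: "glsym \<times> glsym \<Rightarrow> tens \<Rightarrow> tens" where
  "ten_gen \<equiv> (\<lambda>(a, b). ten_act a b)"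

lemma ten_act_zero [simp]: "ten_act a b 0 = 0"
  by (simp add: fun_eq_iff zero_fun_def ten_act_0)

lemma foldr_ten_zero [simp]: "foldr ten_gen w 0 = 0"
proof (induction w)
  case (Cons p w)
  then show ?case by (cases p) (simp del: zero_fun_apply)
qed simp

lemma foldr_has_count:
  "has_count s c x \<Longrightarrow>
    has_count s (c + int (count_list (map fst w) s) - int (count_list (map snd w) s)) (foldr ten_gen w x)"
proof (induction w)
  case (Cons p w)
  obtain a b where p: "p = (a, b)" by force
  from ten_act_has_count[OF Cons.IH[OF Cons.prems], of a b]
  show ?case by (simp add: p algebra_simps split: if_splits)
qed simp

definition letters_only :: "tens \<Rightarrow> bool" where
  "letters_only x \<longleftrightarrow> (\<forall>i. has_count (Alpha i) 0 x \<and> has_count (Beta i) 0 x)"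

lemma letters_only_virtual: "letters_only x \<Longrightarrow> g \<in> virtual_syms m0 m1 \<Longrightarrow> has_count g 0 x"
  by (auto simp: letters_only_def virtual_syms_def)

lemma card_nth_eq_count:
  "k \<le> length u \<Longrightarrow> card {j. j < k \<and> f (u ! j) = g} = count_list (map f (take k u)) g"
proof -
  assume k: "k \<le> length u"
  have "count_list (map f (take k u)) g = length (filter (\<lambda>y. f y = g) (take k u))"
    by (simp add: count_list_eq_length_filter filter_map o_def eq_commute)
  also have "\<dots> = card {j. j < length (take k u) \<and> f (take k u ! j) = g}"
    by (rule length_filter_conv_card)
  also have "{j. j < length (take k u) \<and> f (take k u ! j) = g} = {j. j < k \<and> f (u ! j) = g}"
    using k by auto
  finally show ?thesis ..
qed

lemma irregular_kills:
  assumes "irregular m0 m1 w" "letters_only x"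
  shows "foldr ten_gen w x = 0"
proof -
  obtain i g where i: "i < length w" and g: "g \<in> virtual_syms m0 m1"
    and lt: "card {j. j < i \<and> fst (rev w ! j) = g} < card {j. j \<le> i \<and> snd (rev w ! j) = g}"
    using assms(1) by (auto simp: irregular_def)
  \<comment> \<open>The factors that act before the critical one: the rightmost \<open>i\<close>
    factors of \<open>w\<close>.\<close>
  define u where "u = rev (take i (rev w))"
  obtain a b where ab: "rev w ! i = (a, b)" by force
  have w: "w = rev (drop (Suc i) (rev w)) @ (a, b) # u"
  proof -
    have "rev w = take i (rev w) @ (a, b) # drop (Suc i) (rev w)"
      using id_take_nth_drop[of i "rev w"] i ab by simp
    then have "rev (rev w) = rev (take i (rev w) @ (a, b) # drop (Suc i) (rev w))" by (rule arg_cong)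
    then show ?thesis unfolding u_def by simp
  qed
  have "card {j. j < i \<and> fst (rev w ! j) = g} = count_list (map fst u) g"
    using card_nth_eq_count[of i "rev w" fst g] i by (simp add: u_def flip: rev_map)
  moreover have "card {j. j \<le> i \<and> snd (rev w ! j) = g} = count_list (map snd ((a, b) # u)) g"
    using card_nth_eq_count[of "Suc i" "rev w" snd g] i ab
    by (simp add: u_def less_Suc_eq_le take_Suc_conv_app_nth flip: rev_map)
  ultimately have lt: "count_list (map fst u) g < count_list (map snd ((a, b) # u)) g"
    using lt by simp
  define c where "c = int (count_list (map fst u) g) - int (count_list (map snd u) g)"
  have hc: "has_count g c (foldr ten_gen u x)"
    using foldr_has_count[OF letters_only_virtual[OF assms(2) g], of u] by (simp add: c_def)
  have "ten_act a b (foldr ten_gen u x) = 0"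
  \<comment> \<open>The strict inequality counts the factor \<open>(a, b)\<close> itself. Before it
    the count of \<open>g\<close> can still be 0, but then \<open>b = g\<close> and the factor asks
    for a symbol that is absent.\<close>
  proof (cases "c < 0")
    case True
    then show ?thesis using has_count_neg[OF hc] by simp
  next
    case False
    with lt have "b = g" "c = 0" by (auto simp: c_def split: if_splits)
    then show ?thesis using hc ten_act_count_0 by auto
  qed
  then show ?thesis by (subst w) simp
qed

text \<open>The classes with a representative killing all these tensors form a left ideal: whatever
  is applied to 0 gives 0. It contains the irregular generators, and changing the representative
  costs an element of \<open>gl_ideal\<close>, which acts as 0.\<close>

lemma irr_poly_kills:
  assumes "f \<in> irr_poly m0 m1 n" "letters_only x"
  shows "ten.act f x = 0"
proof -
  let ?T = "tensor_alg m0 m1 n" and ?U = "U m0 m1 n"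
  interpret U: ring ?U by (rule U_ring)
  define J where "J = {X. \<exists>f\<in>carrier ?T. X = U_class m0 m1 n f \<and> (\<forall>x. letters_only x \<longrightarrow> ten.act f x = 0)}"
  have zero: "ten.act h 0 = 0" for h
    by (simp add: ten.act_def)
  have "additive_subgroup J ?U"
  proof (intro additive_subgroup.intro subgroup.intro)
    show "J \<subseteq> carrier (add_monoid ?U)" by (auto simp: J_def U_class_closed)
    show "\<one>\<^bsub>add_monoid ?U\<^esub> \<in> J"
      using U_class_0[of m0 m1 n] by (auto simp: J_def tensor_0_closed intro!: bexI[of _ 0])
    fix X Y assume X: "X \<in> J"
    then obtain f where f: "f \<in> carrier ?T" "X = U_class m0 m1 n f" "\<And>x. letters_only x \<Longrightarrow> ten.act f x = 0"
      by (auto simp: J_def)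
    have "\<ominus>\<^bsub>?U\<^esub> X \<in> J"
      unfolding J_def using f by (auto simp: U_class_a_inv tensor_uminus_closed ten.act_uminus intro!: bexI[of _ "- f"])
    then show "inv\<^bsub>add_monoid ?U\<^esub> X \<in> J" by (simp add: a_inv_def)
    assume "Y \<in> J"
    then obtain g where g: "g \<in> carrier ?T" "Y = U_class m0 m1 n g" "\<And>x. letters_only x \<Longrightarrow> ten.act g x = 0"
      by (auto simp: J_def)
    show "X \<otimes>\<^bsub>add_monoid ?U\<^esub> Y \<in> J"
      unfolding J_def using f g by (auto simp: U_class_add tensor_add_closed ten.act_add intro!: bexI[of _ "f + g"])
  qed
  moreover have "X \<otimes>\<^bsub>?U\<^esub> Y \<in> J" if "X \<in> carrier ?U" "Y \<in> J" for X Y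
  proof -
    obtain f where f: "f \<in> carrier ?T" "X = U_class m0 m1 n f"
      using \<open>X \<in> carrier ?U\<close> by (auto simp: U_carrier)
    obtain g where g: "g \<in> carrier ?T" "Y = U_class m0 m1 n g" "\<And>x. letters_only x \<Longrightarrow> ten.act g x = 0"
      using \<open>Y \<in> J\<close> by (auto simp: J_def)
    show ?thesis
      unfolding J_def using f g
      by (auto simp: U_class_mult tensor_mult_closed ten.act_mult[OF f(1)] zero intro!: bexI[of _ "f * g"])
  qed
  moreover have "{U_class m0 m1 n (word w) | w. set w \<subseteq> syms m0 m1 n \<times> syms m0 m1 n \<and> irregular m0 m1 w} \<subseteq> J"
    unfolding J_def using irregular_kills by (fastforce intro: tensor_word_closed)
  ultimately have "Irr m0 m1 n \<subseteq> J"
    unfolding Irr_def left_ideal_gen_def by blast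
  then obtain g where g: "g \<in> carrier ?T" "U_class m0 m1 n f = U_class m0 m1 n g"
      "\<And>x. letters_only x \<Longrightarrow> ten.act g x = 0"
    using assms(1) by (auto simp: irr_poly_def J_def)
  then have "f - g \<in> gl_ideal m0 m1 n"
    using U_class_eq_iff[of f m0 m1 n g] irr_poly_closed[OF assms(1)] by simp
  then have "ten.act (f - g) x = 0" by (rule ten.act_ideal)
  then show ?thesis using g(3)[OF assms(2)] by (simp add: ten.act_diff)
qed

subsection \<open>Letters act faithfully\<close>

text \<open>The terms of the coproduct of a product of primitive elements: all ways to share the
  factors between two tensor factors, keeping their order.\<close>

fun splits :: "'a list \<Rightarrow> ('a list \<times> 'a list) list" where
  "splits [] = [([], [])]"
| "splits (a # w) = map (\<lambda>(u, v). (a # u, v)) (splits w) @ map (\<lambda>(u, v). (u, a # v)) (splits w)"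

lemma splits_mset: "(u, v) \<in> set (splits w) \<Longrightarrow> mset w = mset u + mset v"
  by (induction w arbitrary: u v) auto

lemma splits_length: "(u, v) \<in> set (splits w) \<Longrightarrow> length w = length u + length v"
  by (metis splits_mset size_mset size_union)

lemma splits_set: "(u, v) \<in> set (splits w) \<Longrightarrow> set w = set u \<union> set v"
  by (metis splits_mset set_mset_mset set_mset_union)

lemma splits_empty: "([], w) \<in> set (splits w)"
  by (induction w) force+

lemma splits_single: "([p], u @ v) \<in> set (splits (u @ p # v))"
proof (induction u)
  case Nil
  then show ?case using splits_empty[of v] by force
qed force

text \<open>The tensor product of a vector \<open>y\<close>, given by its coordinates, with the
  tensor \<open>x\<close>.\<close>

definition tcons :: "(glsym \<Rightarrow> complex) \<Rightarrow> tens \<Rightarrow> tens" where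
  "tcons y x l = (case l of [] \<Rightarrow> 0 | c # l' \<Rightarrow> y c * x l')"

definition vec_act :: "glsym \<times> glsym \<Rightarrow> (glsym \<Rightarrow> complex) \<Rightarrow> glsym \<Rightarrow> complex" where
  "vec_act p y c = (if c = fst p then y (snd p) else 0)"

text \<open>Index 0 is excluded: \<open>Letter 0\<close> is inert under these pairs and serves as an additional trivial
  summand of the natural module.\<close>

definition letter_pairs :: "(glsym \<times> glsym) set" where
  "letter_pairs = (Letter ` {1..}) \<times> (Letter ` {1..})"

lemma syms_letter_pairs: "syms 0 0 n \<times> syms 0 0 n \<subseteq> letter_pairs"
  by (auto simp: syms_def virtual_syms_def letter_pairs_def)

lemma ten_gen_tcons:
  assumes "p \<in> letter_pairs"
  shows "ten_gen p (tcons y x) = tcons (vec_act p y) x + tcons y (ten_gen p x)"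
proof -
  obtain i j where p: "p = (Letter i, Letter j)" using assms by (auto simp: letter_pairs_def)
  have "ten_gen p (tcons y x) l = (tcons (vec_act p y) x + tcons y (ten_gen p x)) l" for l
    by (cases l) (simp_all add: p tcons_def vec_act_def ten_act_mult)
  then show ?thesis by (simp add: fun_eq_iff)
qed

lemma ten_gen_sum_list: "ten_gen p (\<Sum>i\<leftarrow>is. f i) = (\<Sum>i\<leftarrow>is. ten_gen p (f i))"
proof -
  obtain a b where p: "p = (a, b)" by force
  interpret Vector_Spaces.linear ten_scale ten_scale "ten_act a b" by (rule ten_act_linear)
  show ?thesis by (induction "is") (simp_all add: p add zero del: plus_fun_apply zero_fun_apply)
qed

text \<open>The iterated Leibniz rule. No signs arise, since operators between letters are
  even.\<close>

lemma foldr_tcons: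
  assumes "set w \<subseteq> letter_pairs"
  shows "foldr ten_gen w (tcons y x) = (\<Sum>(u, v)\<leftarrow>splits w. tcons (foldr vec_act u y) (foldr ten_gen v x))"
  using assms
proof (induction w)
  case (Cons p w)
  have p: "p \<in> letter_pairs" using Cons.prems by simp
  have "foldr ten_gen (p # w) (tcons y x) =
      (\<Sum>q\<leftarrow>splits w. ten_gen p (case q of (u, v) \<Rightarrow> tcons (foldr vec_act u y) (foldr ten_gen v x)))"
    using Cons by (simp add: ten_gen_sum_list o_def del: split_paired_all)
  also have "\<dots> = (\<Sum>(u, v)\<leftarrow>splits w. tcons (foldr vec_act (p # u) y) (foldr ten_gen v x)
      + tcons (foldr vec_act u y) (foldr ten_gen (p # v) x))"
    by (rule arg_cong[where f = sum_list], rule map_cong[OF refl])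
      (auto simp: ten_gen_tcons[OF p])
  finally show ?case
    by (simp add: case_prod_unfold o_def sum_list_addf)
qed simp

text \<open>The functional \<open>eta\<close> is a tensor product of functionals \<open>e\<^sub>i\<^sup>* - \<delta>\<^sub>i\<^sub>j e\<^sub>0\<^sup>*\<close> and \<open>tvec\<close> one of vectors
  \<open>e\<^sub>j + e\<^sub>0\<close>. On each factor the identity is sent to 0 and \<open>e\<^sub>k\<^sub>l\<close> to 1 or 0 according to whether
  \<open>(k, l) = (i, j)\<close>; hence only words that hit every factor exactly once are seen.\<close>

fun eta :: "(glsym \<times> glsym) list \<Rightarrow> tens \<Rightarrow> complex" where
  "eta [] x = x []"
| "eta ((i, j) # P) x = eta P (\<lambda>l. x (i # l)) - (if i = j then eta P (\<lambda>l. x (Letter 0 # l)) else 0)"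

fun tvec :: "(glsym \<times> glsym) list \<Rightarrow> tens" where
  "tvec [] = (\<lambda>l. if l = [] then 1 else 0)"
| "tvec ((i, j) # P) = tcons (\<lambda>c. if c = j \<or> c = Letter 0 then 1 else 0) (tvec P)"

lemma eta_add: "eta P (\<lambda>l. x l + y l) = eta P x + eta P y"
proof (induction P arbitrary: x y)
  case (Cons p P)
  show ?case by (cases p) (simp add: Cons.IH add_diff_add)
qed simp

lemma eta_mult: "eta P (\<lambda>l. k * x l) = k * eta P x"
proof (induction P arbitrary: x)
  case (Cons p P)
  show ?case by (cases p) (simp add: Cons.IH right_diff_distrib)
qed simp

lemma eta_zero: "eta P (\<lambda>l. 0) = 0"
  using eta_mult[of P 0 "\<lambda>_. 0"] by simp

lemma eta_sum_list: "eta P (\<Sum>i\<leftarrow>is. f i) = (\<Sum>i\<leftarrow>is. eta P (f i))"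
  by (induction "is") (simp_all add: eta_zero zero_fun_def plus_fun_def eta_add)

lemma eta_sum: "eta P (\<Sum>i\<in>A. f i) = (\<Sum>i\<in>A. eta P (f i))"
  by (induction A rule: infinite_finite_induct) (simp_all add: eta_zero zero_fun_def plus_fun_def eta_add)

lemma eta_tcons:
  "eta ((i, j) # P) (tcons y x) = (y i - (if i = j then y (Letter 0) else 0)) * eta P x"
  by (simp add: tcons_def eta_mult left_diff_distrib)

definition coef :: "(glsym \<times> glsym) list \<Rightarrow> (glsym \<times> glsym) list \<Rightarrow> complex" where
  "coef P w = eta P (foldr ten_gen w (tvec P))"

text \<open>Only the part \<open>u\<close> of the word spent on the first factor matters there:
  \<open>u = []\<close> acts as the identity and contributes 0, a single pair contributes 1 exactly
  if it is \<open>p\<close>, and a longer \<open>u\<close> leaves a word that the hypothesis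
  \<open>short\<close> discards.\<close>

lemma coef_Cons:
  assumes w: "set w \<subseteq> letter_pairs" and p: "p \<in> letter_pairs"
    and short: "\<And>v. set v \<subseteq> letter_pairs \<Longrightarrow> Suc (length v) < length w \<Longrightarrow> coef P v = 0"
  shows "coef (p # P) w = (\<Sum>(u, v)\<leftarrow>splits w. if u = [p] then coef P v else 0)"
proof -
  obtain i j where pij: "p = (i, j)" by force
  let ?y = "\<lambda>c. if c = j \<or> c = Letter 0 then 1 else 0 :: complex"
  have nz: "i \<noteq> Letter 0" "j \<noteq> Letter 0" using p pij by (auto simp: letter_pairs_def)
  have "coef (p # P) w = (\<Sum>q\<leftarrow>splits w. eta ((i, j) # P)
      (case q of (u, v) \<Rightarrow> tcons (foldr vec_act u ?y) (foldr ten_gen v (tvec P))))"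
    by (simp add: coef_def pij foldr_tcons[OF w] eta_sum_list o_def del: eta.simps)
  also have "\<dots> = (\<Sum>(u, v)\<leftarrow>splits w. if u = [p] then coef P v else 0)"
  proof (rule arg_cong[where f = sum_list], rule map_cong[OF refl])
    fix q assume q: "q \<in> set (splits w)"
    obtain u v where uv: "q = (u, v)" by force
    have len: "length w = length u + length v" and sub: "set u \<subseteq> letter_pairs" "set v \<subseteq> letter_pairs"
      using splits_length[of u v w] splits_set[of u v w] q uv w by auto
    consider "u = []" | r where "u = [r]" | r s u' where "u = r # s # u'"
      by (metis list.exhaust)
    then have "(foldr vec_act u ?y i - (if i = j then foldr vec_act u ?y (Letter 0) else 0)) * coef P v =
        (if u = [p] then coef P v else 0)"
    proof cases
      case 1
      then show ?thesis using nz by simp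
    next
      case (2 r)
      then have "fst r \<noteq> Letter 0" "snd r \<noteq> Letter 0" using sub by (auto simp: letter_pairs_def)
      then show ?thesis using nz by (cases r) (auto simp: 2 vec_act_def pij)
    next
      case 3
      then show ?thesis using short[OF sub(2)] len by simp
    qed
    then show "eta ((i, j) # P) (case q of (u, v) \<Rightarrow> tcons (foldr vec_act u ?y) (foldr ten_gen v (tvec P))) =
        (case q of (u, v) \<Rightarrow> if u = [p] then coef P v else 0)"
      by (simp add: uv eta_tcons coef_def del: eta.simps)
  qed
  finally show ?thesis .
qed

text \<open>A word with fewer letters than \<open>P\<close> has factors must leave some factor
  unhit, and there the functional gives 0.\<close>

lemma coef_short:
  assumes "set P \<subseteq> letter_pairs" "set w \<subseteq> letter_pairs" "length w < length P"
  shows "coef P w = 0"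
  using assms
proof (induction P arbitrary: w)
  case (Cons p P)
  have "coef (p # P) w = (\<Sum>(u, v)\<leftarrow>splits w. if u = [p] then coef P v else 0)"
    by (rule coef_Cons) (use Cons in auto)
  also have "\<dots> = (\<Sum>q\<leftarrow>splits w. 0)"
  proof (rule arg_cong[where f = sum_list], rule map_cong[OF refl])
    fix q assume q: "q \<in> set (splits w)"
    obtain u v where uv: "q = (u, v)" by force
    show "(case q of (u, v) \<Rightarrow> if u = [p] then coef P v else 0) = 0"
      using Cons.IH[of v] Cons.prems splits_length[of u v w] splits_set[of u v w] q uv by auto
  qed
  finally show ?case by simp
qed simp

lemma of_nat_sum_list: "of_nat (sum_list xs) = sum_list (map of_nat xs)"
  by (induction xs) simp_all

text \<open>The coefficient counts the ways to distribute the letters of \<open>w\<close> one to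
  each factor of \<open>P\<close> with a match everywhere. It is kept as a natural number so that
  contributions cannot cancel.\<close>

lemma coef_same_length:
  assumes "set P \<subseteq> letter_pairs" "set w \<subseteq> letter_pairs" "length w = length P"
  shows "\<exists>k::nat. coef P w = of_nat k \<and> (k > 0 \<longleftrightarrow> mset w = mset P)"
  using assms
proof (induction P arbitrary: w)
  case Nil
  then show ?case by (intro exI[of _ 1]) (simp add: coef_def)
next
  case (Cons p P)
  let ?good = "\<lambda>(u, v). u = [p]"
  have "\<exists>k::nat. coef P v = of_nat k \<and> (k > 0 \<longleftrightarrow> mset v = mset P)"
    if "([p], v) \<in> set (splits w)" for v
    using Cons.IH[of v] Cons.prems splits_length[OF that] splits_set[OF that] by auto
  then obtain k :: "_ \<Rightarrow> nat" where k: "\<And>v. ([p], v) \<in> set (splits w) \<Longrightarrow>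
      coef P v = of_nat (k v) \<and> (k v > 0 \<longleftrightarrow> mset v = mset P)"
    by metis
  let ?k = "\<lambda>(u, v). if u = [p] then k v else 0"
  have "coef (p # P) w = (\<Sum>(u, v)\<leftarrow>splits w. if u = [p] then coef P v else 0)"
    by (rule coef_Cons) (use Cons.prems coef_short[of P] in auto)
  also have "\<dots> = (\<Sum>q\<leftarrow>splits w. of_nat (?k q))"
    by (rule arg_cong[where f = sum_list], rule map_cong[OF refl]) (use k in auto)
  also have "\<dots> = of_nat (\<Sum>q\<leftarrow>splits w. ?k q)"
    by (simp add: of_nat_sum_list o_def)
  finally have "coef (p # P) w = of_nat (\<Sum>q\<leftarrow>splits w. ?k q)" .
  moreover have "(\<Sum>q\<leftarrow>splits w. ?k q) > 0 \<longleftrightarrow> mset w = mset (p # P)"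
  proof
    assume "(\<Sum>q\<leftarrow>splits w. ?k q) > 0"
    then have "\<exists>q\<in>set (splits w). ?k q \<noteq> 0" by (metis (no_types, lifting) not_gr_zero sum_list_eq_0_iff imageE set_map)
    then obtain v where v: "([p], v) \<in> set (splits w)" "k v > 0" by (auto split: if_splits)
    then show "mset w = mset (p # P)" using k[OF v(1)] splits_mset[OF v(1)] by simp
  next
    assume eq: "mset w = mset (p # P)"
    then have "p \<in> set w" by (metis list.set_intros(1) mset_eq_setD)
    then obtain w1 w2 where w: "w = w1 @ p # w2" by (metis split_list)
    have v: "([p], w1 @ w2) \<in> set (splits w)" unfolding w by (rule splits_single)
    then have "k (w1 @ w2) > 0" using k[OF v] eq w by simp
    then have "?k ([p], w1 @ w2) > 0" by simp
    then show "(\<Sum>q\<leftarrow>splits w. ?k q) > 0"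
      using v by (metis (no_types, lifting) image_eqI not_gr_zero set_map sum_list_eq_0_iff)
  qed
  ultimately show ?case by (intro exI[of _ "\<Sum>q\<leftarrow>splits w. ?k q"] conjI)
qed

lemma tvec_support: "tvec P l \<noteq> 0 \<Longrightarrow> set P \<subseteq> letter_pairs \<Longrightarrow> set l \<subseteq> Letter ` UNIV"
  by (induction P arbitrary: l rule: tvec.induct)
    (auto simp: tcons_def letter_pairs_def split: list.splits if_splits)

lemma letters_only_tvec:
  assumes "set P \<subseteq> letter_pairs"
  shows "letters_only (tvec P)"
proof -
  have "count_list l s = 0" if "s \<notin> Letter ` UNIV" "tvec P l \<noteq> 0" for s l
    using tvec_support[OF that(2) assms] that(1) by (auto simp: count_list_0_iff)
  then show ?thesis by (auto simp: letters_only_def has_count_def image_iff)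
qed

section \<open>Reordering words modulo shorter ones\<close>

lemma gl_ideal_sum: "(\<And>i. i \<in> A \<Longrightarrow> f i \<in> gl_ideal m0 m1 n) \<Longrightarrow> sum f A \<in> gl_ideal m0 m1 n"
  by (induction A rule: infinite_finite_induct) (auto simp: gl_ideal_0 gl_ideal_add)

text \<open>The filtration by length, with a strict bound so that level 0 contains only 0 and can
  start an induction.\<close>

definition shorter :: "nat \<Rightarrow> nat \<Rightarrow> gl_poly \<Rightarrow> bool" where
  "shorter n d h \<longleftrightarrow> h \<in> carrier (tensor_alg 0 0 n) \<and> (\<forall>w\<in>Poly_Mapping.keys h. length w < d)"

lemma shorter_add: "shorter n d f \<Longrightarrow> shorter n d g \<Longrightarrow> shorter n d (f + g)"
  using Poly_Mapping.keys_add[of f g] by (auto simp: shorter_def tensor_add_closed)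

lemma shorter_0: "shorter n d 0"
  by (simp add: shorter_def tensor_0_closed)

lemma shorter_sum: "(\<And>i. i \<in> A \<Longrightarrow> shorter n d (f i)) \<Longrightarrow> shorter n d (sum f A)"
  by (induction A rule: infinite_finite_induct) (auto simp: shorter_0 shorter_add)

lemma shorter_mult:
  assumes "set u \<subseteq> syms 0 0 n \<times> syms 0 0 n" "shorter n d f"
  shows "shorter n (length u + d) (Poly_Mapping.single u c * f)"
proof -
  have "length w < length u + d" if "w \<in> Poly_Mapping.keys (Poly_Mapping.single u c * f)" for w
    using that Poly_Mapping.keys_mult[of "Poly_Mapping.single u c" f] assms(2)
    by (auto simp: shorter_def plus_list_def split: if_splits)
  then show ?thesis
    using assms by (auto simp: shorter_def intro: tensor_mult_closed tensor_single_closed)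
qed

definition perm_equiv :: "nat \<Rightarrow> gl_word \<Rightarrow> gl_word \<Rightarrow> bool" where
  "perm_equiv n u w \<longleftrightarrow> (\<exists>h. shorter n (length w) h \<and> word u - word w - h \<in> gl_ideal 0 0 n)"

lemma perm_equiv_refl: "perm_equiv n w w"
  unfolding perm_equiv_def by (rule exI[of _ 0]) (simp add: shorter_0 gl_ideal_0)

lemma perm_equiv_trans:
  assumes "perm_equiv n u v" "perm_equiv n v w" "length v = length w"
  shows "perm_equiv n u w"
proof -
  obtain h k where "shorter n (length w) h" "word u - word v - h \<in> gl_ideal 0 0 n"
    "shorter n (length w) k" "word v - word w - k \<in> gl_ideal 0 0 n"
    using assms by (auto simp: perm_equiv_def)
  moreover have "word u - word w - (h + k) = (word u - word v - h) + (word v - word w - k)" by simp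
  ultimately show ?thesis
    unfolding perm_equiv_def by (metis shorter_add gl_ideal_add)
qed

lemma perm_equiv_Cons:
  assumes "perm_equiv n u w" "p \<in> syms 0 0 n \<times> syms 0 0 n"
  shows "perm_equiv n (p # u) (p # w)"
proof -
  obtain h where h: "shorter n (length w) h" "word u - word w - h \<in> gl_ideal 0 0 n"
    using assms by (auto simp: perm_equiv_def)
  have "word [p] * (word u - word w - h) \<in> gl_ideal 0 0 n"
    by (rule gl_ideal_mult_left[OF h(2)]) (use assms(2) in \<open>simp add: tensor_word_closed\<close>)
  then have "word (p # u) - word (p # w) - word [p] * h \<in> gl_ideal 0 0 n"
    using word_append[of "[p]" u] word_append[of "[p]" w] by (simp add: algebra_simps)
  moreover have "shorter n (length (p # w)) (word [p] * h)"
    using shorter_mult[of "[p]" n "length w" h 1] h(1) assms(2) by (simp add: word_def)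
  ultimately show ?thesis by (auto simp: perm_equiv_def)
qed

text \<open>The commutator of two generators is a combination of generators, so swapping neighbours
  costs words that are shorter by one.\<close>

lemma perm_equiv_swap:
  assumes "p \<in> syms 0 0 n \<times> syms 0 0 n" "q \<in> syms 0 0 n \<times> syms 0 0 n" "set w \<subseteq> syms 0 0 n \<times> syms 0 0 n"
  shows "perm_equiv n (p # q # w) (q # p # w)"
proof -
  obtain a b c d where pq: "p = (a, b)" "q = (c, d)" by force
  have s: "a \<in> syms 0 0 n" "b \<in> syms 0 0 n" "c \<in> syms 0 0 n" "d \<in> syms 0 0 n"
    using assms pq by auto
  have par: "bsign a b c d = 1"
    using s by (auto simp: syms_def virtual_syms_def bsign_def)
  have sgn: "super_sign a b c d = 1"
    by (simp add: super_sign_single par flip: zero_list_def)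
  have "gen a b * gen c d - super_sign a b c d * (gen c d * gen a b) - gl_bracket a b c d \<in> gl_ideal 0 0 n"
    using gl_relations_subset[of 0 0 n] s unfolding gl_relations_def by blast
  then have "(gen a b * gen c d - super_sign a b c d * (gen c d * gen a b) - gl_bracket a b c d) * word w
      \<in> gl_ideal 0 0 n"
    using assms by (intro gl_ideal_mult_right tensor_word_closed)
  then have "word (p # q # w) - word (q # p # w) - gl_bracket a b c d * word w \<in> gl_ideal 0 0 n"
    by (simp add: pq word_Cons sgn algebra_simps)
  moreover have "shorter n (length (q # p # w)) (gl_bracket a b c d * word w)"
  proof -
    have "shorter n (length (q # p # w)) (Poly_Mapping.single ((e, f) # w) k)"
      if "e \<in> syms 0 0 n" "f \<in> syms 0 0 n" for e f k
      using that assms by (auto simp: shorter_def tensor_0_closed intro!: tensor_single_closed split: if_splits)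
    note sh = this[of _ _ 1] this[of _ _ "- 1"]
    have "gl_bracket a b c d * word w =
      (if b = c then Poly_Mapping.single ((a, d) # w) 1 else 0)
      + (if a = d then Poly_Mapping.single ((c, b) # w) (- 1) else 0)"
      by (auto simp: gl_bracket_def sgn gen_def word_def mult_single plus_list_def single_uminus algebra_simps)
    then show ?thesis
      using sh s by (auto intro!: shorter_add shorter_0)
  qed
  ultimately show ?thesis by (auto simp: perm_equiv_def)
qed

lemma perm_equiv_front:
  assumes "p \<in> syms 0 0 n \<times> syms 0 0 n" "set u \<subseteq> syms 0 0 n \<times> syms 0 0 n" "set v \<subseteq> syms 0 0 n \<times> syms 0 0 n"
  shows "perm_equiv n (p # u @ v) (u @ p # v)"
  using assms
proof (induction u)
  case Nil
  then show ?case by (simp add: perm_equiv_refl)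
next
  case (Cons q u)
  have "perm_equiv n (p # q # u @ v) (q # p # u @ v)"
    by (rule perm_equiv_swap) (use Cons.prems in auto)
  moreover have "perm_equiv n (q # p # u @ v) (q # u @ p # v)"
    by (rule perm_equiv_Cons) (use Cons in auto)
  ultimately show ?case using perm_equiv_trans by fastforce
qed

lemma perm_equiv_mset:
  assumes "mset u = mset w" "set u \<subseteq> syms 0 0 n \<times> syms 0 0 n"
  shows "perm_equiv n u w"
  using assms
proof (induction u arbitrary: w)
  case Nil
  then show ?case by (simp add: perm_equiv_refl)
next
  case (Cons p u)
  have "p \<in> set w" by (metis Cons.prems(1) list.set_intros(1) mset_eq_setD)
  then obtain w1 w2 where w: "w = w1 @ p # w2" by (metis split_list)
  have ms: "mset u = mset (w1 @ w2)" using Cons.prems(1) w by simp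
  then have "set (w1 @ w2) = set u" by (metis mset_eq_setD)
  then have sub: "set w1 \<subseteq> syms 0 0 n \<times> syms 0 0 n" "set w2 \<subseteq> syms 0 0 n \<times> syms 0 0 n"
    using Cons.prems(2) by auto
  have "perm_equiv n (p # u) (p # w1 @ w2)"
    by (rule perm_equiv_Cons[OF Cons.IH[OF ms]]) (use Cons.prems in auto)
  moreover have "perm_equiv n (p # w1 @ w2) (w1 @ p # w2)"
    by (rule perm_equiv_front) (use Cons.prems sub in auto)
  ultimately show ?case using perm_equiv_trans w by fastforce
qed

lemma act_scalar: "ten.act (Poly_Mapping.single [] k * f) x = ten_scale k (ten.act f x)"
  using ten.act_mult[of "Poly_Mapping.single [] k" 0 0 0 f x] by (simp add: tensor_single_closed ten.act_single)

lemma eta_act_shorter: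
  assumes "shorter n (length P) h" "set P \<subseteq> syms 0 0 n \<times> syms 0 0 n"
  shows "eta P (ten.act h (tvec P)) = 0"
proof -
  have "eta P (ten_scale (Poly_Mapping.lookup h w) (foldr ten_gen w (tvec P))) = 0"
    if "w \<in> Poly_Mapping.keys h" for w
  proof -
    have "coef P w = 0"
      using assms that syms_letter_pairs[of n]
      by (intro coef_short) (auto simp: shorter_def in_tensor_carrier)
    then show ?thesis by (simp add: coef_def ten_scale_def eta_mult)
  qed
  then show ?thesis by (simp add: ten.act_def eta_sum)
qed

text \<open>Induction on the length bound. Up to shorter words the leading part is a combination of
  one representative for each multiset of factors; the functionals \<open>eta P\<close> show that
  its coefficients vanish, which lowers the bound.\<close>

theorem faithful_on_letters:
  assumes "f \<in> carrier (tensor_alg 0 0 n)" "\<And>x. letters_only x \<Longrightarrow> ten.act f x = 0"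
  shows "f \<in> gl_ideal 0 0 n"
proof -
  have "f \<in> gl_ideal 0 0 n" if "shorter n d f" "\<And>x. letters_only x \<Longrightarrow> ten.act f x = 0" for d f
    using that
  proof (induction d arbitrary: f)
    case 0
    then have "Poly_Mapping.keys f = {}" by (auto simp: shorter_def)
    then show ?case by (simp add: gl_ideal_0)
  next
    case (Suc d)
    let ?K = "Poly_Mapping.keys f" and ?c = "Poly_Mapping.lookup f" and ?S = "syms 0 0 n \<times> syms 0 0 n"
    define top where "top = {w \<in> ?K. length w = d}"
    \<comment> \<open>The chosen word depends on \<open>mset w\<close> only, so rearrangements of
      one word share it. No ordering of the generators has to be fixed.\<close>
    define r where "r w = (SOME u::gl_word. mset u = mset w)" for w :: gl_word
    have r: "mset (r w) = mset w" for w unfolding r_def by (rule someI[of _ w]) simp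
    have r_cong: "r u = r w" if "mset u = mset w" for u w using that by (simp add: r_def)
    have K: "set w \<subseteq> ?S" "length w < Suc d" if "w \<in> ?K" for w
      using Suc.prems(1) that by (auto simp: shorter_def in_tensor_carrier)
    have set_r: "set (r w) = set w" "length (r w) = length w" for w
      using r[of w] by (metis mset_eq_setD, metis mset_eq_length)
    have "\<exists>h. shorter n d h \<and> word w - word (r w) - h \<in> gl_ideal 0 0 n" if "w \<in> top" for w
      using perm_equiv_mset[OF r[of w, symmetric], of n] K[of w] set_r[of w] that
      by (auto simp: top_def perm_equiv_def)
    then obtain h where h: "\<And>w. w \<in> top \<Longrightarrow> shorter n d (h w)"
      "\<And>w. w \<in> top \<Longrightarrow> word w - word (r w) - h w \<in> gl_ideal 0 0 n"
      by metis
    \<comment> \<open>The corrections from rearranging the words of length \<open>d\<close>,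
      together with the words of \<open>f\<close> that were shorter from the start.\<close>
    define rest where "rest = (\<Sum>w\<in>top. Poly_Mapping.single [] (?c w) * h w)
      + (\<Sum>w\<in>?K - top. Poly_Mapping.single w (?c w))"
    define lead where "lead = (\<Sum>w\<in>top. Poly_Mapping.single [] (?c w) * word (r w))"
    have fin: "finite top" by (simp add: top_def)
    have "shorter n d rest"
      unfolding rest_def
    proof (intro shorter_add shorter_sum)
      show "shorter n d (Poly_Mapping.single [] (?c w) * h w)" if "w \<in> top" for w
        using shorter_mult[of "[]" n d "h w"] h(1)[OF that] by simp
      show "shorter n d (Poly_Mapping.single w (?c w))" if "w \<in> ?K - top" for w
        using K[of w] that by (auto simp: shorter_def top_def in_tensor_carrier)
    qed
    have "f = (\<Sum>w\<in>top. Poly_Mapping.single w (?c w)) + (\<Sum>w\<in>?K - top. Poly_Mapping.single w (?c w))"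
      using poly_mapping_decompose[of f] sum.subset_diff[of top ?K "\<lambda>w. Poly_Mapping.single w (?c w)"]
      by (simp add: top_def add.commute)
    moreover have "g - (l + (b + c)) = a - (l + b)" if "g = a + c" for g l a b c :: gl_poly
      using that by simp
    ultimately have "f - (lead + rest) =
      (\<Sum>w\<in>top. Poly_Mapping.single w (?c w)) - (lead + (\<Sum>w\<in>top. Poly_Mapping.single [] (?c w) * h w))"
      unfolding rest_def by blast
    also have "\<dots> = (\<Sum>w\<in>top. Poly_Mapping.single [] (?c w) * (word w - word (r w) - h w))"
      unfolding lead_def
      by (simp add: sum_subtractf sum.distrib right_diff_distrib flip: single_conv_word)
    also have "\<dots> \<in> gl_ideal 0 0 n"
      by (intro gl_ideal_sum gl_ideal_mult_left h(2)) (simp_all add: tensor_single_closed)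
    finally have diff: "f - (lead + rest) \<in> gl_ideal 0 0 n" .
    have kills: "ten.act lead x + ten.act rest x = 0" if "letters_only x" for x
      using ten.act_ideal[OF diff, of x] unfolding ten.act_diff ten.act_add Suc.prems(2)[OF that]
      by (simp only: diff_0 neg_equal_0_iff_equal)
    have coef_sum: "(\<Sum>w | w \<in> top \<and> r w = P. ?c w) = 0" if P: "P \<in> r ` top" for P
    proof -
      from P obtain w0 where w0: "w0 \<in> top" "P = r w0" by blast
      then have setP: "set P \<subseteq> ?S" and lenP: "length P = d"
        using K[of w0] set_r[of w0] by (auto simp: top_def)
      have LP: "set P \<subseteq> letter_pairs" using setP syms_letter_pairs by blast
      have zero: "coef P (r w) = 0" if "w \<in> top" "r w \<noteq> P" for w
      proof -
        have "mset (r w) \<noteq> mset P" using that(2) r w0(2) r_cong by metis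
        moreover have "set (r w) \<subseteq> letter_pairs"
          using K(1)[of w] set_r(1)[of w] that(1) syms_letter_pairs[of n] unfolding top_def by blast
        moreover have "length (r w) = length P"
          using set_r(2)[of w] that(1) lenP by (simp add: top_def)
        ultimately show ?thesis using coef_same_length[OF LP, of "r w"] by auto
      qed
      have nonzero: "coef P P \<noteq> 0" using coef_same_length[OF LP LP] by auto
      \<comment> \<open>The functional sees neither \<open>rest\<close>, whose words are shorter
        than \<open>P\<close>, nor leading words with another multiset; it isolates the coefficient
        at \<open>P\<close>.\<close>
      have "0 = eta P (ten.act lead (tvec P) + ten.act rest (tvec P))"
        by (simp add: kills[OF letters_only_tvec[OF LP]] zero_fun_def eta_zero)
      also have "\<dots> = eta P (ten.act lead (tvec P))"
        using eta_act_shorter[of n P rest] \<open>shorter n d rest\<close> lenP setP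
        by (simp add: plus_fun_def eta_add)
      also have "\<dots> = (\<Sum>w\<in>top. ?c w * coef P (r w))"
        by (simp add: lead_def ten.act_sum act_scalar eta_sum coef_def ten_scale_def eta_mult)
      also have "\<dots> = (\<Sum>w | w \<in> top \<and> r w = P. ?c w * coef P (r w))"
        by (rule sum.mono_neutral_right) (use fin zero in auto)
      also have "\<dots> = (\<Sum>w | w \<in> top \<and> r w = P. ?c w) * coef P P"
        by (simp add: sum_distrib_right)
      finally show ?thesis using nonzero by simp
    qed
    have "lead = (\<Sum>P\<in>r ` top. \<Sum>w | w \<in> top \<and> r w = P. Poly_Mapping.single [] (?c w) * word (r w))"
      unfolding lead_def by (rule sum.image_gen[OF fin])
    also have "\<dots> = (\<Sum>P\<in>r ` top. Poly_Mapping.single P (\<Sum>w | w \<in> top \<and> r w = P. ?c w))"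
    proof (rule sum.cong[OF refl])
      fix P
      have "(\<Sum>w | w \<in> top \<and> r w = P. Poly_Mapping.single [] (?c w) * word (r w)) =
          (\<Sum>w | w \<in> top \<and> r w = P. Poly_Mapping.single P (?c w))"
        by (rule sum.cong) (auto simp flip: single_conv_word)
      also have "\<dots> = Poly_Mapping.single P (\<Sum>w | w \<in> top \<and> r w = P. ?c w)"
        by (rule poly_mapping_eqI) (simp add: lookup_sum lookup_single when_def)
      finally show "(\<Sum>w | w \<in> top \<and> r w = P. Poly_Mapping.single [] (?c w) * word (r w)) =
          Poly_Mapping.single P (\<Sum>w | w \<in> top \<and> r w = P. ?c w)" .
    qed
    also have "\<dots> = 0" by (simp add: coef_sum)
    finally have lead: "lead = 0" .
    have "rest \<in> gl_ideal 0 0 n"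
      by (rule Suc.IH[OF \<open>shorter n d rest\<close>]) (use kills in \<open>simp add: lead\<close>)
    then show ?case using gl_ideal_add[OF diff, of rest] by (simp add: lead)
  qed
  \<comment> \<open>For \<open>f = 0\<close> the maximum of the empty set is unspecified, but then
    the length condition is vacuous.\<close>
  moreover have "shorter n (Suc (Max (length ` Poly_Mapping.keys f))) f"
    using assms(1) by (auto simp: shorter_def less_Suc_eq_le)
  ultimately show ?thesis using assms(2) by blast
qed

subsection \<open>Normal forms modulo irregular words\<close>

text \<open>Two candidates for the value differ by an element of \<open>irr_poly\<close>, which
  kills all tensors without virtual symbols; being a polynomial in letters, it is 0 in U(gl(n)) by
  faithfulness.\<close>

lemma virt_proj_eqI:
  assumes f: "f \<in> carrier (tensor_alg 0 0 n)" and h: "h \<in> carrier (tensor_alg m0 m1 n)"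
    and diff: "h - f \<in> irr_poly m0 m1 n"
  shows "virt_proj m0 m1 n (U_class m0 m1 n h) = U_class 0 0 n f"
proof -
  have iff: "U_class m0 m1 n h \<ominus>\<^bsub>U m0 m1 n\<^esub> U_incl m0 m1 n (U_class 0 0 n g) \<in> Irr m0 m1 n \<longleftrightarrow>
      h - g \<in> irr_poly m0 m1 n" if "g \<in> carrier (tensor_alg 0 0 n)" for g
    using that h tensor_carrier_mono[OF that, of m0 m1]
    by (simp add: U_incl_class U_class_minus irr_poly_def tensor_diff_closed)
  show ?thesis
    unfolding virt_proj_def
  proof (rule the_equality)
    show "U_class 0 0 n f \<in> carrier (Ugl n) \<and>
        U_class m0 m1 n h \<ominus>\<^bsub>U m0 m1 n\<^esub> U_incl m0 m1 n (U_class 0 0 n f) \<in> Irr m0 m1 n"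
      using f diff iff[OF f] by (simp add: U_class_closed)
    fix u assume u: "u \<in> carrier (Ugl n) \<and> U_class m0 m1 n h \<ominus>\<^bsub>U m0 m1 n\<^esub> U_incl m0 m1 n u \<in> Irr m0 m1 n"
    then obtain g where g: "g \<in> carrier (tensor_alg 0 0 n)" "u = U_class 0 0 n g"
      by (auto simp: U_carrier)
    then have "h - g \<in> irr_poly m0 m1 n" using u iff[OF g(1)] by simp
    from irr_poly_diff[OF diff this] have "g - f \<in> irr_poly m0 m1 n" by simp
    then have "g - f \<in> gl_ideal 0 0 n"
      by (intro faithful_on_letters irr_poly_kills tensor_diff_closed g(1) f)
    then show "u = U_class 0 0 n f" using g f by (simp add: U_class_eq_iff)
  qed
qed

lemma word_swap:
  assumes s: "a \<in> syms m0 m1 n" "b \<in> syms m0 m1 n" "c \<in> syms m0 m1 n" "d \<in> syms m0 m1 n"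
    and w: "set w \<subseteq> syms m0 m1 n \<times> syms m0 m1 n"
  shows "word ((a, b) # (c, d) # w) -
      (Poly_Mapping.single [] (bsign a b c d) * word ((c, d) # (a, b) # w)
       + ((if b = c then word ((a, d) # w) else 0)
          - Poly_Mapping.single [] (bsign a b c d) * (if a = d then word ((c, b) # w) else 0)))
     \<in> gl_ideal m0 m1 n"
proof -
  have "gen a b * gen c d - super_sign a b c d * (gen c d * gen a b) - gl_bracket a b c d \<in> gl_ideal m0 m1 n"
    using gl_relations_subset[of m0 m1 n] s unfolding gl_relations_def by blast
  then have "(gen a b * gen c d - super_sign a b c d * (gen c d * gen a b) - gl_bracket a b c d) * word w
      \<in> gl_ideal m0 m1 n"
    using w by (intro gl_ideal_mult_right tensor_word_closed)
  moreover have "(gen a b * gen c d - super_sign a b c d * (gen c d * gen a b) - gl_bracket a b c d) * word w =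
      word ((a, b) # (c, d) # w) -
      (Poly_Mapping.single [] (bsign a b c d) * word ((c, d) # (a, b) # w)
       + ((if b = c then word ((a, d) # w) else 0)
          - Poly_Mapping.single [] (bsign a b c d) * (if a = d then word ((c, b) # w) else 0)))"
    by (simp add: word_Cons super_sign_single gl_bracket_def algebra_simps)
  ultimately show ?thesis by simp
qed

text \<open>The weight under the adjoint action of the diagonal matrices. Reordering preserves it,
  since both terms of a bracket have the weight of the product.\<close>

definition content :: "gl_word \<Rightarrow> glsym \<Rightarrow> int" where
  "content w s = int (count_list (map fst w) s) - int (count_list (map snd w) s)"

lemma content_Nil [simp]: "content [] s = 0"
  by (simp add: content_def)

lemma content_Cons: "content ((a, b) # w) s = (if a = s then 1 else 0) - (if b = s then 1 else 0) + content w s"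
  by (simp add: content_def)

lemma content_append: "content (u @ v) s = content u s + content v s"
  by (simp add: content_def)

text \<open>Factors with a virtual second symbol have disappeared: pushed to the right end of a word
  they make it irregular. The remaining factors with a virtual symbol create it and stand on the
  left.\<close>

definition normal_word :: "nat \<Rightarrow> nat \<Rightarrow> nat \<Rightarrow> gl_word \<Rightarrow> bool" where
  "normal_word m0 m1 n w \<longleftrightarrow> (\<exists>u v. w = u @ v \<and> set u \<subseteq> virtual_syms m0 m1 \<times> syms 0 0 n \<and>
     set v \<subseteq> syms 0 0 n \<times> syms 0 0 n)"

lemma syms_cases: "a \<in> syms m0 m1 n \<longleftrightarrow> a \<in> virtual_syms m0 m1 \<or> a \<in> syms 0 0 n"
  by (auto simp: syms_def virtual_syms_def)

lemma syms_disjoint: "a \<in> virtual_syms m0 m1 \<Longrightarrow> a \<notin> syms 0 0 n"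
  by (auto simp: syms_def virtual_syms_def)

lemma normal_word_closed: "normal_word m0 m1 n w \<Longrightarrow> set w \<subseteq> syms m0 m1 n \<times> syms m0 m1 n"
  by (auto simp: normal_word_def syms_cases[of _ m0 m1])

lemma normal_word_Cons:
  "p \<in> virtual_syms m0 m1 \<times> syms 0 0 n \<Longrightarrow> normal_word m0 m1 n w \<Longrightarrow> normal_word m0 m1 n (p # w)"
  unfolding normal_word_def by (metis append_Cons insert_subset list.simps(15))

text \<open>The weight \<open>k\<close> is carried along because it finally decides whether virtual
  symbols can remain.\<close>

definition normalizes :: "nat \<Rightarrow> nat \<Rightarrow> nat \<Rightarrow> gl_poly \<Rightarrow> (glsym \<Rightarrow> int) \<Rightarrow> bool" where
  "normalizes m0 m1 n f k \<longleftrightarrow> f \<in> carrier (tensor_alg m0 m1 n) \<and>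
     (\<exists>g. (\<forall>w\<in>Poly_Mapping.keys g. normal_word m0 m1 n w \<and> (\<forall>s. content w s = k s)) \<and> f - g \<in> irr_poly m0 m1 n)"

lemma normalizes_closed: "normalizes m0 m1 n f k \<Longrightarrow> f \<in> carrier (tensor_alg m0 m1 n)"
  by (simp add: normalizes_def)

lemma normalizes_irr: "f \<in> irr_poly m0 m1 n \<Longrightarrow> normalizes m0 m1 n f k"
  unfolding normalizes_def by (auto intro!: exI[of _ 0] irr_poly_closed)

lemma normalizes_normal:
  assumes "normal_word m0 m1 n w" "\<forall>s. content w s = k s"
  shows "normalizes m0 m1 n (word w) k"
  using assms tensor_word_closed[OF normal_word_closed[OF assms(1)]]
  unfolding normalizes_def
  by (intro conjI exI[of _ "word w"]) (simp_all add: irr_poly_zero, simp add: word_def)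

lemma normalizes_add:
  assumes "normalizes m0 m1 n f k" "normalizes m0 m1 n f' k"
  shows "normalizes m0 m1 n (f + f') k"
proof -
  obtain g g' where g: "\<forall>w\<in>Poly_Mapping.keys g. normal_word m0 m1 n w \<and> (\<forall>s. content w s = k s)" "f - g \<in> irr_poly m0 m1 n"
    "\<forall>w\<in>Poly_Mapping.keys g'. normal_word m0 m1 n w \<and> (\<forall>s. content w s = k s)" "f' - g' \<in> irr_poly m0 m1 n"
    using assms by (auto simp: normalizes_def)
  have "f + f' - (g + g') \<in> irr_poly m0 m1 n"
    using irr_poly_add[OF g(2,4)] by (simp add: algebra_simps)
  moreover have "\<forall>w\<in>Poly_Mapping.keys (g + g'). normal_word m0 m1 n w \<and> (\<forall>s. content w s = k s)"
    using g(1,3) Poly_Mapping.keys_add[of g g'] by blast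
  ultimately show ?thesis
    using assms unfolding normalizes_def by (blast intro: tensor_add_closed)
qed

lemma normalizes_scalar:
  assumes "normalizes m0 m1 n f k"
  shows "normalizes m0 m1 n (Poly_Mapping.single [] c * f) k"
proof -
  obtain g where g: "\<forall>w\<in>Poly_Mapping.keys g. normal_word m0 m1 n w \<and> (\<forall>s. content w s = k s)" "f - g \<in> irr_poly m0 m1 n"
    using assms by (auto simp: normalizes_def)
  have "Poly_Mapping.single [] c * f - Poly_Mapping.single [] c * g \<in> irr_poly m0 m1 n"
    using irr_poly_mult[OF g(2), of "Poly_Mapping.single [] c"]
    by (simp add: tensor_single_closed right_diff_distrib)
  moreover have "Poly_Mapping.keys (Poly_Mapping.single [] c * g) \<subseteq> Poly_Mapping.keys g"
    using Poly_Mapping.keys_mult[of "Poly_Mapping.single [] c" g] by (auto simp: plus_list_def split: if_splits)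
  ultimately show ?thesis
    using assms g(1) unfolding normalizes_def by (blast intro: tensor_mult_closed tensor_single_closed[of "[]", simplified])
qed

lemma normalizes_sum:
  "(\<And>i. i \<in> A \<Longrightarrow> normalizes m0 m1 n (f i) k) \<Longrightarrow> normalizes m0 m1 n (sum f A) k"
  by (induction A rule: infinite_finite_induct) (auto intro: normalizes_irr[OF irr_poly_zero] normalizes_add)

lemma normalizes_cong:
  assumes "normalizes m0 m1 n f' k" "f - f' \<in> irr_poly m0 m1 n"
  shows "normalizes m0 m1 n f k"
  using normalizes_add[OF assms(1) normalizes_irr[OF assms(2)]] by simp

lemma normalizes_Cons:
  assumes f: "normalizes m0 m1 n f k" and ab: "(a, b) \<in> virtual_syms m0 m1 \<times> syms 0 0 n"
    and l: "\<And>s. l s = (if a = s then 1 else 0) - (if b = s then 1 else 0) + k s"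
  shows "normalizes m0 m1 n (word [(a, b)] * f) l"
proof -
  obtain g where g: "\<forall>w\<in>Poly_Mapping.keys g. normal_word m0 m1 n w \<and> (\<forall>s. content w s = k s)" "f - g \<in> irr_poly m0 m1 n"
    using f by (auto simp: normalizes_def)
  have w: "word [(a, b)] \<in> carrier (tensor_alg m0 m1 n)"
    using ab by (intro tensor_word_closed) (auto simp: syms_cases[of _ m0 m1])
  have "word [(a, b)] * f - word [(a, b)] * g \<in> irr_poly m0 m1 n"
    using irr_poly_mult[OF g(2) w] by (simp add: right_diff_distrib)
  moreover have "normal_word m0 m1 n w \<and> (\<forall>s. content w s = l s)"
    if "w \<in> Poly_Mapping.keys (word [(a, b)] * g)" for w
  proof -
    from that obtain u where "w = (a, b) # u" "u \<in> Poly_Mapping.keys g"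
      using Poly_Mapping.keys_mult[of "word [(a, b)]" g] by (auto simp: plus_list_def word_def)
    then show ?thesis using g(1) normal_word_Cons[OF ab] by (auto simp: content_Cons l)
  qed
  ultimately show ?thesis
    unfolding normalizes_def using tensor_mult_closed[OF w normalizes_closed[OF f]] by blast
qed

text \<open>As \<open>Irr\<close> is generated as a left ideal, the factor with second symbol
  \<open>g\<close> has to reach the right end. Passing a letter factor \<open>(c, d)\<close> never
  uses up \<open>g\<close>, because \<open>g\<close> differs from \<open>c\<close>; the only bracket
  term is again a factor with second symbol \<open>g\<close>.\<close>

lemma virtual_letters_irr:
  assumes "a \<in> syms m0 m1 n" "g \<in> virtual_syms m0 m1" "set w \<subseteq> syms 0 0 n \<times> syms 0 0 n"
  shows "word ((a, g) # w) \<in> irr_poly m0 m1 n"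
  using assms
proof (induction w arbitrary: a)
  case Nil
  then show ?case using irr_poly_virtual[of a m0 m1 n g] by (simp add: gen_def)
next
  case (Cons p w)
  obtain c d where p: "p = (c, d)" by force
  have cd: "c \<in> syms 0 0 n" "d \<in> syms 0 0 n" using Cons.prems p by auto
  then have cd': "c \<in> syms m0 m1 n" "d \<in> syms m0 m1 n"
    using syms_mono[of n m0 m1] by auto
  have gc: "g \<noteq> c"
    using syms_disjoint Cons.prems(2) cd(1) by blast
  have g: "g \<in> syms m0 m1 n" using Cons.prems(2) by (simp add: syms_cases[of _ m0 m1])
  have w: "set w \<subseteq> syms m0 m1 n \<times> syms m0 m1 n" using Cons.prems(3) syms_mono[of n m0 m1] by auto
  let ?e = "Poly_Mapping.single [] (bsign a g c d)"
  have e: "?e \<in> carrier (tensor_alg m0 m1 n)" by (simp add: tensor_single_closed)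
  have IH: "word ((b, g) # w) \<in> irr_poly m0 m1 n" if "b \<in> syms m0 m1 n" for b
    using Cons that by simp
  have "word ((c, d) # (a, g) # w) \<in> irr_poly m0 m1 n"
    using irr_poly_mult[OF IH[OF Cons.prems(1)], of "gen c d"] cd' by (simp add: gen_closed word_Cons)
  then have A: "?e * word ((c, d) # (a, g) # w) \<in> irr_poly m0 m1 n"
    by (rule irr_poly_mult[OF _ e])
  have "(if a = d then word ((c, g) # w) else 0) \<in> irr_poly m0 m1 n"
    using IH[OF cd'(1)] by (simp add: irr_poly_zero)
  then have B: "?e * (if a = d then word ((c, g) # w) else 0) \<in> irr_poly m0 m1 n"
    by (rule irr_poly_mult[OF _ e])
  have "word ((a, g) # (c, d) # w) - (?e * word ((c, d) # (a, g) # w)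
       - ?e * (if a = d then word ((c, g) # w) else 0)) \<in> irr_poly m0 m1 n"
    using irr_poly_ideal[OF word_swap[OF Cons.prems(1) g cd' w]] gc by simp
  from irr_poly_add[OF this irr_poly_diff[OF A B]] show ?case by (simp add: p)
qed

text \<open>If the normal word begins with a factor that creates a virtual symbol,
  \<open>(a, b)\<close> is moved behind it, and all resulting terms prepend a single factor to the
  shorter tail. If there is no such factor, the word is in \<open>irr_poly\<close> or already
  normal.\<close>

lemma normalizes_Cons_normal:
  assumes "normal_word m0 m1 n w" "a \<in> syms m0 m1 n" "b \<in> syms m0 m1 n"
    and "\<And>s. k s = content ((a, b) # w) s"
  shows "normalizes m0 m1 n (word ((a, b) # w)) k"
  using assms
proof (induction w arbitrary: a b k)
  case Nil
  show ?case
  proof (cases "b \<in> virtual_syms m0 m1")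
    case True
    then show ?thesis
      using virtual_letters_irr[of a m0 m1 n b "[]"] Nil.prems by (simp add: normalizes_irr)
  next
    case False
    then have "b \<in> syms 0 0 n" using Nil.prems(3) by (simp add: syms_cases[of _ m0 m1])
    then have "normal_word m0 m1 n [(a, b)]"
      using Nil.prems(2) unfolding syms_cases[of _ m0 m1] normal_word_def
      by (elim disjE) (rule exI[of _ "[(a, b)]"], simp, rule exI[of _ "[]"], simp)
    then show ?thesis using Nil.prems(4) by (intro normalizes_normal) auto
  qed
next
  case (Cons p w)
  obtain c d where p: "p = (c, d)" by force
  obtain u v where uv: "p # w = u @ v" "set u \<subseteq> virtual_syms m0 m1 \<times> syms 0 0 n"
    "set v \<subseteq> syms 0 0 n \<times> syms 0 0 n"
    using Cons.prems(1) by (auto simp: normal_word_def)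
  have closed: "set (p # w) \<subseteq> syms m0 m1 n \<times> syms m0 m1 n"
    using Cons.prems(1) by (rule normal_word_closed)
  then have cd: "c \<in> syms m0 m1 n" "d \<in> syms m0 m1 n" and w: "set w \<subseteq> syms m0 m1 n \<times> syms m0 m1 n"
    by (auto simp: p)
  show ?case
  proof (cases u)
    case Nil
    then have v: "set (p # w) \<subseteq> syms 0 0 n \<times> syms 0 0 n" using uv by simp
    show ?thesis
    proof (cases "b \<in> virtual_syms m0 m1")
      case True
      then show ?thesis
        using virtual_letters_irr[OF Cons.prems(2) True v] by (simp add: normalizes_irr)
    next
      case False
      then have b: "b \<in> syms 0 0 n" using Cons.prems(3) by (simp add: syms_cases[of _ m0 m1])
      have "normal_word m0 m1 n ((a, b) # p # w)"
      proof (cases "a \<in> virtual_syms m0 m1")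
        case True
        then show ?thesis using normal_word_Cons[OF _ Cons.prems(1), of "(a, b)"] b by simp
      next
        case False
        then have "a \<in> syms 0 0 n" using Cons.prems(2) by (simp add: syms_cases[of _ m0 m1])
        then show ?thesis unfolding normal_word_def using v b
          by (intro exI[of _ "[]"] exI[of _ "(a, b) # p # w"]) auto
      qed
      then show ?thesis using Cons.prems(4) by (intro normalizes_normal) auto
    qed
  next
    case (Cons q u')
    then have px: "(c, d) \<in> virtual_syms m0 m1 \<times> syms 0 0 n" and nw: "normal_word m0 m1 n w"
      using uv by (auto simp: p normal_word_def)
    note IH = Cons.IH[OF nw]
    let ?e = "Poly_Mapping.single [] (bsign a b c d)"
    have ksimp: "k s = (if a = s then 1 else 0) - (if b = s then 1 else 0)
        + ((if c = s then 1 else 0) - (if d = s then 1 else 0) + content w s)" for s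
      using Cons.prems(4)[of s] by (simp add: p content_Cons)
    have "normalizes m0 m1 n (word [(c, d)] * word ((a, b) # w)) k"
      by (rule normalizes_Cons[OF IH[OF Cons.prems(2,3) refl] px]) (simp add: ksimp content_Cons)
    then have A: "normalizes m0 m1 n (?e * word ((c, d) # (a, b) # w)) k"
      by (intro normalizes_scalar) (simp flip: word_append)
    have B: "normalizes m0 m1 n (if b = c then word ((a, d) # w) else 0) k"
    proof (cases "b = c")
      case True
      then have "normalizes m0 m1 n (word ((a, d) # w)) k"
        by (intro IH Cons.prems(2) cd(2)) (simp add: ksimp content_Cons)
      then show ?thesis using True by simp
    qed (simp add: normalizes_irr[OF irr_poly_zero])
    have "normalizes m0 m1 n (if a = d then word ((c, b) # w) else 0) k"
    proof (cases "a = d")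
      case True
      then have "normalizes m0 m1 n (word ((c, b) # w)) k"
        by (intro IH Cons.prems(3) cd(1)) (simp add: ksimp content_Cons)
      then show ?thesis using True by simp
    qed (simp add: normalizes_irr[OF irr_poly_zero])
    then have C: "normalizes m0 m1 n (Poly_Mapping.single [] (- bsign a b c d) * (if a = d then word ((c, b) # w) else 0)) k"
      by (rule normalizes_scalar)
    have "normalizes m0 m1 n (?e * word ((c, d) # (a, b) # w) + ((if b = c then word ((a, d) # w) else 0)
        + Poly_Mapping.single [] (- bsign a b c d) * (if a = d then word ((c, b) # w) else 0))) k"
      by (intro normalizes_add A B C)
    then show ?thesis
      unfolding p
      by (rule normalizes_cong)
        (use irr_poly_ideal[OF word_swap[OF Cons.prems(2,3) cd w]] in \<open>simp add: single_uminus\<close>)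
  qed
qed

lemma normalizes_word:
  assumes "set w \<subseteq> syms m0 m1 n \<times> syms m0 m1 n"
  shows "normalizes m0 m1 n (word w) (content w)"
  using assms
proof (induction w)
  case Nil
  have "normal_word m0 m1 n []" by (simp add: normal_word_def)
  then show ?case by (intro normalizes_normal) auto
next
  case (Cons p w)
  obtain a b where p: "p = (a, b)" by force
  obtain g where g: "\<forall>u\<in>Poly_Mapping.keys g. normal_word m0 m1 n u \<and> (\<forall>s. content u s = content w s)"
    "word w - g \<in> irr_poly m0 m1 n"
    using Cons by (auto simp: normalizes_def)
  have ab: "a \<in> syms m0 m1 n" "b \<in> syms m0 m1 n" using Cons.prems p by auto
  have "gen a b * g = (\<Sum>u\<in>Poly_Mapping.keys g. Poly_Mapping.single [] (Poly_Mapping.lookup g u) * word ((a, b) # u))"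
    by (subst poly_mapping_decompose[of g])
      (simp add: sum_distrib_left gen_def word_def mult_single plus_list_def)
  also have "normalizes m0 m1 n \<dots> (content (p # w))"
    using g(1) ab
    by (intro normalizes_sum normalizes_scalar normalizes_Cons_normal) (auto simp: p content_Cons)
  finally have "normalizes m0 m1 n (gen a b * g) (content (p # w))" .
  then show ?case
    by (rule normalizes_cong)
      (use irr_poly_mult[OF g(2) gen_closed[OF ab]] in \<open>simp add: p word_Cons right_diff_distrib\<close>)
qed

lemma content_letters:
  assumes "set w \<subseteq> syms 0 0 n \<times> syms 0 0 n" "s \<in> virtual_syms m0 m1"
  shows "content w s = 0"
proof -
  have "s \<notin> set (map fst w)" "s \<notin> set (map snd w)" using assms syms_disjoint[of s m0 m1 n] by auto
  then show ?thesis by (simp add: content_def count_notin)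
qed

lemma content_virtual_pos:
  assumes "set u \<subseteq> virtual_syms m0 m1 \<times> syms 0 0 n" "s \<in> virtual_syms m0 m1"
  shows "content u s = int (count_list (map fst u) s)"
proof -
  have "s \<notin> set (map snd u)" using assms syms_disjoint[of s m0 m1 n] by auto
  then show ?thesis by (simp add: content_def count_notin)
qed

text \<open>Existence of the projection. In a normal word a virtual symbol occurs only as a first
  entry and hence gives positive content; content 0 leaves letters only.\<close>

lemma balanced_word_letters:
  assumes w: "set w \<subseteq> syms m0 m1 n \<times> syms m0 m1 n" and bal: "\<And>s. content w s = 0"
  obtains f where "f \<in> carrier (tensor_alg 0 0 n)" "\<And>u s. u \<in> Poly_Mapping.keys f \<Longrightarrow> content u s = 0"
    "word w - f \<in> irr_poly m0 m1 n"
proof -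
  obtain g where g: "\<forall>u\<in>Poly_Mapping.keys g. normal_word m0 m1 n u \<and> (\<forall>s. content u s = content w s)"
    "word w - g \<in> irr_poly m0 m1 n"
    using normalizes_word[OF w] by (auto simp: normalizes_def)
  have "set x \<subseteq> syms 0 0 n \<times> syms 0 0 n" if x: "x \<in> Poly_Mapping.keys g" for x
  proof -
    obtain u v where uv: "x = u @ v" "set u \<subseteq> virtual_syms m0 m1 \<times> syms 0 0 n"
      "set v \<subseteq> syms 0 0 n \<times> syms 0 0 n"
      using g(1) x by (auto simp: normal_word_def)
    have "u = []"
    proof (rule ccontr)
      assume "u \<noteq> []"
      then obtain a b u' where u: "u = (a, b) # u'" by (metis list.exhaust surj_pair)
      then have a: "a \<in> virtual_syms m0 m1" using uv by auto
      have "content x a > 0"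
        unfolding uv(1) content_append content_virtual_pos[OF uv(2) a] content_letters[OF uv(3) a]
        by (simp add: u)
      then show False using g(1) x bal by simp
    qed
    then show ?thesis using uv by simp
  qed
  then have "g \<in> carrier (tensor_alg 0 0 n)" by (simp add: in_tensor_carrier)
  then show thesis using that[of g] g bal by auto
qed

subsection \<open>Eigenvalues on highest weight vectors\<close>

text \<open>The principal grading: lowering operators have positive degree, raising operators
  negative and diagonal ones 0.\<close>

definition height :: "(nat \<times> nat) list \<Rightarrow> int" where
  "height w = (\<Sum>(i, j)\<leftarrow>w. int i - int j)"

definition lowering :: "nat \<Rightarrow> (nat \<times> nat) set" where
  "lowering n = {(i, j). i \<in> {1..n} \<and> j \<in> {1..n} \<and> j < i}"

lemma height_lowering: "set w \<subseteq> lowering n \<Longrightarrow> w \<noteq> [] \<Longrightarrow> height w > 0"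
proof (induction w)
  case (Cons p w)
  then show ?case by (cases "w = []"; cases p) (auto simp: height_def lowering_def)
qed simp

context gl_module
begin

abbreviation run :: "(nat \<times> nat) list \<Rightarrow> 'v \<Rightarrow> 'v" where
  "run \<equiv> foldr (\<lambda>(i, j). E i j)"

definition lowspan :: "'v \<Rightarrow> int \<Rightarrow> 'v set" where
  "lowspan v h = span {run u v | u. set u \<subseteq> lowering n \<and> height u = h}"

lemma lowspan_preimage:
  assumes ij: "i \<in> {1..n}" "j \<in> {1..n}"
    and base: "\<And>u. set u \<subseteq> lowering n \<Longrightarrow> height u = h \<Longrightarrow> E i j (run u v) \<in> lowspan v h'"
    and x: "x \<in> lowspan v h"
  shows "E i j x \<in> lowspan v h'"
proof -
  interpret L: Vector_Spaces.linear scale scale "E i j" by (rule E_linear[OF ij])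
  have "span {run u v | u. set u \<subseteq> lowering n \<and> height u = h} \<subseteq> {x. E i j x \<in> lowspan v h'}"
  proof (rule span_minimal)
    show "subspace {x. E i j x \<in> lowspan v h'}"
      by (auto simp: subspace_def lowspan_def L.add L.scale L.zero span_zero span_add span_scale)
  qed (use base in blast)
  then show ?thesis using x by (auto simp: lowspan_def)
qed

lemma lowspan_run: "set u \<subseteq> lowering n \<Longrightarrow> height u = h \<Longrightarrow> run u v \<in> lowspan v h"
  unfolding lowspan_def by (rule span_base) blast

lemma E_lowering_lowspan:
  assumes kl: "(k, l) \<in> lowering n" and x: "x \<in> lowspan v h" and h': "h' = h + int k - int l"
  shows "E k l x \<in> lowspan v h'"
proof (rule lowspan_preimage[OF _ _ _ x])
  show "k \<in> {1..n}" "l \<in> {1..n}" using kl by (auto simp: lowering_def)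
  show "E k l (run u v) \<in> lowspan v h'" if "set u \<subseteq> lowering n" "height u = h" for u
    using lowspan_run[of "(k, l) # u" h' v] that kl h' by (simp add: height_def)
qed

text \<open>The operator is commuted to the right, the bracket terms being shorter words of the same
  total height, until it meets \<open>v\<close>. There it vanishes, scales, or is itself a lowering
  operator.\<close>

lemma E_run_lowspan:
  assumes v: "highest_weight_vector scale n E wt v" and ij: "i \<in> {1..n}" "j \<in> {1..n}"
    and u: "set u \<subseteq> lowering n"
  shows "E i j (run u v) \<in> lowspan v (height u + int i - int j)"
  using ij u
proof (induction u arbitrary: i j)
  case Nil
  consider "j < i" | "i = j" | "i < j" by linarith
  then show ?case
  proof cases
    case 1
    then show ?thesis
      using Nil lowspan_run[of "[(i, j)]" "height [] + int i - int j" v] by (simp add: lowering_def height_def)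
  next
    case 2
    have "v \<in> lowspan v 0" using lowspan_run[of "[]" 0 v] by (simp add: height_def)
    then show ?thesis
      using 2 v Nil by (simp add: highest_weight_vector_def height_def lowspan_def span_scale)
  next
    case 3
    then show ?thesis using v Nil by (simp add: highest_weight_vector_def lowspan_def span_zero)
  qed
next
  case (Cons p u)
  obtain k l where p: "p = (k, l)" by force
  have kl: "k \<in> {1..n}" "l \<in> {1..n}" "(k, l) \<in> lowering n" and u: "set u \<subseteq> lowering n"
    using Cons.prems by (auto simp: p lowering_def)
  let ?x = "run u v" and ?h = "height u + int k - int l + int i - int j"
  have h: "height (p # u) + int i - int j = ?h" by (simp add: height_def p)
  note IH = Cons.IH[OF _ _ u]
  have "E k l (E i j ?x) \<in> lowspan v ?h"
    by (rule E_lowering_lowspan[OF kl(3) IH[OF Cons.prems(1,2)]]) simp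
  moreover have "(if j = k then E i l ?x else 0) \<in> lowspan v ?h"
    using IH[OF Cons.prems(1) kl(2)] by (auto simp: lowspan_def span_zero algebra_simps)
  moreover have "(if i = l then E k j ?x else 0) \<in> lowspan v ?h"
    using IH[OF kl(1) Cons.prems(2)] by (auto simp: lowspan_def span_zero algebra_simps)
  ultimately have "E k l (E i j ?x) + ((if j = k then E i l ?x else 0) - (if i = l then E k j ?x else 0)) \<in> lowspan v ?h"
    unfolding lowspan_def by (intro span_add span_diff)
  also have "E k l (E i j ?x) + ((if j = k then E i l ?x else 0) - (if i = l then E k j ?x else 0)) = E i j (E k l ?x)"
    using E_bracket[OF Cons.prems(1,2) kl(1,2), of ?x] by (metis add.commute diff_add_cancel)
  finally show ?case unfolding h by (simp add: p)
qed

lemma run_lowspan: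
  assumes v: "highest_weight_vector scale n E wt v" and "set w \<subseteq> {1..n} \<times> {1..n}"
  shows "run w v \<in> lowspan v (height w)"
  using assms(2)
proof (induction w)
  case Nil
  then show ?case using lowspan_run[of "[]" "height []" v] by simp
next
  case (Cons p w)
  obtain i j where p: "p = (i, j)" by force
  have ij: "i \<in> {1..n}" "j \<in> {1..n}" using Cons.prems p by auto
  have h: "height (p # w) = height w + int i - int j" by (simp add: height_def p)
  have "E i j (run w v) \<in> lowspan v (height w + int i - int j)"
  proof (rule lowspan_preimage[OF ij])
    show "E i j (run u v) \<in> lowspan v (height w + int i - int j)"
      if "set u \<subseteq> lowering n" "height u = height w" for u
      using E_run_lowspan[OF v ij that(1)] that(2) by simp
    show "run w v \<in> lowspan v (height w)" using Cons by simp
  qed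
  then show ?case unfolding h by (simp add: p)
qed

text \<open>The only product of lowering operators of height 0 is the empty one, so the span in
  question is the line of \<open>v\<close>.\<close>

lemma run_height_0:
  assumes "highest_weight_vector scale n E wt v" "set w \<subseteq> {1..n} \<times> {1..n}" "height w = 0"
  shows "\<exists>c. run w v = scale c v"
proof -
  have "{run u v | u. set u \<subseteq> lowering n \<and> height u = 0} \<subseteq> {v}"
    using height_lowering by force
  then have "lowspan v 0 \<subseteq> span {v}" unfolding lowspan_def by (rule span_mono)
  then show ?thesis using run_lowspan[OF assms(1,2)] assms(3) by (auto simp: span_singleton)
qed

end

abbreviation "ten_E \<equiv> (\<lambda>i j. ten_act (Letter i) (Letter j))"

lemma gl_module_ten_prod:
  fixes scale :: "complex \<Rightarrow> 'v::ab_group_add \<Rightarrow> 'v"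
  assumes "gl_module scale n E"
  shows "gl_module (\<lambda>c (v, x). (scale c v, ten_scale c x)) n (\<lambda>i j (v, x). (E i j v, ten_E i j x))"
proof -
  interpret gl_module scale n E by (rule assms)
  let ?s = "\<lambda>c (v, x). (scale c v, ten_scale c x)"
  interpret P: vector_space ?s
    by unfold_locales (auto simp: scale_right_distrib scale_left_distrib
        ten.scale_right_distrib ten.scale_left_distrib)
  show ?thesis
  proof (intro gl_module.intro P.vector_space_axioms gl_module_axioms.intro)
    fix i j assume ij: "i \<in> {1..n}" "j \<in> {1..n}"
    interpret L: Vector_Spaces.linear scale scale "E i j" by (rule E_linear[OF ij])
    interpret M: Vector_Spaces.linear ten_scale ten_scale "ten_E i j" by (rule ten_act_linear)
    show "Vector_Spaces.linear ?s ?s (\<lambda>(v, x). (E i j v, ten_E i j x))"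
      by unfold_locales (auto simp: L.add M.add L.scale M.scale simp del: plus_fun_apply)
  next
    fix i j k l and v :: "'v \<times> tens" assume ij: "i \<in> {1..n}" "j \<in> {1..n}" "k \<in> {1..n}" "l \<in> {1..n}"
    obtain y x where v: "v = (y, x)" by force
    let ?E = "\<lambda>i j (v, x). (E i j v, ten_E i j x)"
    show "?E i j (?E k l v) - ?E k l (?E i j v) = (if j = k then ?E i l v else 0) - (if i = l then ?E k j v else 0)"
      using E_bracket[OF ij, of y] ten_act_bracket[of "Letter i" "Letter j" "Letter k" "Letter l" x]
      by (auto simp: v bsign_def zero_prod_def simp del: zero_fun_apply)
  qed
qed

lemma content_0_mset:
  assumes "\<And>s. content u s = 0"
  shows "mset (map fst u) = mset (map snd u)"
proof (rule multiset_eqI)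
  fix s show "count (mset (map fst u)) s = count (mset (map snd u)) s"
    using assms[of s] by (simp add: content_def count_mset del: mset_map)
qed

lemma common_eigenvalue:
  assumes "gl_module scale n E" and v: "highest_weight_vector scale n E wt v"
    and x: "highest_weight_vector ten_scale n ten_E wt x"
    and u: "set u \<subseteq> syms 0 0 n \<times> syms 0 0 n" and bal: "\<And>s. content u s = 0"
  shows "\<exists>c. foldr (\<lambda>(a, b). E (idx a) (idx b)) u v = scale c v \<and> foldr ten_gen u x = ten_scale c x"
proof -
  interpret P: gl_module "\<lambda>c (v, x). (scale c v, ten_scale c x)" n "\<lambda>i j (v, x). (E i j v, ten_E i j x)"
    by (rule gl_module_ten_prod[OF assms(1)])
  let ?u = "map (map_prod idx idx) u"
  have hw: "highest_weight_vector (\<lambda>c (v, x). (scale c v, ten_scale c x)) n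
      (\<lambda>i j (v, x). (E i j v, ten_E i j x)) wt (v, x)"
    using v x by (auto simp: highest_weight_vector_def zero_prod_def simp del: zero_fun_apply)
  have "set ?u \<subseteq> {1..n} \<times> {1..n}"
    using u by (fastforce simp: syms_def virtual_syms_def)
  \<comment> \<open>By balance the first and the second entries form the same multiset, so their
    indices have the same sum.\<close>
  moreover have "height ?u = 0"
  proof -
    have "height ?u = (\<Sum>a\<leftarrow>map fst u. int (idx a)) - (\<Sum>a\<leftarrow>map snd u. int (idx a))"
      by (induction u) (auto simp: height_def)
    also have "\<dots> = 0"
    proof -
      have "(\<Sum>a\<leftarrow>xs. int (idx a)) = (\<Sum>a\<in>#mset xs. int (idx a))" for xs
        by (induction xs) simp_all
      then show ?thesis using content_0_mset[OF bal] by (simp only: diff_self)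
    qed
    finally show ?thesis .
  qed
  ultimately obtain c where c: "P.run ?u (v, x) = (scale c v, ten_scale c x)"
    using P.run_height_0[OF hw, of ?u] by auto
  have "P.run ?u (v, x) = (foldr (\<lambda>(a, b). E (idx a) (idx b)) u v, foldr ten_gen u x)"
    using u
  proof (induction u)
    case (Cons p u)
    obtain a b where p: "p = (a, b)" by force
    have "a = Letter (idx a)" "b = Letter (idx b)"
      using Cons.prems by (auto simp: p syms_def virtual_syms_def)
    then show ?case using Cons by (simp add: p)
  qed simp
  then show ?thesis using c by (intro exI[of _ c]) simp
qed

lemma common_eigenvalue_poly:
  assumes E: "gl_module scale n E" and v: "highest_weight_vector scale n E wt v"
    and x: "highest_weight_vector ten_scale n ten_E wt x"
    and f: "f \<in> carrier (tensor_alg 0 0 n)" and bal: "\<And>u s. u \<in> Poly_Mapping.keys f \<Longrightarrow> content u s = 0"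
  shows "\<exists>c. poly_act scale E f v = scale c v \<and> ten.act f x = ten_scale c x"
proof -
  interpret gl_module scale n E by (rule E)
  have "\<exists>c. foldr (\<lambda>(a, b). E (idx a) (idx b)) u v = scale c v \<and> foldr ten_gen u x = ten_scale c x"
    if "u \<in> Poly_Mapping.keys f" for u
    using common_eigenvalue[OF E v x] f bal that by (simp add: in_tensor_carrier)
  then obtain c where c: "\<And>u. u \<in> Poly_Mapping.keys f \<Longrightarrow>
      foldr (\<lambda>(a, b). E (idx a) (idx b)) u v = scale (c u) v \<and> foldr ten_gen u x = ten_scale (c u) x"
    by metis
  have "poly_act scale E f v = scale (\<Sum>u\<in>Poly_Mapping.keys f. Poly_Mapping.lookup f u * c u) v"
    by (simp add: poly_act_def c scale_sum_left)
  moreover have "ten.act f x = ten_scale (\<Sum>u\<in>Poly_Mapping.keys f. Poly_Mapping.lookup f u * c u) x"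
    by (simp add: ten.act_def c ten.scale_sum_left)
  ultimately show ?thesis by blast
qed

subsection \<open>Anticommuting operators\<close>

lemma ten_scale_simps [simp]: "ten_scale 0 x = 0" "ten_scale 1 x = x" "ten_scale k 0 = 0"
  by simp_all

lemma ten_eq_uminus: "(x :: tens) = - x \<Longrightarrow> x = 0"
  by (auto simp: fun_eq_iff)

definition anticommuting :: "('c \<Rightarrow> tens \<Rightarrow> tens) \<Rightarrow> bool" where
  "anticommuting F \<longleftrightarrow> (\<forall>c. Vector_Spaces.linear ten_scale ten_scale (F c)) \<and>
     (\<forall>c d x. F c (F d x) = - F d (F c x))"

lemma anticommutingD: "anticommuting F \<Longrightarrow> F c (F d x) = - F d (F c x)"
  unfolding anticommuting_def by blast

lemma anticommuting_linear: "anticommuting F \<Longrightarrow> Vector_Spaces.linear ten_scale ten_scale (F c)"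
  unfolding anticommuting_def by blast

lemma
  assumes "anticommuting F"
  shows anticommuting_add: "F c (x + y) = F c x + F c y"
    and anticommuting_scale: "F c (ten_scale k x) = ten_scale k (F c x)"
proof -
  interpret Vector_Spaces.linear ten_scale ten_scale "F c" by (rule anticommuting_linear[OF assms])
  show "F c (x + y) = F c x + F c y" "F c (ten_scale k x) = ten_scale k (F c x)"
    by (rule add, rule scale)
qed

lemma anticommuting_0: "anticommuting F \<Longrightarrow> F c 0 = 0"
  using anticommuting_scale[of F c 0 0] by simp

lemma anticommuting_foldr_scale: "anticommuting F \<Longrightarrow> foldr F cs (ten_scale k x) = ten_scale k (foldr F cs x)"
  by (induction cs) (auto simp: anticommuting_scale)

lemma anticommuting_foldr_0: "anticommuting F \<Longrightarrow> foldr F cs 0 = 0"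
  by (induction cs) (simp_all add: anticommuting_0 del: zero_fun_apply)

lemma anticommuting_front:
  assumes F: "anticommuting F"
  shows "foldr F (c # u @ v) x = ten_scale ((- 1) ^ length u) (foldr F (u @ c # v) x)"
proof (induction u)
  case (Cons d u)
  have "foldr F (c # (d # u) @ v) x = - F d (foldr F (c # u @ v) x)"
    by (simp add: anticommutingD[OF F, of c d])
  also have "\<dots> = - ten_scale ((- 1) ^ length u) (F d (foldr F (u @ c # v) x))"
    unfolding Cons by (simp add: anticommuting_scale[OF F])
  finally show ?case by simp
qed simp

text \<open>The sign is chosen before the family \<open>F\<close>. Thus the same sign serves
  creation and annihilation operators, and \<open>e * e = 1\<close> makes it drop out of their
  product.\<close>

lemma anticommuting_perm:
  assumes "mset cs = mset cs'"
  shows "\<exists>e::complex. e * e = 1 \<and>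
    (\<forall>F. anticommuting F \<longrightarrow> (\<forall>x. foldr F cs x = ten_scale e (foldr F cs' x)))"
  using assms
proof (induction cs arbitrary: cs')
  case Nil
  then show ?case by (intro exI[of _ 1]) simp
next
  case (Cons c cs)
  have "c \<in> set cs'" by (metis Cons.prems list.set_intros(1) mset_eq_setD)
  then obtain u v where cs': "cs' = u @ c # v" by (metis split_list)
  have "mset cs = mset (u @ v)" using Cons.prems cs' by simp
  from Cons.IH[OF this] obtain e :: complex where e: "e * e = 1"
    "\<And>F x. anticommuting F \<Longrightarrow> foldr F cs x = ten_scale e (foldr F (u @ v) x)" by blast
  let ?e = "(- 1) ^ length u * e"
  have "foldr F (c # cs) x = ten_scale ?e (foldr F cs' x)" if F: "anticommuting F" for F x
  proof -
    have "foldr F (c # cs) x = ten_scale e (foldr F (c # u @ v) x)"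
      by (simp add: e(2)[OF F] anticommuting_scale[OF F])
    then show ?thesis unfolding anticommuting_front[OF F] cs' by (simp add: mult.commute)
  qed
  moreover have "?e * ?e = 1"
    using e(1) by (simp add: algebra_simps flip: power_mult_distrib power_add mult_2)
  ultimately show ?case by blast
qed

lemma anticommuting_rev:
  assumes F: "anticommuting F"
  shows "foldr F (rev cs) x = ten_scale ((- 1) ^ (length cs choose 2)) (foldr F cs x)"
proof (induction cs)
  case (Cons c cs)
  have "foldr F (c # rev cs) x = ten_scale ((- 1) ^ length cs) (foldr F (rev (c # cs)) x)"
    using anticommuting_front[OF F, of c "rev cs" "[]" x] by simp
  then have "ten_scale ((- 1) ^ length cs) (foldr F (c # rev cs) x) = foldr F (rev (c # cs)) x"
    by (simp flip: power_add mult_2)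
  moreover have "foldr F (c # rev cs) x = ten_scale ((- 1) ^ (length cs choose 2)) (foldr F (c # cs) x)"
    by (simp add: Cons anticommuting_scale[OF F])
  moreover have "Suc (length cs) choose 2 = length cs + (length cs choose 2)"
    by (simp add: numeral_2_eq_2)
  ultimately show ?case by (simp add: power_add)
qed (simp add: numeral_2_eq_2)

text \<open>Two equal factors can be brought together, and \<open>F c\<close> squares to 0 because
  it anticommutes with itself.\<close>

lemma anticommuting_repeat:
  assumes F: "anticommuting F" and "\<not> distinct cs"
  shows "foldr F cs x = 0"
proof -
  obtain u v w c where cs: "cs = u @ [c] @ v @ [c] @ w"
    using not_distinct_decomp[OF assms(2)] by blast
  have "F c (F c y) = 0" for y
    by (rule ten_eq_uminus[OF anticommutingD[OF F]])
  then have "foldr F (c # c # v @ w) x = 0" by simp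
  moreover have "foldr F (c # c # v @ w) x = ten_scale ((- 1) ^ length v) (foldr F (c # v @ c # w) x)"
    using anticommuting_front[OF F, of c v w x] by (simp add: anticommuting_scale[OF F])
  ultimately have "foldr F (c # v @ c # w) x = 0" by (simp del: zero_fun_apply)
  then show ?thesis by (simp add: cs anticommuting_foldr_0[OF F] del: zero_fun_apply)
qed

text \<open>\<open>D\<close> acts as a derivation that replaces one factor \<open>c\<close> by
  \<open>g c\<close>. As \<open>g c\<close> is already among the other factors, each such term
  contains a repeated factor.\<close>

lemma derivation_kills:
  assumes F: "anticommuting F"
    and D: "\<And>c x. D (F c x) = F c (D x) + (if P c then ten_scale s (F (g c) x) else 0)"
    and y: "D y = 0"
    and cs: "\<And>c. c \<in> set cs \<Longrightarrow> P c \<Longrightarrow> g c \<noteq> c \<and> g c \<in> set cs"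
  shows "D (foldr F cs y) = 0"
proof -
  have add: "foldr F us (a + b) = foldr F us a + foldr F us b" for us a b
  proof (induction us)
    case (Cons c us)
    then show ?case by (simp add: anticommuting_add[OF F] del: plus_fun_apply)
  qed (simp del: plus_fun_apply)
  \<comment> \<open>\<open>us\<close> holds the factors that \<open>D\<close> has already passed;
    the duplicate of \<open>g c\<close> may be on either side.\<close>
  have "foldr F us (D (foldr F cs y)) = 0"
    if "\<And>c. c \<in> set cs \<Longrightarrow> P c \<Longrightarrow> g c \<noteq> c \<and> g c \<in> set us \<union> set cs" for us
    using that
  proof (induction cs arbitrary: us)
    case Nil
    then show ?case by (simp add: y anticommuting_foldr_0[OF F] del: zero_fun_apply)
  next
    case (Cons c cs)
    have "foldr F (us @ [c]) (D (foldr F cs y)) = 0"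
      by (rule Cons.IH) (use Cons.prems in auto)
    then have "foldr F us (F c (D (foldr F cs y))) = 0" by (simp del: zero_fun_apply)
    moreover have "foldr F us (if P c then ten_scale s (F (g c) (foldr F cs y)) else 0) = 0"
    proof (cases "P c")
      case True
      then have "\<not> distinct (us @ g c # cs)" using Cons.prems[of c] by auto
      from anticommuting_repeat[OF F this, of y] True show ?thesis
        by (simp add: anticommuting_foldr_scale[OF F] del: zero_fun_apply)
    qed (simp add: anticommuting_foldr_0[OF F] del: zero_fun_apply)
    ultimately show ?case by (simp add: D add del: zero_fun_apply plus_fun_apply)
  qed
  from this[of "[]"] cs show ?thesis by simp
qed

subsection \<open>Raising and lowering operators attached to cells\<close>

text \<open>The cell in row p and column j stands for the pair of \<open>Alpha p\<close> and letter
  j. Creation turns a letter j of the tensor into \<open>Alpha p\<close>, annihilation does the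
  converse.\<close>

definition creat :: "nat \<times> nat \<Rightarrow> tens \<Rightarrow> tens" where
  "creat c = ten_act (Alpha (fst c)) (Letter (snd c))"

definition annih :: "nat \<times> nat \<Rightarrow> tens \<Rightarrow> tens" where
  "annih c = ten_act (Letter (snd c)) (Alpha (fst c))"

lemma anticommuting_creat: "anticommuting creat"
proof -
  have "creat c (creat d x) = - creat d (creat c x)" for c d x
    using ten_act_bracket[of "Alpha (fst c)" "Letter (snd c)" "Alpha (fst d)" "Letter (snd d)" x]
    by (simp add: creat_def bsign_def eq_neg_iff_add_eq_0 del: zero_fun_apply)
  moreover have "Vector_Spaces.linear ten_scale ten_scale (creat c)" for c
    unfolding creat_def by (rule ten_act_linear)
  ultimately show ?thesis unfolding anticommuting_def by blast
qed

lemma anticommuting_annih: "anticommuting annih"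
proof -
  have "annih c (annih d x) = - annih d (annih c x)" for c d x
    using ten_act_bracket[of "Letter (snd c)" "Alpha (fst c)" "Letter (snd d)" "Alpha (fst d)" x]
    by (simp add: annih_def bsign_def eq_neg_iff_add_eq_0 del: zero_fun_apply)
  moreover have "Vector_Spaces.linear ten_scale ten_scale (annih c)" for c
    unfolding annih_def by (rule ten_act_linear)
  ultimately show ?thesis unfolding anticommuting_def by blast
qed

lemma alpha_creat:
  "ten_act (Alpha q) (Alpha p) (creat c x) = creat c (ten_act (Alpha q) (Alpha p) x)
     + (if fst c = p then ten_scale 1 (creat (q, snd c) x) else 0)"
  using ten_act_bracket[of "Alpha q" "Alpha p" "Alpha (fst c)" "Letter (snd c)" x]
  by (auto simp: creat_def bsign_def algebra_simps simp del: zero_fun_apply plus_fun_apply)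

lemma letter_creat:
  "ten_act (Letter i) (Letter j) (creat c x) = creat c (ten_act (Letter i) (Letter j) x)
     + (if snd c = i then ten_scale (- 1) (creat (fst c, j) x) else 0)"
  using ten_act_bracket[of "Letter i" "Letter j" "Alpha (fst c)" "Letter (snd c)" x]
  by (auto simp: creat_def bsign_def algebra_simps simp del: zero_fun_apply plus_fun_apply)

lemma letter_annih:
  "ten_act (Letter i) (Letter j) (annih c x) = annih c (ten_act (Letter i) (Letter j) x)
     + (if snd c = j then ten_scale 1 (annih (fst c, i) x) else 0)"
  using ten_act_bracket[of "Letter i" "Letter j" "Letter (snd c)" "Alpha (fst c)" x]
  by (auto simp: annih_def bsign_def algebra_simps simp del: zero_fun_apply plus_fun_apply)

lemma annih_creat:
  "annih (p, j) (creat (q, i) x) = - creat (q, i) (annih (p, j) x)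
     + (if p = q then ten_act (Letter j) (Letter i) x else 0)
     + (if i = j then ten_act (Alpha q) (Alpha p) x else 0)"
  using ten_act_bracket[of "Letter j" "Alpha p" "Alpha q" "Letter i" x]
  by (auto simp: creat_def annih_def bsign_def algebra_simps simp del: zero_fun_apply plus_fun_apply)

definition creat_word :: "(nat \<times> nat) list \<Rightarrow> gl_word" where
  "creat_word cs = map (\<lambda>(p, i). (Alpha p, Letter i)) cs"

definition annih_word :: "(nat \<times> nat) list \<Rightarrow> gl_word" where
  "annih_word cs = map (\<lambda>(p, i). (Letter i, Alpha p)) cs"

lemma foldr_creat_word: "foldr ten_gen (creat_word cs) x = foldr creat cs x"
  by (induction cs) (auto simp: creat_word_def creat_def)

lemma foldr_annih_word: "foldr ten_gen (annih_word cs) x = foldr annih cs x"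
  by (induction cs) (auto simp: annih_word_def annih_def)

subsection \<open>Partitions\<close>

lemma part_antimono:
  assumes "is_partition lam" "1 \<le> i" "i \<le> j"
  shows "part lam j \<le> part lam i"
proof (cases "i = j \<or> j > length lam")
  case True
  then show ?thesis by (auto simp: Defs.part_def)
next
  case False
  then show ?thesis
    using assms sorted_wrt_nth_less[of "(\<ge>)" lam "i - 1" "j - 1"] by (auto simp: Defs.part_def is_partition_def)
qed

lemma part_pos_le_length: "1 \<le> j \<Longrightarrow> j \<le> part lam i \<Longrightarrow> 1 \<le> i \<and> i \<le> length lam"
  by (auto simp: Defs.part_def split: if_splits)

lemma part_conjugate:
  assumes "is_partition lam" "1 \<le> j"
  shows "part (conjugate lam) j = card {i \<in> {1..length lam}. j \<le> part lam i}"
proof (cases "j \<le> part lam 1")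
  case True
  moreover have "[1..<Suc (part lam 1)] ! (j - 1) = j" using True assms(2) by (subst nth_upt) auto
  ultimately show ?thesis
    unfolding Defs.part_def[of "conjugate lam" j] unfolding conjugate_def
    using True assms(2) by (simp del: upt_Suc)
next
  case False
  have "{i \<in> {1..length lam}. j \<le> part lam i} = {}"
    using part_antimono[OF assms(1), of 1] False by fastforce
  then show ?thesis
    unfolding Defs.part_def[of "conjugate lam" j] unfolding conjugate_def
    using False by (simp del: upt_Suc)
qed

lemma part_conjugate_set:
  assumes "is_partition lam" "1 \<le> j"
  shows "{i \<in> {1..length lam}. j \<le> part lam i} = {1..part (conjugate lam) j}"
proof -
  let ?A = "{i \<in> {1..length lam}. j \<le> part lam i}"
  have down: "i \<in> ?A" if "i' \<in> ?A" "1 \<le> i" "i \<le> i'" for i i'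
    using that part_antimono[OF assms(1), of i i'] by auto
  show ?thesis
  proof (cases "?A = {}")
    case True
    then show ?thesis unfolding part_conjugate[OF assms] by simp
  next
    case False
    have fin: "finite ?A" by simp
    have "?A = {1..Max ?A}"
    proof
      show "?A \<subseteq> {1..Max ?A}" using fin by auto
      show "{1..Max ?A} \<subseteq> ?A"
      proof
        fix i assume "i \<in> {1..Max ?A}"
        then show "i \<in> ?A" using down[OF Max_in[OF fin False], of i] by (simp only: atLeastAtMost_iff)
      qed
    qed
    then have "card ?A = Max ?A" by (metis card_atLeastAtMost diff_Suc_1)
    then show ?thesis unfolding part_conjugate[OF assms] using \<open>?A = {1..Max ?A}\<close> by simp
  qed
qed

text \<open>Transposition of the diagram as a Galois connection; it replaces the explicit formula of
  \<open>conjugate\<close> from here on.\<close>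

lemma le_part_conjugate_iff:
  assumes "is_partition lam" "1 \<le> i" "1 \<le> j"
  shows "i \<le> part (conjugate lam) j \<longleftrightarrow> j \<le> part lam i"
proof -
  have "i \<le> part (conjugate lam) j \<longleftrightarrow> i \<in> {i \<in> {1..length lam}. j \<le> part lam i}"
    using part_conjugate_set[OF assms(1,3)] assms(2) by auto
  also have "\<dots> \<longleftrightarrow> j \<le> part lam i" using part_pos_le_length[OF assms(3), of lam i] by auto
  finally show ?thesis .
qed

lemma cells_iff: "(i, j) \<in> cells lam \<longleftrightarrow> 1 \<le> i \<and> 1 \<le> j \<and> j \<le> part lam i"
  using part_pos_le_length[of j lam i] by (auto simp: cells_def)

lemma finite_cells: "finite (cells lam)"
proof (rule finite_subset)
  show "cells lam \<subseteq> (SIGMA i:{1..length lam}. {1..part lam i})" by (auto simp: cells_def)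
qed simp

subsection \<open>The order in which the cells are filled\<close>

text \<open>Rows from top to bottom and each row from right to left: in this order the annihilation operator
  of a cell kills every state in which exactly the earlier cells have been created.\<close>

definition before :: "nat \<times> nat \<Rightarrow> nat \<times> nat \<Rightarrow> bool" where
  "before c d \<longleftrightarrow> fst c < fst d \<or> fst c = fst d \<and> snd d < snd c"

text \<open>As operators act from the right end of a word, the cell filled last is the head of the list.\<close>

primrec filling :: "nat list \<Rightarrow> (nat \<times> nat) list \<Rightarrow> bool" where
  "filling lam [] \<longleftrightarrow> True"
| "filling lam (c # cs) \<longleftrightarrow> c \<in> cells lam \<and> set cs = {d \<in> cells lam. before d c} \<and> filling lam cs"

lemma filling_distinct: "filling lam cs \<Longrightarrow> distinct cs"
  by (induction cs) (auto simp: before_def)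

text \<open>Generalized to sets of cells closed under earlier cells. The cell to remove is the last
  one, the leftmost cell of the lowest occupied row.\<close>

lemma filling_exists: "\<exists>cs. filling lam cs \<and> set cs = cells lam"
proof -
  have "\<exists>cs. filling lam cs \<and> set cs = D"
    if "D \<subseteq> cells lam" "\<And>c d. d \<in> D \<Longrightarrow> c \<in> cells lam \<Longrightarrow> before c d \<Longrightarrow> c \<in> D" for D
    using that
  proof (induction "card D" arbitrary: D)
    case 0
    then have "D = {}" using finite_subset[OF _ finite_cells] by auto
    then show ?case by (intro exI[of _ "[]"]) simp
  next
    case (Suc k)
    have fin: "finite D" using Suc.prems(1) finite_cells finite_subset by blast
    have ne: "D \<noteq> {}" using Suc.hyps(2) by auto
    define p where "p = Max (fst ` D)"
    define R where "R = snd ` {c \<in> D. fst c = p}"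
    have "p \<in> fst ` D" unfolding p_def using fin ne by (intro Max_in) auto
    then have R: "finite R" "R \<noteq> {}" using fin by (auto simp: R_def)
    define m where "m = (p, Min R)"
    have m: "m \<in> D" using Min_in[OF R] by (auto simp: m_def R_def)
    have last: "before d m" if d: "d \<in> D" "d \<noteq> m" for d
    proof -
      have "fst d \<le> p" unfolding p_def using fin d by auto
      moreover have "fst d = p \<Longrightarrow> Min R \<le> snd d" using R d by (auto simp: R_def)
      ultimately show ?thesis using d(2) by (cases d) (auto simp: before_def m_def)
    qed
    have "\<exists>cs. filling lam cs \<and> set cs = D - {m}"
    proof (rule Suc.hyps(1))
      show "k = card (D - {m})" using Suc.hyps(2) m by simp
      show "c \<in> D - {m}" if "d \<in> D - {m}" "c \<in> cells lam" "before c d" for c d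
      proof -
        have "before d m" using last that by auto
        then have "c \<noteq> m" using that(3) by (auto simp: before_def)
        then show ?thesis using Suc.prems(2)[of d c] that by auto
      qed
    qed (use Suc.prems(1) in auto)
    then obtain cs where cs: "filling lam cs" "set cs = D - {m}" by blast
    have "D - {m} = {d \<in> cells lam. before d m}"
    proof (intro equalityI subsetI)
      show "d \<in> {d \<in> cells lam. before d m}" if "d \<in> D - {m}" for d
        using that last Suc.prems(1) by blast
      show "d \<in> D - {m}" if "d \<in> {d \<in> cells lam. before d m}" for d
      proof -
        have "d \<in> D" using that Suc.prems(2)[OF m] by blast
        moreover have "d \<noteq> m" using that by (auto simp: before_def)
        ultimately show ?thesis by blast
      qed
    qed
    then have "filling lam (m # cs)" using cs m Suc.prems(1) by auto
    moreover have "set (m # cs) = D" using cs(2) m by auto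
    ultimately show ?case by blast
  qed
  then show ?thesis by blast
qed

text \<open>The annihilator is moved through the creators. A creator in the same row leaves a
  raising operator, which changes a cell of column j higher up into one of column i; that cell is
  filled already, since rows above are at least as long. A creator in the same column leaves an
  operator that consumes \<open>Alpha p\<close>.\<close>

lemma annih_filling:
  assumes lam: "is_partition lam" and x: "letters_only x"
    and hw: "\<And>i j. 1 \<le> i \<Longrightarrow> i < j \<Longrightarrow> j \<le> part lam 1 \<Longrightarrow> ten_act (Letter i) (Letter j) x = 0"
    and c: "(p, j) \<in> cells lam"
    and cs: "filling lam cs" "\<And>d. d \<in> set cs \<Longrightarrow> before d (p, j)"
  shows "annih (p, j) (foldr creat cs x) = 0"
  using cs
proof (induction cs)
  case Nil
  have "has_count (Alpha p) 0 x" using x by (simp add: letters_only_def)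
  then show ?case by (simp add: annih_def ten_act_count_0 del: zero_fun_apply)
next
  case (Cons d cs)
  obtain q i where d: "d = (q, i)" by force
  let ?x = "foldr creat cs x"
  have set_cs: "set cs = {e \<in> cells lam. before e (q, i)}" and qi: "(q, i) \<in> cells lam"
    using Cons.prems(1) by (auto simp: d)
  have before: "q < p \<or> q = p \<and> j < i" using Cons.prems(2)[of d] by (simp add: d before_def)
  have IH: "annih (p, j) ?x = 0" using Cons by auto
  have "ten_act (Letter j) (Letter i) ?x = 0" if "p = q"
  proof (rule derivation_kills[where D = "ten_act (Letter j) (Letter i)" and P = "\<lambda>e. snd e = j"
        and s = "- 1" and g = "\<lambda>e. (fst e, i)" and F = creat and y = x and cs = cs])
    show "anticommuting creat" by (rule anticommuting_creat)
    show "ten_act (Letter j) (Letter i) (creat e y) = creat e (ten_act (Letter j) (Letter i) y)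
        + (if snd e = j then ten_scale (- 1) (creat (fst e, i) y) else 0)" for e y
      by (rule letter_creat)
    have ji: "j < i" using before that by simp
    have "part lam q \<le> part lam 1" using part_antimono[OF lam, of 1 q] qi by (simp add: cells_iff)
    then show "ten_act (Letter j) (Letter i) x = 0" using hw[of j i] ji c qi by (simp add: cells_iff)
    fix e assume e: "e \<in> set cs" "snd e = j"
    then have lt: "fst e < q" using set_cs ji by (cases e) (auto simp: before_def)
    then have "part lam q \<le> part lam (fst e)" using part_antimono[OF lam, of "fst e" q] e set_cs
      by (cases e) (auto simp: cells_iff)
    then show "(fst e, i) \<noteq> e \<and> (fst e, i) \<in> set cs"
      using e set_cs qi ji lt by (cases e) (auto simp: cells_iff before_def)
  qed
  moreover have "ten_act (Alpha q) (Alpha p) ?x = 0" if "i = j"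
  proof (rule derivation_kills[where D = "ten_act (Alpha q) (Alpha p)" and P = "\<lambda>e. fst e = p"
        and s = 1 and g = "\<lambda>e. (q, snd e)" and F = creat and y = x and cs = cs])
    show "anticommuting creat" by (rule anticommuting_creat)
    show "ten_act (Alpha q) (Alpha p) (creat e y) = creat e (ten_act (Alpha q) (Alpha p) y)
        + (if fst e = p then ten_scale 1 (creat (q, snd e) y) else 0)" for e y
      by (rule alpha_creat)
    have "has_count (Alpha p) 0 x" using x by (simp add: letters_only_def)
    then show "ten_act (Alpha q) (Alpha p) x = 0" by (rule ten_act_count_0)
    fix e assume e: "e \<in> set cs" "fst e = p"
    then have "before e (q, i)" using set_cs by blast
    \<comment> \<open>Vacuous: \<open>q < p\<close> here, and no cell of row \<open>p\<close> comes
      before one of row \<open>q\<close>.\<close>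
    then show "(q, snd e) \<noteq> e \<and> (q, snd e) \<in> set cs"
      using before that e(2) by (simp add: before_def)
  qed
  ultimately show ?case
    by (simp add: d annih_creat IH anticommuting_0[OF anticommuting_creat] del: zero_fun_apply plus_fun_apply)
qed

text \<open>The anticommutator is diagonal. Of the letters j, one has been consumed for each of the
  p - 1 cells above, leaving leg plus one; the \<open>Alpha p\<close> present come from the cells to
  the right, which is the arm.\<close>

lemma annih_creat_filling:
  assumes lam: "is_partition lam" and x: "letters_only x"
    and hw: "\<And>i j. 1 \<le> i \<Longrightarrow> i < j \<Longrightarrow> j \<le> part lam 1 \<Longrightarrow> ten_act (Letter i) (Letter j) x = 0"
    and wt: "\<And>i. 1 \<le> i \<Longrightarrow> has_count (Letter i) (int (part (conjugate lam) i)) x"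
    and cs: "filling lam (c # cs)"
  shows "annih c (creat c (foldr creat cs x)) = ten_scale (of_nat (hook_length lam c)) (foldr creat cs x)"
proof -
  obtain p j where c: "c = (p, j)" by force
  have pj: "1 \<le> p" "1 \<le> j" "j \<le> part lam p" using cs by (auto simp: c cells_iff)
  have pj': "p \<le> part (conjugate lam) j" using le_part_conjugate_iff[OF lam pj(1,2)] pj(3) by simp
  have set_cs: "set cs = {e \<in> cells lam. before e (p, j)}" and fill: "filling lam cs"
    using cs by (auto simp: c)
  let ?x = "foldr creat cs x"
  have A: "annih (p, j) ?x = 0"
    by (rule annih_filling[OF lam x hw _ fill]) (use cs c set_cs in auto)
  have count: "count_list (map f cs) a = card {e \<in> set cs. f e = a}" for f :: "_ \<Rightarrow> glsym" and a
    using distinct_card[OF distinct_filter[OF filling_distinct[OF fill]], of "\<lambda>e. f e = a"]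
    by (simp add: count_list_eq_length_filter filter_map o_def eq_commute)
  have "{e \<in> set cs. snd e = j} = (\<lambda>q. (q, j)) ` {1..<p}"
  proof (intro equalityI subsetI)
    fix e assume "e \<in> {e \<in> set cs. snd e = j}"
    then have "snd e = j" "1 \<le> fst e" "fst e < p"
      using set_cs by (cases e; auto simp: cells_iff before_def)+
    then show "e \<in> (\<lambda>q. (q, j)) ` {1..<p}" by (intro image_eqI[of _ _ "fst e"]) (auto simp: prod_eq_iff)
  next
    fix e assume "e \<in> (\<lambda>q. (q, j)) ` {1..<p}"
    then obtain q where q: "e = (q, j)" "1 \<le> q" "q < p" by auto
    then have "j \<le> part lam q" using part_antimono[OF lam, of q p] pj by simp
    then show "e \<in> {e \<in> set cs. snd e = j}" using q set_cs pj by (simp add: cells_iff before_def)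
  qed
  then have col: "card {e \<in> set cs. snd e = j} = p - 1"
    by (simp add: card_image inj_on_def)
  have "{e \<in> set cs. fst e = p} = (\<lambda>i. (p, i)) ` {j<..part lam p}"
  proof (intro equalityI subsetI)
    fix e assume "e \<in> {e \<in> set cs. fst e = p}"
    then have "fst e = p" "j < snd e" "snd e \<le> part lam p"
      using set_cs by (cases e; auto simp: cells_iff before_def)+
    then show "e \<in> (\<lambda>i. (p, i)) ` {j<..part lam p}"
      by (intro image_eqI[of _ _ "snd e"]) (auto simp: prod_eq_iff)
  next
    fix e assume "e \<in> (\<lambda>i. (p, i)) ` {j<..part lam p}"
    then obtain i where "e = (p, i)" "j < i" "i \<le> part lam p" by auto
    then show "e \<in> {e \<in> set cs. fst e = p}" using set_cs pj by (simp add: cells_iff before_def)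
  qed
  then have row: "card {e \<in> set cs. fst e = p} = part lam p - j"
    by (simp add: card_image inj_on_def)
  have "has_count (Letter j) (int (part (conjugate lam) j) + int (count_list (map fst (creat_word cs)) (Letter j))
      - int (count_list (map snd (creat_word cs)) (Letter j))) ?x"
    using foldr_has_count[OF wt[OF pj(2)], of "creat_word cs"] by (simp add: foldr_creat_word)
  moreover have "count_list (map fst (creat_word cs)) (Letter j) = 0"
    by (auto simp: count_list_0_iff creat_word_def)
  moreover have "count_list (map snd (creat_word cs)) (Letter j) = p - 1"
    using count[of "\<lambda>e. Letter (snd e)" "Letter j"] col by (simp add: creat_word_def case_prod_unfold o_def)
  ultimately have L: "has_count (Letter j) (int (part (conjugate lam) j - (p - 1))) ?x"
    using pj' by simp
  have "has_count (Alpha p) (0 + int (count_list (map fst (creat_word cs)) (Alpha p))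
      - int (count_list (map snd (creat_word cs)) (Alpha p))) ?x"
    using foldr_has_count[of "Alpha p" 0 x "creat_word cs"] x by (simp add: foldr_creat_word letters_only_def)
  moreover have "count_list (map snd (creat_word cs)) (Alpha p) = 0"
    by (auto simp: count_list_0_iff creat_word_def)
  moreover have "count_list (map fst (creat_word cs)) (Alpha p) = part lam p - j"
    using count[of "\<lambda>e. Alpha (fst e)" "Alpha p"] row by (simp add: creat_word_def case_prod_unfold o_def)
  ultimately have R: "has_count (Alpha p) (int (part lam p - j)) ?x" by simp
  have hook: "hook_length lam (p, j) = (part (conjugate lam) j - (p - 1)) + (part lam p - j)"
    using pj pj' by (simp add: hook_length_def)
  show ?thesis
    unfolding c annih_creat A ten_act_diag[OF L] ten_act_diag[OF R] hook
    by (simp add: anticommuting_0[OF anticommuting_creat] ten.scale_left_distrib del: zero_fun_apply plus_fun_apply)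
qed

lemma annih_creat_product:
  assumes lam: "is_partition lam" and x: "letters_only x"
    and hw: "\<And>i j. 1 \<le> i \<Longrightarrow> i < j \<Longrightarrow> j \<le> part lam 1 \<Longrightarrow> ten_act (Letter i) (Letter j) x = 0"
    and wt: "\<And>i. 1 \<le> i \<Longrightarrow> has_count (Letter i) (int (part (conjugate lam) i)) x"
    and cs: "filling lam cs"
  shows "foldr annih (rev cs) (foldr creat cs x) = ten_scale (of_nat (\<Prod>c\<in>set cs. hook_length lam c)) x"
  using cs
proof (induction cs)
  case (Cons c cs)
  have "c \<notin> set cs" using filling_distinct[OF Cons.prems] by simp
  have "foldr annih (rev (c # cs)) (foldr creat (c # cs) x) =
      foldr annih (rev cs) (annih c (creat c (foldr creat cs x)))" by simp
  also have "\<dots> = ten_scale (of_nat (hook_length lam c)) (foldr annih (rev cs) (foldr creat cs x))"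
  proof -
    have "annih c (creat c (foldr creat cs x)) = ten_scale (of_nat (hook_length lam c)) (foldr creat cs x)"
      by (rule annih_creat_filling[OF lam x _ _ Cons.prems]) (rule hw wt; assumption)+
    then show ?thesis by (simp only: anticommuting_foldr_scale[OF anticommuting_annih])
  qed
  also have "foldr annih (rev cs) (foldr creat cs x) = ten_scale (of_nat (\<Prod>c\<in>set cs. hook_length lam c)) x"
    using Cons by (simp only: filling.simps)
  finally show ?case unfolding list.set(2) using \<open>c \<notin> set cs\<close> by simp
qed simp

text \<open>The list \<open>L\<close> is any enumeration of the cells: passing to the filling order
  changes both products by the same sign, and only the reversal of one of them costs a sign.\<close>

lemma annih_creat_cells:
  assumes lam: "is_partition lam" and x: "letters_only x"
    and hw: "\<And>i j. 1 \<le> i \<Longrightarrow> i < j \<Longrightarrow> j \<le> part lam 1 \<Longrightarrow> ten_act (Letter i) (Letter j) x = 0"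
    and wt: "\<And>i. 1 \<le> i \<Longrightarrow> has_count (Letter i) (int (part (conjugate lam) i)) x"
    and L: "distinct L" "set L = cells lam"
  shows "foldr annih L (foldr creat L x) =
    ten_scale ((- 1) ^ (length L choose 2) * of_nat (hook_product lam)) x"
proof -
  obtain cs where cs: "filling lam cs" "set cs = cells lam" using filling_exists by blast
  have "mset L = mset cs"
    using L cs filling_distinct[OF cs(1)] set_eq_iff_mset_eq_distinct[of L cs] by simp
  then obtain e :: complex where e: "e * e = 1"
    "\<And>F x. anticommuting F \<Longrightarrow> foldr F L x = ten_scale e (foldr F cs x)"
    using anticommuting_perm[of L cs] by blast
  have len: "length L = length cs" using \<open>mset L = mset cs\<close> by (rule mset_eq_length)
  have "foldr annih L (foldr creat L x) = foldr annih cs (foldr creat cs x)"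
    by (simp add: e anticommuting_creat anticommuting_annih anticommuting_foldr_scale)
  moreover have "foldr annih (rev cs) (foldr creat cs x) = ten_scale (of_nat (hook_product lam)) x"
    using annih_creat_product[OF lam x hw wt cs(1)] cs(2) by (simp add: hook_product_def)
  ultimately have "ten_scale ((- 1) ^ (length L choose 2)) (foldr annih L (foldr creat L x)) =
      ten_scale (of_nat (hook_product lam)) x"
    using anticommuting_rev[OF anticommuting_annih, of cs "foldr creat cs x"] len by simp
  then have "ten_scale ((- 1) ^ (length L choose 2)) (ten_scale ((- 1) ^ (length L choose 2))
      (foldr annih L (foldr creat L x))) =
      ten_scale ((- 1) ^ (length L choose 2)) (ten_scale (of_nat (hook_product lam)) x)"
    by (rule arg_cong)
  then show ?thesis by (simp flip: power_add mult_2)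
qed

subsection \<open>Row-strict tableaux\<close>

lemma zip_concat_map:
  "(\<And>x. x \<in> set xs \<Longrightarrow> length (f x) = length (g x)) \<Longrightarrow>
    zip (concat (map f xs)) (concat (map g xs)) = concat (map (\<lambda>x. zip (f x) (g x)) xs)"
  by (induction xs) simp_all

lemma row_strict_tableaux_nth:
  "S \<in> row_strict_tableaux n lam \<Longrightarrow> p < length lam \<Longrightarrow> length (S ! p) = part lam (Suc p)"
  by (auto simp: row_strict_tableaux_def Defs.part_def)

lemma row_strict_tableaux_length: "S \<in> row_strict_tableaux n lam \<Longrightarrow> length S = length lam"
  by (auto simp: row_strict_tableaux_def)

lemma row_strict_tableaux_row:
  assumes "S \<in> row_strict_tableaux n lam" "r \<in> set S"
  shows "sorted_wrt (<) r" "distinct r" "set r \<subseteq> {1..n}"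
  using assms strict_sorted_iff[of r] by (auto simp: row_strict_tableaux_def)

lemma row_strict_tableaux_finite: "finite (row_strict_tableaux n lam)"
proof (rule finite_subset)
  let ?R = "{r. set r \<subseteq> {1..n} \<and> length r \<le> sum_list lam}"
  show "row_strict_tableaux n lam \<subseteq> {S. set S \<subseteq> ?R \<and> length S = length lam}"
  proof
    fix S assume S: "S \<in> row_strict_tableaux n lam"
    have "r \<in> ?R" if r: "r \<in> set S" for r
    proof -
      have "length r \<in> set lam" using S r by (auto simp: row_strict_tableaux_def)
      then have "length r \<le> sum_list lam" by (rule member_le_sum_list) simp
      then show ?thesis using row_strict_tableaux_row(3)[OF S r] by blast
    qed
    then show "S \<in> {S. set S \<subseteq> ?R \<and> length S = length lam}"
      using row_strict_tableaux_length[OF S] by blast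
  qed
  show "finite {S. set S \<subseteq> ?R \<and> length S = length lam}"
    by (intro finite_lists_length_eq finite_lists_length_le) simp
qed

lemma length_concat_rows: "map length S = lam \<Longrightarrow> length (concat S) = sum_list lam"
  by (auto simp: length_concat)

section \<open>Contents of row-strict tableaux and dominance\<close>

lemma sum_part_take:
  assumes S: "S \<in> row_strict_tableaux n lam"
  shows "(\<Sum>p=1..r. part lam p) = length (concat (take r S))"
proof (induction r)
  case (Suc r)
  show ?case
  proof (cases "r < length S")
    case True
    then show ?thesis
      using Suc row_strict_tableaux_nth[OF S, of r] row_strict_tableaux_length[OF S]
      by (simp add: take_Suc_conv_app_nth)
  next
    case False
    then have "part lam (Suc r) = 0" using row_strict_tableaux_length[OF S] by (simp add: Defs.part_def)
    then show ?thesis using Suc False by simp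
  qed
qed simp

lemma count_list_distinct: "distinct xs \<Longrightarrow> count_list xs x = (if x \<in> set xs then 1 else 0)"
  by (induction xs) auto

lemma count_concat_distinct:
  "(\<And>r. r \<in> set xs \<Longrightarrow> distinct r) \<Longrightarrow> count_list (concat xs) i \<le> length xs"
proof (induction xs)
  case (Cons r xs)
  have "count_list r i \<le> 1" using Cons.prems by (simp add: count_list_distinct)
  then show ?case using Cons by simp
qed simp

lemma card_filter_sum: "finite A \<Longrightarrow> card {x \<in> A. P x} = (\<Sum>x\<in>A. if P x then 1 else 0)"
  by (simp only: card_eq_sum sum.inter_filter)

text \<open>Counts the cells in the first \<open>r\<close> rows of the diagram, by columns and by
  rows.\<close>

lemma sum_min_conjugate:
  assumes mu: "is_partition mu" and n: "part mu 1 \<le> n"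
  shows "(\<Sum>i=1..n. min r (part (conjugate mu) i)) = (\<Sum>k=1..r. part mu k)"
proof -
  have "(\<Sum>i=1..n. min r (part (conjugate mu) i)) = (\<Sum>i=1..n. \<Sum>k=1..r. if i \<le> part mu k then 1 else 0)"
  proof (rule sum.cong[OF refl])
    fix i assume i: "i \<in> {1..n}"
    have "{k \<in> {1..r}. i \<le> part mu k} = {1..min r (part (conjugate mu) i)}"
      using le_part_conjugate_iff[OF mu, of _ i] i by auto
    then have "card {k \<in> {1..r}. i \<le> part mu k} = min r (part (conjugate mu) i)" by simp
    then show "min r (part (conjugate mu) i) = (\<Sum>k=1..r. if i \<le> part mu k then 1 else 0)"
      by (simp only: card_filter_sum finite_atLeastAtMost)
  qed
  also have "\<dots> = (\<Sum>k=1..r. \<Sum>i=1..n. if i \<le> part mu k then 1 else 0)"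
    by (rule sum.swap)
  also have "\<dots> = (\<Sum>k=1..r. part mu k)"
  proof (rule sum.cong[OF refl])
    fix k assume "k \<in> {1..r}"
    then have "part mu k \<le> n" using part_antimono[OF mu, of 1 k] n by simp
    then have "{i \<in> {1..n}. i \<le> part mu k} = {1..part mu k}" by auto
    then have "card {i \<in> {1..n}. i \<le> part mu k} = part mu k" by simp
    then show "(\<Sum>i=1..n. if i \<le> part mu k then 1 else 0) = part mu k"
      by (simp only: card_filter_sum finite_atLeastAtMost)
  qed
  finally show ?thesis .
qed

definition fits :: "nat list \<Rightarrow> nat list list \<Rightarrow> bool" where
  "fits mu S \<longleftrightarrow> (\<forall>i\<ge>1. count_list (concat S) i \<le> part (conjugate mu) i)"

text \<open>A strictly increasing row contains a letter at most once, so the first \<open>r\<close>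
  rows contain it at most \<open>r\<close> times.\<close>

lemma fits_count_take:
  assumes S: "S \<in> row_strict_tableaux n lam" and "fits mu S" "1 \<le> i"
  shows "count_list (concat (take r S)) i \<le> min r (part (conjugate mu) i)"
proof -
  have "count_list (concat (take r S)) i \<le> length (take r S)"
    by (rule count_concat_distinct) (use row_strict_tableaux_row[OF S] in \<open>auto dest: in_set_takeD\<close>)
  moreover have "count_list (concat (take r S @ drop r S)) i \<le> part (conjugate mu) i"
    using assms(2,3) by (simp add: fits_def)
  ultimately show ?thesis unfolding concat_append by simp
qed

lemma sum_part_count:
  assumes S: "S \<in> row_strict_tableaux n lam"
  shows "(\<Sum>p=1..r. part lam p) = (\<Sum>i=1..n. count_list (concat (take r S)) i)"
proof -
  have "set (concat (take r S)) \<subseteq> {1..n}"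
    using row_strict_tableaux_row(3)[OF S] by (fastforce dest: in_set_takeD)
  then show ?thesis using sum_count_set[of "concat (take r S)" "{1..n}"] sum_part_take[OF S] by simp
qed

lemma fits_dominance:
  assumes mu: "is_partition mu" "part mu 1 \<le> n" and S: "S \<in> row_strict_tableaux n lam" "fits mu S"
  shows "(\<Sum>p=1..r. part lam p) \<le> (\<Sum>p=1..r. part mu p)"
  unfolding sum_part_count[OF S(1)] sum_min_conjugate[OF mu, symmetric]
  by (rule sum_mono) (use fits_count_take[OF S] in auto)

lemma sum_part_total: "length lam \<le> r \<Longrightarrow> (\<Sum>p=1..r. part lam p) = sum_list lam"
proof -
  assume r: "length lam \<le> r"
  have "(\<Sum>p=1..r. part lam p) = (\<Sum>p=1..length lam. part lam p)"
    by (rule sum.mono_neutral_right) (use r in \<open>auto simp: Defs.part_def\<close>)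
  also have "\<dots> = (\<Sum>p<length lam. part lam (Suc p))"
    by (rule sum.reindex_bij_witness[of _ Suc "\<lambda>p. p - 1"]) auto
  also have "\<dots> = sum_list lam"
    by (simp add: sum_list_sum_nth Defs.part_def atLeast0LessThan)
  finally show ?thesis .
qed

lemma fits_size:
  assumes "is_partition mu" "part mu 1 \<le> n" "S \<in> row_strict_tableaux n lam" "fits mu S"
  shows "sum_list lam \<le> sum_list mu"
  using fits_dominance[OF assms, of "max (length lam) (length mu)"]
  unfolding sum_part_total[OF max.cobounded1] sum_part_total[OF max.cobounded2] .

definition first_tableau :: "nat list \<Rightarrow> nat list list" where
  "first_tableau lam = map (\<lambda>p. [1..<Suc (part lam p)]) [1..<Suc (length lam)]"

lemma first_tableau_row_strict:
  assumes lam: "is_partition lam" "part lam 1 \<le> n"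
  shows "first_tableau lam \<in> row_strict_tableaux n lam"
proof -
  have "part lam p \<le> n" if "1 \<le> p" for p using part_antimono[OF lam(1), of 1 p] that lam(2) by simp
  moreover have "map length (first_tableau lam) = lam"
    by (rule nth_equalityI) (auto simp: first_tableau_def Defs.part_def simp del: upt_Suc)
  ultimately show ?thesis
    by (fastforce simp: row_strict_tableaux_def first_tableau_def simp del: upt_Suc)
qed

text \<open>For equal shapes the sums in the dominance argument agree, so the termwise bounds are
  equalities for every \<open>r\<close>. Comparing consecutive \<open>r\<close> determines which
  letters each row contains.\<close>

lemma fits_unique:
  assumes lam: "is_partition lam" "part lam 1 \<le> n" and S: "S \<in> row_strict_tableaux n lam" "fits lam S"
  shows "S = first_tableau lam"
proof (rule nth_equalityI)
  show "length S = length (first_tableau lam)"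
    using row_strict_tableaux_length[OF S(1)] by (simp add: first_tableau_def del: upt_Suc)
  fix p assume p: "p < length S"
  have count: "count_list (concat (take r S)) i = min r (part (conjugate lam) i)" if i: "i \<in> {1..n}" for r i
  proof (rule ccontr)
    assume ne: "count_list (concat (take r S)) i \<noteq> min r (part (conjugate lam) i)"
    have "(\<Sum>i=1..n. count_list (concat (take r S)) i) < (\<Sum>i=1..n. min r (part (conjugate lam) i))"
    proof (rule sum_strict_mono_ex1)
      show "\<forall>i\<in>{1..n}. count_list (concat (take r S)) i \<le> min r (part (conjugate lam) i)"
        using fits_count_take[OF S] by auto
      show "\<exists>i\<in>{1..n}. count_list (concat (take r S)) i < min r (part (conjugate lam) i)"
        using fits_count_take[OF S, of i r] ne i by (intro bexI[OF _ i]) auto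
    qed simp
    then show False using sum_part_count[OF S(1), of r] sum_min_conjugate[OF lam, of r] by simp
  qed
  have row: "sorted_wrt (<) (S ! p)" "distinct (S ! p)" "set (S ! p) \<subseteq> {1..n}"
    using row_strict_tableaux_row[OF S(1), of "S ! p"] p by auto
  have plen: "part lam (Suc p) \<le> n" using part_antimono[OF lam(1), of 1 "Suc p"] lam(2) by simp
  have "i \<in> set (S ! p) \<longleftrightarrow> i \<in> {1..part lam (Suc p)}" if i: "i \<in> {1..n}" for i
  proof -
    have "count_list (concat (take (Suc p) S)) i = count_list (concat (take p S)) i + count_list (S ! p) i"
      using p by (simp add: take_Suc_conv_app_nth)
    then have "count_list (S ! p) i + min p (part (conjugate lam) i) = min (Suc p) (part (conjugate lam) i)"
      using count[OF i] by simp
    then have "count_list (S ! p) i \<noteq> 0 \<longleftrightarrow> Suc p \<le> part (conjugate lam) i" by auto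
    then show ?thesis
      using le_part_conjugate_iff[OF lam(1), of "Suc p" i] i by (simp add: count_list_0_iff)
  qed
  then have "set (S ! p) = set [1..<Suc (part lam (Suc p))]"
    using row(3) plen by (auto simp del: upt_Suc)
  moreover have "sorted (S ! p)" using row(1) by (rule strict_sorted_imp_sorted)
  ultimately have "S ! p = [1..<Suc (part lam (Suc p))]"
    using row(2) by (intro sorted_distinct_set_unique) (auto simp del: upt_Suc)
  then show "S ! p = first_tableau lam ! p"
    using p row_strict_tableaux_length[OF S(1)] by (simp add: first_tableau_def del: upt_Suc)
qed

section \<open>The words of a tableau\<close>

definition lower_word :: "nat list \<Rightarrow> nat list list \<Rightarrow> gl_word" where
  "lower_word lam S = zip (concat (map (map Letter) S)) (concat (C_star lam))"

definition raise_word :: "nat list \<Rightarrow> nat list list \<Rightarrow> gl_word" where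
  "raise_word lam S = zip (concat (C_star lam)) (concat (map (map Letter) S))"

lemma C_star_length: "length (concat (C_star lam)) = sum_list lam"
proof (rule length_concat_rows)
  show "map length (C_star lam) = lam"
    by (rule nth_equalityI) (auto simp: C_star_def Defs.part_def simp del: upt_Suc)
qed

lemma letters_length:
  assumes "S \<in> row_strict_tableaux n lam"
  shows "length (concat (map (map Letter) S)) = sum_list lam"
  by (rule length_concat_rows) (use assms in \<open>auto simp: row_strict_tableaux_def o_def\<close>)

lemma raise_word_projections:
  assumes "S \<in> row_strict_tableaux n lam"
  shows "map fst (raise_word lam S) = concat (C_star lam)"
    "map snd (raise_word lam S) = map Letter (concat S)"
    "map fst (lower_word lam S) = map Letter (concat S)"
    "map snd (lower_word lam S) = concat (C_star lam)"
  using C_star_length[of lam] letters_length[OF assms]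
  by (simp_all add: raise_word_def lower_word_def map_concat)

lemma C_star_syms: "length lam \<le> m0 \<Longrightarrow> set (concat (C_star lam)) \<subseteq> virtual_syms m0 m1"
  by (auto simp: C_star_def virtual_syms_def)

lemma tableau_words_closed:
  assumes S: "S \<in> row_strict_tableaux n lam" and "length lam \<le> m0"
  shows "set (lower_word lam S) \<subseteq> syms m0 m1 n \<times> syms m0 m1 n"
    "set (raise_word lam S) \<subseteq> syms m0 m1 n \<times> syms m0 m1 n"
proof -
  have "set (map Letter (concat S)) \<subseteq> syms m0 m1 n"
    using row_strict_tableaux_row(3)[OF S] by (fastforce simp: syms_def)
  moreover have "set (concat (C_star lam)) \<subseteq> syms m0 m1 n"
    using C_star_syms[OF assms(2), of m1] by (auto simp: syms_def)
  ultimately have "set (map fst (lower_word lam S)) \<subseteq> syms m0 m1 n" "set (map snd (lower_word lam S)) \<subseteq> syms m0 m1 n"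
    "set (map fst (raise_word lam S)) \<subseteq> syms m0 m1 n" "set (map snd (raise_word lam S)) \<subseteq> syms m0 m1 n"
    unfolding raise_word_projections[OF S] by blast+
  then show "set (lower_word lam S) \<subseteq> syms m0 m1 n \<times> syms m0 m1 n"
    "set (raise_word lam S) \<subseteq> syms m0 m1 n \<times> syms m0 m1 n"
    by (auto simp: mem_Times_iff)
qed

lemma tableau_words_content:
  assumes "S \<in> row_strict_tableaux n lam"
  shows "content (lower_word lam S @ raise_word lam S) s = 0"
  by (simp add: content_append content_def raise_word_projections[OF assms])

lemma count_list_map_Letter: "count_list (map Letter xs) (Letter i) = count_list xs i"
  by (induction xs) auto

lemma not_fits_vanish:
  assumes S: "S \<in> row_strict_tableaux n lam"
    and wt: "\<And>i. 1 \<le> i \<Longrightarrow> has_count (Letter i) (int (part (conjugate mu) i)) x"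
    and "\<not> fits mu S"
  shows "foldr ten_gen (lower_word lam S @ raise_word lam S) x = 0"
proof -
  obtain i where i: "1 \<le> i" "part (conjugate mu) i < count_list (concat S) i"
    using assms(3) by (auto simp: fits_def not_le)
  have "count_list (concat (C_star lam)) (Letter i) = 0"
    by (auto simp: count_list_0_iff C_star_def)
  then have "has_count (Letter i) (int (part (conjugate mu) i) - int (count_list (concat S) i))
      (foldr ten_gen (raise_word lam S) x)"
    using foldr_has_count[OF wt[OF i(1)], of "raise_word lam S"]
    by (simp add: raise_word_projections[OF S] count_list_map_Letter)
  then have "foldr ten_gen (raise_word lam S) x = 0" by (rule has_count_neg) (use i(2) in simp)
  then show ?thesis by (simp del: zero_fun_apply)
qed

text \<open>Both words run through the cells in the same reading order \<open>L\<close>; neither is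
  reversed.\<close>

lemma first_tableau_words:
  defines "L \<equiv> \<lambda>lam. concat (map (\<lambda>p. map (Pair p) [1..<Suc (part lam p)]) [1..<Suc (length lam)])"
  shows "raise_word lam (first_tableau lam) = creat_word (L lam)"
    and "lower_word lam (first_tableau lam) = annih_word (L lam)"
    and "distinct (L lam)" and "set (L lam) = cells lam" and "length (L lam) = sum_list lam"
proof -
  let ?P = "[1..<Suc (length lam)]" and ?r = "\<lambda>p. [1..<Suc (part lam p)]"
  have zip1: "zip (replicate (length ys) (Alpha p)) (map Letter ys) = map (\<lambda>i. (Alpha p, Letter i)) ys"
    and zip2: "zip (map Letter ys) (replicate (length ys) (Alpha p)) = map (\<lambda>i. (Letter i, Alpha p)) ys" for p ys
    by (induction ys) simp_all
  have z1: "zip (replicate (part lam p) (Alpha p)) (map Letter (?r p)) = map (\<lambda>i. (Alpha p, Letter i)) (?r p)"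
    and z2: "zip (map Letter (?r p)) (replicate (part lam p) (Alpha p)) = map (\<lambda>i. (Letter i, Alpha p)) (?r p)" for p
    using zip1[of "?r p" p] zip2[of "?r p" p] by (simp_all del: upt_Suc)
  show "raise_word lam (first_tableau lam) = creat_word (L lam)"
    unfolding raise_word_def first_tableau_def C_star_def map_map
    by (subst zip_concat_map) (simp_all add: z1[unfolded One_nat_def] L_def creat_word_def map_concat o_def del: upt_Suc)
  show "lower_word lam (first_tableau lam) = annih_word (L lam)"
    unfolding lower_word_def first_tableau_def C_star_def map_map
    by (subst zip_concat_map) (simp_all add: z2[unfolded One_nat_def] L_def annih_word_def map_concat o_def del: upt_Suc)
  show set: "set (L lam) = cells lam"
  proof (intro equalityI subrelI)
    fix p i assume "(p, i) \<in> cells lam"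
    then have "p \<in> set ?P" "i \<in> set (?r p)" by (auto simp: cells_def simp del: upt_Suc)
    then have "(p, i) \<in> Pair p ` set (?r p)" by (intro image_eqI[of "(p, i)" "Pair p" i] refl)
    with \<open>p \<in> set ?P\<close> have "(p, i) \<in> (\<Union>p\<in>set ?P. Pair p ` set (?r p))" by (rule UN_I)
    then show "(p, i) \<in> set (L lam)" by (simp add: L_def image_image del: upt_Suc set_upt)
  qed (auto simp: L_def cells_def simp del: upt_Suc)
  show len: "length (L lam) = sum_list lam"
    unfolding L_def
  proof (rule length_concat_rows)
    show "map length (map (\<lambda>p. map (Pair p) (?r p)) ?P) = lam"
      by (rule nth_equalityI) (auto simp: Defs.part_def simp del: upt_Suc)
  qed
  have "distinct (concat (map (\<lambda>p. map (Pair p) (?r p)) ps))" if "distinct ps" for ps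
    using that by (induction ps) (auto simp: distinct_map inj_on_def simp del: upt_Suc)
  then show "distinct (L lam)" by (simp add: L_def del: upt_Suc)
qed

lemma first_tableau_action:
  assumes lam: "is_partition lam" and x: "letters_only x"
    and hw: "\<And>i j. 1 \<le> i \<Longrightarrow> i < j \<Longrightarrow> j \<le> part lam 1 \<Longrightarrow> ten_act (Letter i) (Letter j) x = 0"
    and wt: "\<And>i. 1 \<le> i \<Longrightarrow> has_count (Letter i) (int (part (conjugate lam) i)) x"
  shows "foldr ten_gen (lower_word lam (first_tableau lam) @ raise_word lam (first_tableau lam)) x =
    ten_scale ((- 1) ^ (sum_list lam choose 2) * of_nat (hook_product lam)) x"
proof -
  note L = first_tableau_words[of lam]
  show ?thesis
    using annih_creat_cells[OF lam x _ _ L(3,4)] hw wt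
    unfolding L(1,2,5) foldr_append foldr_creat_word foldr_annih_word by blast
qed

subsection \<open>Conjugation\<close>

lemma length_conjugate: "length (conjugate lam) = part lam 1"
  by (simp add: conjugate_def)

lemma is_partition_conjugate:
  assumes lam: "is_partition lam"
  shows "is_partition (conjugate lam)"
proof -
  have nth: "conjugate lam ! k = card {i \<in> {1..length lam}. Suc k \<le> part lam i}" if "k < part lam 1" for k
    using that by (simp add: conjugate_def nth_upt del: upt_Suc)
  have "conjugate lam ! l \<le> conjugate lam ! k" if "k < l" "l < part lam 1" for k l
    unfolding nth[OF that(2)] nth[OF less_trans[OF that]] by (rule card_mono) (use that in auto)
  then have "sorted_wrt (\<ge>) (conjugate lam)"
    by (auto simp: sorted_wrt_iff_nth_less length_conjugate)
  moreover have "0 \<notin> set (conjugate lam)"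
  proof
    assume "0 \<in> set (conjugate lam)"
    then obtain k where k: "k < part lam 1" "conjugate lam ! k = 0"
      by (auto simp: in_set_conv_nth length_conjugate)
    then have "{i \<in> {1..length lam}. Suc k \<le> part lam i} = {}" using nth[OF k(1)] by simp
    moreover have "1 \<in> {i \<in> {1..length lam}. Suc k \<le> part lam i}"
      using k(1) part_pos_le_length[of "Suc k" lam 1] by simp
    ultimately show False by blast
  qed
  ultimately show ?thesis by (simp add: is_partition_def)
qed

lemma part_conjugate_conjugate:
  assumes lam: "is_partition lam" and i: "1 \<le> i"
  shows "part (conjugate (conjugate lam)) i = part lam i"
proof -
  have "j \<le> part (conjugate (conjugate lam)) i \<longleftrightarrow> j \<le> part lam i" if "1 \<le> j" for j
    using le_part_conjugate_iff[OF is_partition_conjugate[OF lam] that i]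
      le_part_conjugate_iff[OF lam i that] by simp
  then show ?thesis by (metis le_antisym le_zero_eq not_less_eq_eq order_refl One_nat_def)
qed

text \<open>Transposition exchanges arms and legs.\<close>

lemma hook_product_conjugate:
  assumes lam: "is_partition lam"
  shows "hook_product (conjugate lam) = hook_product lam"
  unfolding hook_product_def
proof (rule prod.reindex_bij_witness[of _ prod.swap prod.swap])
  fix c assume "c \<in> cells lam"
  then show "prod.swap c \<in> cells (conjugate lam)"
    using le_part_conjugate_iff[OF lam] by (cases c) (auto simp: cells_iff)
next
  fix c assume "c \<in> cells (conjugate lam)"
  then show "prod.swap c \<in> cells lam"
    using le_part_conjugate_iff[OF lam] by (cases c) (auto simp: cells_iff)
next
  fix c assume "c \<in> cells (conjugate lam)"
  then show "hook_length lam (prod.swap c) = hook_length (conjugate lam) c"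
    by (cases c) (simp add: cells_iff hook_length_def part_conjugate_conjugate[OF lam])
qed auto

subsection \<open>Highest weight vectors in tensor space\<close>

definition basis_ten :: "glsym list \<Rightarrow> tens" where
  "basis_ten l0 = (\<lambda>l. if l = l0 then 1 else 0)"

lemma basis_ten_has_count: "has_count s (int (count_list l0 s)) (basis_ten l0)"
  by (simp add: has_count_def basis_ten_def)

lemma basis_ten_nonzero: "basis_ten l0 \<noteq> 0"
  by (auto simp: basis_ten_def fun_eq_iff)

text \<open>Odd operators applied to \<open>\<alpha>\<^sub>0 \<otimes> \<dots> \<otimes> \<alpha>\<^sub>0\<close> antisymmetrize: \<open>alt_part m 1\<close> is, up to sign,
  the tensor \<open>1 \<and> \<dots> \<and> m\<close>.\<close>

definition alt_part :: "nat \<Rightarrow> nat \<Rightarrow> tens" where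
  "alt_part m k = foldr annih (map (Pair 0) [k..<Suc m]) (basis_ten (replicate m (Alpha 0)))"

lemma alt_part_step: "k \<le> m \<Longrightarrow> alt_part m k = annih (0, k) (alt_part m (Suc k))"
  by (simp add: alt_part_def upt_conv_Cons del: upt_Suc)

lemma alt_part_has_count:
  "has_count s (int (count_list (replicate m (Alpha 0)) s)
     + int (count_list (map Letter [k..<Suc m]) s) - int (count_list (replicate (Suc m - k) (Alpha 0)) s)) (alt_part m k)"
proof -
  have "foldr annih cs x = foldr ten_gen (annih_word cs) x" for cs x
    by (rule foldr_annih_word[symmetric])
  then have eq: "alt_part m k = foldr ten_gen (annih_word (map (Pair 0) [k..<Suc m])) (basis_ten (replicate m (Alpha 0)))"
    by (simp add: alt_part_def)
  have "map snd (annih_word (map (Pair 0) [k..<Suc m])) = replicate (Suc m - k) (Alpha 0)"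
    "map fst (annih_word (map (Pair 0) [k..<Suc m])) = map Letter [k..<Suc m]"
    by (simp_all add: annih_word_def o_def map_replicate_const del: upt_Suc)
  then show ?thesis
    unfolding eq using foldr_has_count[OF basis_ten_has_count] by metis
qed

lemma count_list_replicate: "count_list (replicate k a) b = (if a = b then k else 0)"
  by (induction k) auto

lemma count_list_Letter_upt: "count_list (map Letter [k..<l]) (Letter i) = (if k \<le> i \<and> i < l then 1 else 0)"
proof -
  have "count_list (map Letter xs) (Letter i) = count_list xs i" for xs
    by (induction xs) auto
  then show ?thesis by (simp add: count_list_distinct)
qed

lemma count_list_Letter_virtual: "s \<notin> range Letter \<Longrightarrow> count_list (map Letter xs) s = 0"
  by (auto simp: count_list_0_iff)

text \<open>Creation undoes the last annihilation up to a nonzero factor: by the anticommutator it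
  multiplies \<open>alt_part m (Suc k)\<close> by \<open>k\<close>, the number of
  \<open>Alpha 0\<close> still present.\<close>

lemma alt_part_nonzero: "k \<ge> 1 \<Longrightarrow> alt_part m k \<noteq> 0"
proof (induction "Suc m - k" arbitrary: k)
  case 0
  then show ?case by (simp add: alt_part_def basis_ten_nonzero del: zero_fun_apply upt_Suc)
next
  case (Suc d)
  then have k: "k \<le> m" by linarith
  let ?x = "alt_part m (Suc k)"
  have nz: "?x \<noteq> 0" by (rule Suc.hyps(1)) (use Suc in auto)
  have "has_count (Letter k) 0 ?x"
    using alt_part_has_count[of "Letter k" m "Suc k"]
    by (simp add: count_list_replicate count_list_Letter_upt del: upt_Suc)
  then have cr: "creat (0, k) ?x = 0" "ten_act (Letter k) (Letter k) ?x = 0"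
    by (simp_all add: creat_def ten_act_count_0 del: zero_fun_apply)
  have "has_count (Alpha 0) (int k) ?x"
    using alt_part_has_count[of "Alpha 0" m "Suc k"] k
    by (simp add: count_list_replicate count_list_Letter_virtual image_iff of_nat_diff del: upt_Suc)
  then have al: "ten_act (Alpha 0) (Alpha 0) ?x = ten_scale (of_nat k) ?x"
    using ten_act_diag by fastforce
  have "creat (0, k) (annih (0, k) ?x) + annih (0, k) (creat (0, k) ?x) =
      ten_act (Alpha 0) (Alpha 0) ?x + ten_act (Letter k) (Letter k) ?x"
    using ten_act_bracket[of "Alpha 0" "Letter k" "Letter k" "Alpha 0" ?x]
    by (simp add: creat_def annih_def bsign_def del: zero_fun_apply plus_fun_apply)
  then have "creat (0, k) (alt_part m k) = ten_scale (of_nat k) ?x"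
    unfolding cr al alt_part_step[OF k] anticommuting_0[OF anticommuting_annih] by (simp only: add_0_right)
  moreover have "ten_scale (of_nat k) ?x \<noteq> 0" using nz Suc.prems by (simp del: zero_fun_apply)
  ultimately show ?case using anticommuting_0[OF anticommuting_creat] by metis
qed

definition alt :: "nat \<Rightarrow> tens" where
  "alt m = alt_part m 1"

lemma alt_has_count:
  "has_count (Letter i) (if 1 \<le> i \<and> i \<le> m then 1 else 0) (alt m)"
  "s \<notin> range Letter \<Longrightarrow> has_count s 0 (alt m)"
  using alt_part_has_count[of "Letter i" m 1] alt_part_has_count[of s m 1]
  by (auto simp: alt_def count_list_replicate count_list_Letter_upt count_list_Letter_virtual
      less_Suc_eq_le simp del: upt_Suc cong: if_cong split: if_splits)

text \<open>Raising replaces the factor of letter \<open>j\<close> by that of \<open>i < j\<close>,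
  which occurs already.\<close>

lemma alt_raising:
  assumes "1 \<le> i" "i < j"
  shows "ten_act (Letter i) (Letter j) (alt m) = 0"
  unfolding alt_def alt_part_def
proof (rule derivation_kills[where D = "ten_act (Letter i) (Letter j)" and P = "\<lambda>e. snd e = j"
      and s = 1 and g = "\<lambda>e. (fst e, i)" and F = annih and y = "basis_ten (replicate m (Alpha 0))"])
  show "anticommuting annih" by (rule anticommuting_annih)
  show "ten_act (Letter i) (Letter j) (annih e y) = annih e (ten_act (Letter i) (Letter j) y)
      + (if snd e = j then ten_scale 1 (annih (fst e, i) y) else 0)" for e y
    by (rule letter_annih)
  have "has_count (Letter j) 0 (basis_ten (replicate m (Alpha 0)))"
    using basis_ten_has_count[of "Letter j" "replicate m (Alpha 0)"] by (simp add: count_list_replicate)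
  then show "ten_act (Letter i) (Letter j) (basis_ten (replicate m (Alpha 0))) = 0"
    by (rule ten_act_count_0)
  fix e assume "e \<in> set (map (Pair 0) [1..<Suc m])" "snd e = j"
  then show "(fst e, i) \<noteq> e \<and> (fst e, i) \<in> set (map (Pair 0) [1..<Suc m])"
    using assms by (auto simp del: upt_Suc)
qed

lemma ten_act_length:
  "(\<And>l. x l \<noteq> 0 \<Longrightarrow> length l = m) \<Longrightarrow> ten_act a b x l \<noteq> 0 \<Longrightarrow> length l = m"
proof (induction l arbitrary: x m)
  case (Cons c l)
  show ?case
  proof (cases "ten_act a b (\<lambda>u. x (c # u)) l = 0")
    case True
    then have "x (b # l) \<noteq> 0" using Cons.prems(2) by (auto split: if_splits)
    then show ?thesis using Cons.prems(1)[of "b # l"] by simp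
  next
    case False
    \<comment> \<open>Truncated subtraction is harmless: for \<open>m = 0\<close> the slice
      vanishes, which is excluded next.\<close>
    have "length l = m - 1" by (rule Cons.IH[OF _ False]) (use Cons.prems(1) in fastforce)
    moreover have "m \<noteq> 0"
    proof
      assume "m = 0"
      then have "(\<lambda>u. x (c # u)) = (\<lambda>u. 0)" using Cons.prems(1) by (intro ext) fastforce
      then show False using False by (simp add: ten_act_0)
    qed
    ultimately show ?thesis by simp
  qed
qed simp

lemma alt_length: "alt m l \<noteq> 0 \<Longrightarrow> length l = m"
proof -
  have "foldr annih cs (basis_ten l0) l \<noteq> 0 \<Longrightarrow> length l = length l0" for cs l0 l
  proof (induction cs arbitrary: l)
    case Nil
    then show ?case by (simp add: basis_ten_def split: if_splits)
  next
    case (Cons c cs)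
    have "ten_act (Letter (snd c)) (Alpha (fst c)) (foldr annih cs (basis_ten l0)) l \<noteq> 0"
      using Cons.prems by (simp add: annih_def[symmetric])
    from ten_act_length[OF Cons.IH this] show ?case .
  qed
  from this[of _ "replicate m (Alpha 0)" l] show "alt m l \<noteq> 0 \<Longrightarrow> length l = m"
    by (simp add: alt_def alt_part_def del: upt_Suc)
qed

text \<open>The tensor product when \<open>x\<close> is homogeneous of degree \<open>m\<close>:
  words are cut at position \<open>m\<close>.\<close>

definition ten_mult :: "nat \<Rightarrow> tens \<Rightarrow> tens \<Rightarrow> tens" where
  "ten_mult m x y = (\<lambda>l. x (take m l) * y (drop m l))"

lemma ten_act_ten_mult:
  "ten_act (Letter i) (Letter j) (ten_mult m x y) l =
     ten_act (Letter i) (Letter j) x (take m l) * y (drop m l)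
     + x (take m l) * ten_act (Letter i) (Letter j) y (drop m l)"
proof (induction l arbitrary: m x)
  case (Cons c l)
  show ?case
  proof (cases m)
    case 0
    then show ?thesis by (simp add: ten_mult_def ten_act_mult algebra_simps)
  next
    case (Suc m')
    have "(\<lambda>u. ten_mult m x y (c # u)) = ten_mult m' (\<lambda>u. x (c # u)) y"
      by (simp add: Suc ten_mult_def)
    then show ?thesis using Cons[of m' "\<lambda>u. x (c # u)"]
      by (simp add: Suc ten_mult_def algebra_simps)
  qed
qed simp

lemma ten_mult_has_count:
  assumes "has_count s c x" "has_count s d y"
  shows "has_count s (c + d) (ten_mult m x y)"
  unfolding has_count_def
proof (intro allI impI)
  fix l assume "ten_mult m x y l \<noteq> 0"
  then have "int (count_list (take m l) s) = c" "int (count_list (drop m l) s) = d"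
    using assms by (auto simp: ten_mult_def has_count_def)
  moreover have "count_list l s = count_list (take m l) s + count_list (drop m l) s"
    by (metis append_take_drop_id count_list_append)
  ultimately show "int (count_list l s) = c + d" by simp
qed

text \<open>The highest weight vector in a tensor product of exterior powers, one for each part; its
  weight is the conjugate partition.\<close>

primrec hw_ten :: "nat list \<Rightarrow> tens" where
  "hw_ten [] = basis_ten []"
| "hw_ten (m # mu) = ten_mult m (alt m) (hw_ten mu)"

lemma hw_ten_nonzero: "hw_ten mu \<noteq> 0"
proof (induction mu)
  case Nil
  then show ?case by (simp add: basis_ten_nonzero del: zero_fun_apply)
next
  case (Cons m mu)
  have "alt m \<noteq> 0" by (simp add: alt_def alt_part_nonzero del: zero_fun_apply)
  then obtain l1 where l1: "alt m l1 \<noteq> 0" by (auto simp: fun_eq_iff)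
  obtain l2 where l2: "hw_ten mu l2 \<noteq> 0" using Cons by (auto simp: fun_eq_iff)
  have "hw_ten (m # mu) (l1 @ l2) \<noteq> 0"
    using l1 l2 alt_length[OF l1] by (simp add: ten_mult_def)
  then show ?case by (metis zero_fun_apply)
qed

lemma hw_ten_raising: "1 \<le> i \<Longrightarrow> i < j \<Longrightarrow> ten_act (Letter i) (Letter j) (hw_ten mu) = 0"
proof (induction mu)
  case Nil
  have "has_count (Letter j) 0 (basis_ten [])" using basis_ten_has_count[of "Letter j" "[]"] by simp
  then show ?case by (simp add: ten_act_count_0 del: zero_fun_apply)
next
  case (Cons m mu)
  then show ?case
    using alt_raising[of i j m] by (simp add: fun_eq_iff ten_act_ten_mult)
qed

lemma hw_ten_letters_only: "letters_only (hw_ten mu)"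
proof -
  have "has_count s 0 (hw_ten mu)" if s: "s \<notin> range Letter" for s
  proof (induction mu)
    case Nil
    show ?case using basis_ten_has_count[of s "[]"] by simp
  next
    case (Cons m mu)
    show ?case using ten_mult_has_count[OF alt_has_count(2)[OF s] Cons] by simp
  qed
  then show ?thesis by (auto simp: letters_only_def)
qed

lemma hw_ten_count_Letter:
  assumes "1 \<le> i"
  shows "has_count (Letter i) (int (length (filter (\<lambda>m. i \<le> m) mu))) (hw_ten mu)"
proof (induction mu)
  case Nil
  show ?case using basis_ten_has_count[of "Letter i" "[]"] by simp
next
  case (Cons m mu)
  show ?case using ten_mult_has_count[OF alt_has_count(1) Cons, of m m] assms
    by (auto simp: add.commute split: if_splits)
qed

lemma hw_ten_weight:
  assumes mu: "is_partition mu" and i: "1 \<le> i"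
  shows "has_count (Letter i) (int (part (conjugate mu) i)) (hw_ten mu)"
proof -
  have "length (filter (\<lambda>m. i \<le> m) mu) = card {p. p < length mu \<and> i \<le> mu ! p}"
    by (rule length_filter_conv_card)
  also have "\<dots> = card {p \<in> {1..length mu}. i \<le> part mu p}"
    by (rule bij_betw_same_card[of Suc], rule bij_betw_byWitness[of _ "\<lambda>p. p - 1"])
      (auto simp: Defs.part_def)
  finally show ?thesis using hw_ten_count_Letter[OF i, of mu] part_conjugate[OF mu i] by simp
qed

lemma hw_ten_highest_weight:
  assumes "is_partition mu"
  shows "highest_weight_vector ten_scale n ten_E (\<lambda>i. of_nat (part (conjugate mu) i)) (hw_ten mu)"
  unfolding highest_weight_vector_def
  using hw_ten_nonzero hw_ten_raising ten_act_diag[OF hw_ten_weight[OF assms]] by auto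

subsection \<open>The action of the Capelli-type elements\<close>

text \<open>The virtual method for one summand: its projection has a representative in letters that
  is balanced, hence of weight zero, and acts on tensors without virtual symbols like the
  unprojected word.\<close>

lemma K_elem_term:
  assumes S: "S \<in> row_strict_tableaux n lam" and m0: "length lam \<le> m0"
  obtains f where "f \<in> carrier (tensor_alg 0 0 n)"
    "\<And>u s. u \<in> Poly_Mapping.keys f \<Longrightarrow> content u s = 0"
    "\<And>x. letters_only x \<Longrightarrow> ten.act f x = foldr ten_gen (lower_word lam S @ raise_word lam S) x"
    "virt_proj m0 m1 n
        (bitableau_monomial m0 m1 n (map (map Letter) S) (C_star lam) \<otimes>\<^bsub>U m0 m1 n\<^esub>
         bitableau_monomial m0 m1 n (C_star lam) (map (map Letter) S)) = U_class 0 0 n f"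
proof -
  let ?w = "lower_word lam S @ raise_word lam S"
  note closed = tableau_words_closed[OF S m0, of m1]
  then have w: "set ?w \<subseteq> syms m0 m1 n \<times> syms m0 m1 n" by simp
  obtain f where f: "f \<in> carrier (tensor_alg 0 0 n)" "\<And>u s. u \<in> Poly_Mapping.keys f \<Longrightarrow> content u s = 0"
    "word ?w - f \<in> irr_poly m0 m1 n"
    using balanced_word_letters[OF w tableau_words_content[OF S]] by blast
  have act: "ten.act f x = foldr ten_gen ?w x" if "letters_only x" for x
    using irr_poly_kills[OF f(3) that] unfolding ten.act_diff ten.act_word by simp
  have "bitableau_monomial m0 m1 n (map (map Letter) S) (C_star lam) \<otimes>\<^bsub>U m0 m1 n\<^esub>
      bitableau_monomial m0 m1 n (C_star lam) (map (map Letter) S) = U_class m0 m1 n (word ?w)"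
    unfolding bitableau_monomial_def lower_word_def[symmetric] raise_word_def[symmetric]
    by (simp add: U_class_mult tensor_word_closed closed word_append)
  then have "virt_proj m0 m1 n
        (bitableau_monomial m0 m1 n (map (map Letter) S) (C_star lam) \<otimes>\<^bsub>U m0 m1 n\<^esub>
         bitableau_monomial m0 m1 n (C_star lam) (map (map Letter) S)) = U_class 0 0 n f"
    using virt_proj_eqI[OF f(1) tensor_word_closed[OF w] f(3)] by simp
  with f act show thesis by (intro that) auto
qed

lemma K_elem_action:
  assumes E: "gl_module scale n E" and v: "highest_weight_vector scale n E wt v"
    and x: "highest_weight_vector ten_scale n ten_E wt x" "letters_only x"
    and m0: "length lam \<le> m0"
  obtains c where "U_act scale E (K_elem m0 m1 n lam) v = scale (\<Sum>S\<in>row_strict_tableaux n lam. c S) v"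
    "\<And>S. S \<in> row_strict_tableaux n lam \<Longrightarrow>
      foldr ten_gen (lower_word lam S @ raise_word lam S) x = ten_scale (c S) x"
proof -
  let ?R = "row_strict_tableaux n lam"
  let ?t = "\<lambda>S. virt_proj m0 m1 n
        (bitableau_monomial m0 m1 n (map (map Letter) S) (C_star lam) \<otimes>\<^bsub>U m0 m1 n\<^esub>
         bitableau_monomial m0 m1 n (C_star lam) (map (map Letter) S))"
  interpret gl_super_module scale 0 0 n "\<lambda>(a, b). E (idx a) (idx b)" by (rule gl_module_super[OF E])
  have poly_act: "poly_act scale E f v = act f v" for f by (simp add: poly_act_def act_def)
  have "\<exists>f c. f \<in> carrier (tensor_alg 0 0 n) \<and> ?t S = U_class 0 0 n f \<and> act f v = scale c v \<and>
      foldr ten_gen (lower_word lam S @ raise_word lam S) x = ten_scale c x" if S: "S \<in> ?R" for S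
  proof -
    obtain f where f: "f \<in> carrier (tensor_alg 0 0 n)"
      "\<And>u s. u \<in> Poly_Mapping.keys f \<Longrightarrow> content u s = 0"
      "\<And>x. letters_only x \<Longrightarrow> ten.act f x = foldr ten_gen (lower_word lam S @ raise_word lam S) x"
      "?t S = U_class 0 0 n f"
      by (rule K_elem_term[OF S m0, where ?m1.0 = m1]) (rule that; assumption)
    obtain c where "poly_act scale E f v = scale c v" "ten.act f x = ten_scale c x"
      using common_eigenvalue_poly[OF E v x(1) f(1,2)] by blast
    then show ?thesis using f(1,4) f(3)[OF x(2)] poly_act by metis
  qed
  then obtain f c where fc: "\<And>S. S \<in> ?R \<Longrightarrow> f S \<in> carrier (tensor_alg 0 0 n)"
    "\<And>S. S \<in> ?R \<Longrightarrow> ?t S = U_class 0 0 n (f S)"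
    "\<And>S. S \<in> ?R \<Longrightarrow> act (f S) v = scale (c S) v"
    "\<And>S. S \<in> ?R \<Longrightarrow> foldr ten_gen (lower_word lam S @ raise_word lam S) x = ten_scale (c S) x"
    by metis
  interpret R: ring "Ugl n" by (rule U_ring)
  have "K_elem m0 m1 n lam = (\<Oplus>\<^bsub>Ugl n\<^esub>S\<in>?R. U_class 0 0 n (f S))"
    unfolding K_elem_def by (rule R.finsum_cong') (use fc U_class_closed in auto)
  also have "\<dots> = U_class 0 0 n (sum f ?R)"
    by (rule finsum_U_class) (rule fc(1))
  finally have "U_act scale E (K_elem m0 m1 n lam) v = poly_act scale E (sum f ?R) v"
    using U_act_class[OF E tensor_sum_closed[of ?R f 0 0 n]] fc(1) by simp
  also have "\<dots> = scale (\<Sum>S\<in>?R. c S) v"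
    by (simp add: poly_act act_sum fc(3) scale_sum_left)
  finally show thesis using fc(4) by (intro that) auto
qed

theorem theorem4p32:
  fixes n m0 m1 :: nat and lam mu :: "nat list"
    and scale :: "complex \<Rightarrow> 'v::ab_group_add \<Rightarrow> 'v"
    and E :: "nat \<Rightarrow> nat \<Rightarrow> 'v \<Rightarrow> 'v" and v :: 'v
  assumes "n \<ge> 1"
    and "is_partition lam" and "is_partition mu"
    and "part lam 1 \<le> n" and "part mu 1 \<le> n"
    and "length lam \<le> m0"
    and "gl_irreducible scale n E"
    and "highest_weight_vector scale n E (\<lambda>i. of_nat (part (conjugate mu) i)) v"
  shows "(sum_list mu < sum_list lam \<longrightarrow> U_act scale E (K_elem m0 m1 n lam) v = 0) \<and>
    (sum_list mu = sum_list lam \<and> \<not> lam \<unlhd>\<^sub>d mu \<longrightarrow> U_act scale E (K_elem m0 m1 n lam) v = 0) \<and>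
    (mu = lam \<longrightarrow> U_act scale E (K_elem m0 m1 n lam) v =
       scale ((- 1) ^ (sum_list lam choose 2) * of_nat (hook_product lam)) v) \<and>
    hook_product (conjugate lam) = hook_product lam"
proof -
  let ?R = "row_strict_tableaux n lam" and ?x = "hw_ten mu"
  have E: "gl_module scale n E" using assms(7) by (simp add: gl_irreducible_def)
  interpret gl_module scale n E by (rule E)
  note wt = hw_ten_weight[OF assms(3)]
  obtain c where K: "U_act scale E (K_elem m0 m1 n lam) v = scale (\<Sum>S\<in>?R. c S) v"
    and c: "\<And>S. S \<in> ?R \<Longrightarrow> foldr ten_gen (lower_word lam S @ raise_word lam S) ?x = ten_scale (c S) ?x"
    using K_elem_action[OF E assms(8) hw_ten_highest_weight[OF assms(3)] hw_ten_letters_only assms(6), of m1]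
    by blast
  \<comment> \<open>As \<open>?x\<close> is nonzero, the scalar vanishes as soon as the word kills
    \<open>?x\<close>.\<close>
  have not_fits: "c S = 0" if "S \<in> ?R" "\<not> fits mu S" for S
    using c[OF that(1)] not_fits_vanish[OF that(1) wt that(2)] hw_ten_nonzero[of mu]
      ten.scale_eq_0_iff[of "c S" ?x] by metis
  have "U_act scale E (K_elem m0 m1 n lam) v = 0" if "sum_list mu < sum_list lam"
  proof -
    have "\<not> fits mu S" if "S \<in> ?R" for S
      using fits_size[OF assms(3,5) that] \<open>sum_list mu < sum_list lam\<close> by linarith
    then show ?thesis by (simp add: K not_fits)
  qed
  moreover have "U_act scale E (K_elem m0 m1 n lam) v = 0"
    if "sum_list mu = sum_list lam" "\<not> lam \<unlhd>\<^sub>d mu"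
  proof -
    have "\<not> fits mu S" if "S \<in> ?R" for S
      using fits_dominance[OF assms(3,5) that] \<open>sum_list mu = sum_list lam\<close> \<open>\<not> lam \<unlhd>\<^sub>d mu\<close>
      unfolding dominated_by_def by metis
    then show ?thesis by (simp add: K not_fits)
  qed
  moreover have "U_act scale E (K_elem m0 m1 n lam) v =
      scale ((- 1) ^ (sum_list lam choose 2) * of_nat (hook_product lam)) v" if "mu = lam"
  proof -
    let ?D = "first_tableau lam"
    have D: "?D \<in> ?R" by (rule first_tableau_row_strict[OF assms(2,4)])
    have "(\<Sum>S\<in>?R. c S) = (\<Sum>S\<in>{?D}. c S)"
      by (rule sum.mono_neutral_right)
        (use D not_fits fits_unique[OF assms(2,4)] that row_strict_tableaux_finite in auto)
    moreover have "ten_scale (c ?D) ?x =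
        ten_scale ((- 1) ^ (sum_list lam choose 2) * of_nat (hook_product lam)) ?x"
      unfolding c[OF D, symmetric]
      by (rule first_tableau_action[OF assms(2) hw_ten_letters_only]) (use hw_ten_raising wt that in auto)
    then have "c ?D = (- 1) ^ (sum_list lam choose 2) * of_nat (hook_product lam)"
      using hw_ten_nonzero[of mu] by (metis ten.scale_right_imp_eq)
    ultimately show ?thesis by (simp add: K)
  qed
  ultimately show ?thesis using hook_product_conjugate[OF assms(2)] by blast
qed

end
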